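(* Let $a_0 = 1.3145271093265$. There exists an open neighborhood $B\subset\mathbb{R}$ of $b=-0.3$ such that for every $b\in B$ there is a parameter value $a\in [a_0-10^{-5},\,a_0+10^{-5}]$ for which the Hénon map $H_{a,b}(x,y)=(a-x^2+by,\;x)$ has a quadratic homoclinic tangency, unfolding generically (with respect to the parameter $a$), for its fixed point $(x_{a,b},y_{a,b})$ given by \[ x_{a,b}=y_{a,b}=\tfrac{1}{2}\left(b-\sqrt{(b-1)^2+4a}-1\right) \] (for $a=a_0$, $b=-0.3$ this fixed point is approximately $(-1.9679632427827796,\,-1.9679632427827796)$).
   Context: The Hénon map is $H_{a,b}:\mathbb{R}^2\to\mathbb{R}^2$, $H_{a,b}(x,y)=(a-x^2+by,\,x)$, a diffeomorphism for $b\neq 0$. For the parameter values considered, the fixed point $p_{a,b}=(x_{a,b},y_{a,b})$ is a hyperbolic saddle, so it has one-dimensional stable and unstable manifolds $W^s(p_{a,b})$, $W^u(p_{a,b})$. A homoclinic tangency for $p_{a,b}$ is a point $q\neq p_{a,b}$ lying in $W^s(p_{a,b})\cap W^u(p_{a,b})$ at which the two curves are tangent (the intersection is non-transversal). The tangency is quadratic if the two curves have exactly quadratic (second-order, not higher) contact at $q$, i.e. in local coordinates in which $W^s$ near $q$ is a graph and $W^u$ near $q$ is a graph over the same tangent line, their difference has a nondegenerate (nonzero second derivative) critical point at $q$. It unfolds generically in the one-parameter family $a\mapsto H_{a,b}$ if, as $a$ varies through the tangency value, the (continuously continued) local stable and unstable manifold pieces near $q$ move relative to each other with nonzero speed, i.e.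 the signed distance between them measured along a fixed line transversal to the common tangent has nonzero derivative with respect to $a$ at the tangency parameter. *)

theory Defs
  imports "HOL-Analysis.Analysis"
begin

definition henon :: "real \<Rightarrow> real \<Rightarrow> real \<times> real \<Rightarrow> real \<times> real" where
  "henon a b = (\<lambda>(x, y). (a - x ^ 2 + b * y, x))"

definition henon_fp :: "real \<Rightarrow> real \<Rightarrow> real \<times> real" where
  "henon_fp a b = (let x = (b - sqrt ((b - 1) ^ 2 + 4 * a) - 1) / 2 in (x, x))"

definition stable_set :: "real \<Rightarrow> real \<Rightarrow> real \<times> real \<Rightarrow> (real \<times> real) set" where
  "stable_set a b p = {z. (\<lambda>n. (henon a b ^^ n) z) \<longlonglongrightarrow> p}"

text \<open>Unstable set: points having a backward orbit converging to p
  (for b \<noteq> 0 the map is a diffeomorphism, so the backward orbit is unique).\<close>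
definition unstable_set :: "real \<Rightarrow> real \<Rightarrow> real \<times> real \<Rightarrow> (real \<times> real) set" where
  "unstable_set a b p = {z. \<exists>s :: nat \<Rightarrow> real \<times> real. s 0 = z \<and>
      (\<forall>n. henon a b (s (Suc n)) = s n) \<and> s \<longlonglongrightarrow> p}"

text \<open>Quadratic homoclinic tangency for p_{a,b} at parameter a, unfolding generically in a.
  There is a point q \<noteq> p_{a,b}, a tangent direction v and a transversal direction w, and,
  for all parameters a' near a, graphs t \<mapsto> q + t v + fs a' t w (resp. fu a' t w),
  |t| < \<delta>, lying in the stable (resp. unstable) manifold of p_{a',b}, depending continuously
  on (a',t) (continuation of the local pieces), such that at a' = a both graphs pass through q
  tangent to v, the difference fs a - fu a has a nondegenerate critical point at 0
  (quadratic contact), and the signed distance fs a' 0 - fu a' 0 along the line q + s w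
  has nonzero derivative in a' at a (generic unfolding).\<close>
definition quadratic_generic_homoclinic_tangency :: "real \<Rightarrow> real \<Rightarrow> bool" where
  "quadratic_generic_homoclinic_tangency a b \<longleftrightarrow>
    (\<exists>q v w \<epsilon> \<delta> fs fu fs' fu' fs'' fu'' D.
       q \<noteq> henon_fp a b \<and>
       fst v * snd w - snd v * fst w \<noteq> 0 \<and>
       \<epsilon> > 0 \<and> \<delta> > 0 \<and>
       (\<forall>a' \<in> {a - \<epsilon> <..< a + \<epsilon>}. \<forall>t \<in> {-\<delta> <..< \<delta>}.
          q + t *\<^sub>R v + fs a' t *\<^sub>R w \<in> stable_set a' b (henon_fp a' b) \<and>
          q + t *\<^sub>R v + fu a' t *\<^sub>R w \<in> unstable_set a' b (henon_fp a' b)) \<and>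
       continuous_on ({a - \<epsilon> <..< a + \<epsilon>} \<times> {-\<delta> <..< \<delta>}) (\<lambda>(a', t). fs a' t) \<and>
       continuous_on ({a - \<epsilon> <..< a + \<epsilon>} \<times> {-\<delta> <..< \<delta>}) (\<lambda>(a', t). fu a' t) \<and>
       fs a 0 = 0 \<and> fu a 0 = 0 \<and>
       (\<forall>t \<in> {-\<delta> <..< \<delta>}. (fs a has_real_derivative fs' t) (at t) \<and>
                              (fu a has_real_derivative fu' t) (at t)) \<and>
       fs' 0 = 0 \<and> fu' 0 = 0 \<and>
       (fs' has_real_derivative fs'') (at 0) \<and> (fu' has_real_derivative fu'') (at 0) \<and>
       fs'' \<noteq> fu'' \<and>
       ((\<lambda>a'. fs a' 0 - fu a' 0) has_real_derivative D) (at a) \<and> D \<noteq> 0)"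

end

theory Submission
  imports Defs
begin

text \<open>Both invariant manifolds of the saddle are parametrised by rapidly convergent power series that linearise
  the map, so finitely many iterates bring them to explicit curves meeting near (-1.655, 1.725). There the
  stable curve is a graph over y; the horizontal gap d between the curves is, in the unstable parameter u,
  uniformly convex (d_uu > 8700) and strictly decreasing in the unstable eigenvalue l (d_l < -3.2), while at
  one explicit point d and d_u are tiny. Hence the minimum of d over u changes sign as l increases, which gives
  a tangency; it is quadratic because d_uu \<noteq> 0 and unfolds generically because d_l \<noteq> 0. The inequalities
  are verified by integer ball arithmetic on derivatives, simultaneously for all b within 10^-9 of -0.3.\<close>

section \<open>Implicitly defined branches\<close>

text \<open>Using the unstable eigenvalue l in place of a keeps the computation rational: the fixed
  point, a, the stable eigenvalue -b / l and all series coefficients are rational in b and l, so the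
  verified arithmetic needs only ring operations and reciprocals. No invariant manifold theorem
  enters: convergence of orbits is read off from the linearising equation.

  The numerical obstacle is strong stretching. Four iterates amplify errors and ball arithmetic
  overestimates on boxes, so the boxes must be tiny (about 3e-6 in l, 1e-4 in u), yet monotonicity
  and convexity across them must still beat the error at the centre. Hence a division of labour:
  derivatives of the gap are bounded on whole boxes, where crude enclosures suffice, while the gap
  and its slope are evaluated only at the centre. Finding the zero by minimisation instead of a
  two-dimensional Newton argument avoids the mixed derivative d_lu, which is why jets have exactly
  four components.\<close>

lemma has_derivative_compose_pair:
  assumes F: "((\<lambda>(x, y). F x y) has_derivative (\<lambda>(h, k). a * h + b * k)) (at (p z, q z))"
    and p: "(p has_derivative p') (at z)" and q: "(q has_derivative q') (at z)"
  shows "((\<lambda>z. F (p z) (q z)) has_derivative (\<lambda>h. a * p' h + b * q' h :: real)) (at z)"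
proof -
  have "((\<lambda>z. (p z, q z)) has_derivative (\<lambda>h. (p' h, q' h))) (at z)"
    by (intro has_derivative_Pair p q)
  from has_derivative_compose[OF this F] show ?thesis by simp
qed

lemma has_real_derivative_compose_pair:
  fixes F :: "real \<Rightarrow> real \<Rightarrow> real"
  assumes F: "((\<lambda>(x, y). F x y) has_derivative (\<lambda>(h, k). a * h + b * k)) (at (p z, q z))"
    and p: "(p has_real_derivative p') (at z)" and q: "(q has_real_derivative q') (at z)"
  shows "((\<lambda>z. F (p z) (q z)) has_real_derivative a * p' + b * q') (at z)"
  using has_derivative_compose_pair[OF F p[unfolded has_field_derivative_def] q[unfolded has_field_derivative_def]]
  unfolding has_field_derivative_def
  by (rule has_derivative_eq_rhs) (auto simp: algebra_simps)

lemma partial_fst: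
  fixes F :: "real \<Rightarrow> real \<Rightarrow> real"
  assumes "((\<lambda>(x, y). F x y) has_derivative (\<lambda>(h, k). a * h + b * k)) (at (x, y))"
  shows "((\<lambda>x. F x y) has_real_derivative a) (at x)"
  using has_real_derivative_compose_pair[of F a b "\<lambda>x. x" x "\<lambda>_. y" 1 0] assms by simp

lemma partial_snd:
  fixes F :: "real \<Rightarrow> real \<Rightarrow> real"
  assumes "((\<lambda>(x, y). F x y) has_derivative (\<lambda>(h, k). a * h + b * k)) (at (x, y))"
  shows "(F x has_real_derivative b) (at y)"
  using has_real_derivative_compose_pair[of F a b "\<lambda>_. x" y "\<lambda>y. y" 0 1] assms by simp

text \<open>Strict monotonicity in s gives the branch on the whole explicit set \<open>V\<close>, as
  the numerical boxes require; a local implicit function theorem would give a neighbourhood of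
  unknown size. Monotonicity also makes the inverse continuous, after which its derivative comes
  from inverting the triangular map (l, s) to (l, F l s).\<close>

lemma implicit_branch:
  fixes F Fl Fs :: "real \<Rightarrow> real \<Rightarrow> real"
  assumes L: "open L" and s: "s1 < s2"
    and der: "\<And>l s. l \<in> L \<Longrightarrow> s \<in> {s1..s2} \<Longrightarrow>
      ((\<lambda>(l, s). F l s) has_derivative (\<lambda>(h, k). Fl l s * h + Fs l s * k)) (at (l, s))"
    and pos: "\<And>l s. l \<in> L \<Longrightarrow> s \<in> {s1..s2} \<Longrightarrow> Fs l s > 0"
  defines "V \<equiv> {(l, y). l \<in> L \<and> F l s1 < y \<and> y < F l s2}"
  obtains S where "open V"
    "\<And>l y. (l, y) \<in> V \<Longrightarrow> S l y \<in> {s1<..<s2} \<and> F l (S l y) = y"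
    "\<And>l s. l \<in> L \<Longrightarrow> s \<in> {s1<..<s2} \<Longrightarrow> (l, F l s) \<in> V \<and> S l (F l s) = s"
    "\<And>l y. (l, y) \<in> V \<Longrightarrow> ((\<lambda>(l, y). S l y) has_derivative
      (\<lambda>(h, k). (- Fl l (S l y) / Fs l (S l y)) * h + (1 / Fs l (S l y)) * k)) (at (l, y))"
proof -
  have mono: "F l x < F l y" if "l \<in> L" "s1 \<le> x" "x < y" "y \<le> s2" for l x y
  proof (rule DERIV_pos_imp_increasing[OF \<open>x < y\<close>])
    fix t assume "x \<le> t" "t \<le> y"
    with that have t: "t \<in> {s1..s2}" by auto
    show "\<exists>d. (F l has_real_derivative d) (at t) \<and> 0 < d"
      using partial_snd[OF der[OF that(1) t]] pos[OF that(1) t] by blast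
  qed
  have contF: "isCont (\<lambda>l. F l x) l" if "l \<in> L" "x \<in> {s1..s2}" for l x
    using partial_fst[OF der[OF that]] by (rule DERIV_isCont)
  define S where "S l y = (SOME s. s \<in> {s1<..<s2} \<and> F l s = y)" for l y
  have S: "S l y \<in> {s1<..<s2} \<and> F l (S l y) = y" if "(l, y) \<in> V" for l y
  proof -
    from that have l: "l \<in> L" and y: "F l s1 < y" "y < F l s2" by (auto simp: V_def)
    have "continuous_on {s1..s2} (F l)"
      by (intro continuous_at_imp_continuous_on ballI DERIV_isCont[OF partial_snd[OF der[OF l]]])
    from IVT'[of "F l" s1 y s2, OF _ _ _ this] y s
    obtain x where x: "s1 \<le> x" "x \<le> s2" "F l x = y" by force
    with y have "x \<in> {s1<..<s2}" by (cases "x = s1"; cases "x = s2") auto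
    with x(3) have "\<exists>s. s \<in> {s1<..<s2} \<and> F l s = y" by blast
    then show ?thesis unfolding S_def by (rule someI_ex)
  qed
  have inV: "(l, F l x) \<in> V" if "l \<in> L" "x \<in> {s1<..<s2}" for l x
    using that mono[of l s1 x] mono[of l x s2] by (auto simp: V_def)
  have S_F: "S l (F l x) = x" if "l \<in> L" "x \<in> {s1<..<s2}" for l x
  proof (rule ccontr)
    assume ne: "S l (F l x) \<noteq> x"
    note * = S[OF inV[OF that]]
    show False
      using mono[of l x "S l (F l x)"] mono[of l "S l (F l x)" x] ne * that
      by (cases "x < S l (F l x)") auto
  qed
  \<comment> \<open>Strict inequalities at fixed abscissae persist near (l, y); this serves both
    openness of \<open>V\<close> and continuity of \<open>S\<close>.\<close>
  have ev: "\<forall>\<^sub>F z in nhds (l, y). fst z \<in> L \<and> F (fst z) x1 < snd z \<and> snd z < F (fst z) x2"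
    if "l \<in> L" "x1 \<in> {s1..s2}" "x2 \<in> {s1..s2}" "F l x1 < y" "y < F l x2" for l y x1 x2
  proof -
    have f: "(fst \<longlongrightarrow> l) (nhds (l, y))"
      using tendsto_fst[OF filterlim_ident[of "nhds (l, y)"]] by simp
    have g: "(snd \<longlongrightarrow> y) (nhds (l, y))"
      using tendsto_snd[OF filterlim_ident[of "nhds (l, y)"]] by simp
    have c: "((\<lambda>z. F (fst z) x) \<longlongrightarrow> F l x) (nhds (l, y))" if "x \<in> {s1..s2}" for x
      using isCont_tendsto_compose[OF contF[OF \<open>l \<in> L\<close> that] f] .
    have 1: "\<forall>\<^sub>F z in nhds (l, y). fst z \<in> L"
      using topological_tendstoD[OF f L \<open>l \<in> L\<close>] .
    have 2: "\<forall>\<^sub>F z in nhds (l, y). 0 < snd z - F (fst z) x1"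
      by (rule order_tendstoD[OF tendsto_diff[OF g c[OF that(2)]]]) (use that in auto)
    have 3: "\<forall>\<^sub>F z in nhds (l, y). 0 < F (fst z) x2 - snd z"
      by (rule order_tendstoD[OF tendsto_diff[OF c[OF that(3)] g]]) (use that in auto)
    show ?thesis using 1 2 3 by eventually_elim auto
  qed
  have openV: "open V"
    unfolding open_subopen[of V]
  proof
    fix z assume z: "z \<in> V"
    obtain l y where ly: "z = (l, y)" by force
    have "\<forall>\<^sub>F z in nhds (l, y). fst z \<in> L \<and> F (fst z) s1 < snd z \<and> snd z < F (fst z) s2"
      by (rule ev) (use z s in \<open>auto simp: V_def ly\<close>)
    then obtain T where T: "open T" "(l, y) \<in> T" "\<And>z. z \<in> T \<Longrightarrow> fst z \<in> L \<and> F (fst z) s1 < snd z \<and> snd z < F (fst z) s2"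
      unfolding eventually_nhds by blast
    show "\<exists>T. open T \<and> z \<in> T \<and> T \<subseteq> V"
      by (intro exI[of _ T] conjI) (use T in \<open>auto simp: ly V_def\<close>)
  qed
  have contS: "isCont (\<lambda>(l, y). S l y) (l, y)" if v: "(l, y) \<in> V" for l y
    unfolding isCont_def
  proof (rule tendstoI)
    fix e :: real assume e: "e > 0"
    have l: "l \<in> L" using v by (auto simp: V_def)
    define x where "x = S l y"
    have x: "x \<in> {s1<..<s2}" "F l x = y" using S[OF v] by (auto simp: x_def)
    \<comment> \<open>Averaging with the endpoints keeps \<open>x1\<close> and \<open>x2\<close>
      inside the interval, and \<open>e / 2\<close> keeps them close to x; by monotonicity the
      solution for any nearby (l', y') is trapped between them.\<close>
    define x1 where "x1 = max ((s1 + x) / 2) (x - e / 2)"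
    define x2 where "x2 = min ((s2 + x) / 2) (x + e / 2)"
    have x12: "s1 \<le> x1" "x1 < x" "x < x2" "x2 \<le> s2" "x - x1 < e" "x2 - x < e"
      using x e by (auto simp: x1_def x2_def max_def min_def field_simps)
    have "\<forall>\<^sub>F z in nhds (l, y). fst z \<in> L \<and> F (fst z) x1 < snd z \<and> snd z < F (fst z) x2"
      by (rule ev) (use x x12 l mono[of l x1 x] mono[of l x x2] in auto)
    moreover have "\<forall>\<^sub>F z in nhds (l, y). z \<in> V"
      using openV v by (rule eventually_nhds_in_open)
    ultimately have "\<forall>\<^sub>F z in nhds (l, y). dist (case z of (l, y) \<Rightarrow> S l y) x < e"
    proof eventually_elim
      case (elim z)
      obtain l' y' where z: "z = (l', y')" by force
      define w where "w = S l' y'"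
      have w: "w \<in> {s1<..<s2}" "F l' w = y'" using S[of l' y'] elim by (auto simp: z w_def)
      have "x1 < w"
        using mono[of l' w x1] elim w x12 by (cases "w < x1"; cases "w = x1") (auto simp: z)
      moreover have "w < x2"
        using mono[of l' x2 w] elim w x12 by (cases "x2 < w"; cases "w = x2") (auto simp: z)
      ultimately show ?case using x12 by (auto simp: z w_def[symmetric] dist_real_def)
    qed
    then show "\<forall>\<^sub>F z in at (l, y). dist (case z of (l, y) \<Rightarrow> S l y) (case (l, y) of (l, y) \<Rightarrow> S l y) < e"
      unfolding x_def by (auto simp: eventually_at_filter elim: eventually_mono)
  qed
  have derS: "((\<lambda>(l, y). S l y) has_derivative
      (\<lambda>(h, k). (- Fl l (S l y) / Fs l (S l y)) * h + (1 / Fs l (S l y)) * k)) (at (l, y))"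
    if v: "(l, y) \<in> V" for l y
  proof -
    define x where "x = S l y"
    have l: "l \<in> L" using v by (auto simp: V_def)
    have x: "x \<in> {s1<..<s2}" "x \<in> {s1..s2}" "F l x = y" using S[OF v] by (auto simp: x_def)
    have nz: "Fs l x > 0" using pos[OF l x(2)] .
    have df: "((\<lambda>(l, s). (l, F l s)) has_derivative (\<lambda>(h, k). (h, Fl l x * h + Fs l x * k)))
      (at ((\<lambda>(l, y). (l, S l y)) (l, y)))"
    proof -
      have "((\<lambda>z. (fst z, F (fst z) (snd z))) has_derivative (\<lambda>h. (fst h, Fl l x * fst h + Fs l x * snd h))) (at (l, x))"
      proof (rule has_derivative_Pair)
        show "(fst has_derivative fst) (at (l, x))" by (rule bounded_linear_imp_has_derivative[OF bounded_linear_fst])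
        show "((\<lambda>z. F (fst z) (snd z)) has_derivative (\<lambda>h. Fl l x * fst h + Fs l x * snd h)) (at (l, x))"
          using der[OF l x(2)] by (simp add: case_prod_unfold)
      qed
      then show ?thesis by (simp add: case_prod_unfold x_def)
    qed
    have "((\<lambda>(l, y). (l, S l y)) has_derivative (\<lambda>(h, k). (h, (k - Fl l x * h) / Fs l x))) (at (l, y))"
    proof (rule has_derivative_inverse_basic[where f = "\<lambda>(l, s). (l, F l s)" and g = "\<lambda>(l, y). (l, S l y)" and y = "(l, y)" and T = V, OF df _ _ _ openV v])
      have "bounded_linear (\<lambda>z :: real \<times> real. (fst z, (snd z - Fl l x * fst z) / Fs l x))"
        by (intro bounded_linear_Pair bounded_linear_fst bounded_linear_divide[THEN bounded_linear_compose]
            bounded_linear_sub bounded_linear_snd bounded_linear_const_mult)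
      then show "bounded_linear (\<lambda>(h, k). (h, (k - Fl l x * h) / Fs l x))"
        by (simp add: case_prod_unfold)
      show "(\<lambda>(h, k). (h, (k - Fl l x * h) / Fs l x)) \<circ> (\<lambda>(h, k). (h, Fl l x * h + Fs l x * k)) = id"
        using nz by (auto simp: fun_eq_iff)
      have "isCont (\<lambda>z. (fst z, (\<lambda>(l, y). S l y) z)) (l, y)"
        by (intro continuous_intros contS v)
      then show "isCont (\<lambda>(l, y). (l, S l y)) (l, y)"
        by (simp add: case_prod_unfold)
      show "(\<lambda>(l, s). (l, F l s)) ((\<lambda>(l, y). (l, S l y)) z) = z" if "z \<in> V" for z
        using S[of "fst z" "snd z"] that by (auto simp: case_prod_unfold)
    qed
    from has_derivative_snd[OF this]
    have "((\<lambda>z. S (fst z) (snd z)) has_derivative (\<lambda>h. (snd h - Fl l x * fst h) / Fs l x)) (at (l, y))"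
      by (simp add: case_prod_unfold)
    then show ?thesis
      unfolding x_def[symmetric] case_prod_unfold
      by (rule has_derivative_eq_rhs) (simp add: fun_eq_iff diff_divide_distrib)
  qed
  show ?thesis
    by (rule that[of S]) (use openV S inV S_F derS in auto)
qed

text \<open>The zero is found at the least l for which d l takes a value \<le> 0 on the compact u-interval: by minimality
  d l vanishes there and is nonnegative elsewhere, so u is a minimum, and the bounds keep it away from the boundary.\<close>

lemma convex_family_touches_zero:
  fixes d dl du duu :: "real \<Rightarrow> real \<Rightarrow> real"
  assumes LU: "{l0 - h..l0 + h} \<subseteq> L" "{u0 - k..u0 + k} \<subseteq> U" and hk: "h > 0" "k > 0"
    and der: "\<And>l u. l \<in> L \<Longrightarrow> u \<in> U \<Longrightarrow>
      ((\<lambda>(l, u). d l u) has_derivative (\<lambda>(x, y). dl l u * x + du l u * y)) (at (l, u))"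
    and der2: "\<And>l u. l \<in> L \<Longrightarrow> u \<in> U \<Longrightarrow> (du l has_real_derivative duu l u) (at u)"
    and dl: "\<And>l u. l \<in> L \<Longrightarrow> u \<in> U \<Longrightarrow> - D2 \<le> dl l u \<and> dl l u \<le> - D1"
    and duu: "\<And>l u. l \<in> L \<Longrightarrow> u \<in> U \<Longrightarrow> c \<le> duu l u"
    and e: "\<bar>d l0 u0\<bar> \<le> e0" "\<bar>du l0 u0\<bar> \<le> e1"
    and small: "e0 + e1 * k < D1 * h" "e0 + e1 * k + D2 * h < c * k\<^sup>2 / 2"
    and c: "0 \<le> c"
  obtains l u where "l \<in> {l0 - h<..<l0 + h}" "u \<in> {u0 - k<..<u0 + k}" "d l u = 0" "du l u = 0"
proof -
  let ?I = "{l0 - h..l0 + h}" and ?J = "{u0 - k..u0 + k}"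
  have in_L: "l \<in> L" if "l \<in> ?I" for l using LU that by blast
  have in_U: "u \<in> U" if "u \<in> ?J" for u using LU that by blast
  have pl: "((\<lambda>l. d l u) has_real_derivative dl l u) (at l)" if "l \<in> ?I" "u \<in> ?J" for l u
    using partial_fst[OF der[OF in_L[OF that(1)] in_U[OF that(2)]]] .
  have pu: "(d l has_real_derivative du l u) (at u)" if "l \<in> ?I" "u \<in> ?J" for l u
    using partial_snd[OF der[OF in_L[OF that(1)] in_U[OF that(2)]]] .
  have l0: "l0 \<in> ?I" and u0: "u0 \<in> ?J" using hk by auto
  have incr: "D1 * (l' - l) \<le> d l u - d l' u \<and> d l u - d l' u \<le> D2 * (l' - l)"
    if "l \<in> ?I" "l' \<in> ?I" "l \<le> l'" "u \<in> ?J" for l l' u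
  proof (cases "l = l'")
    case False
    with that have lt: "l < l'" by simp
    have "\<exists>z. l < z \<and> z < l' \<and> d l' u - d l u = (l' - l) * dl z u"
      by (rule MVT2[OF lt]) (use pl that in auto)
    then obtain z where z: "l < z" "z < l'" "d l' u - d l u = (l' - l) * dl z u" by blast
    have "- D2 \<le> dl z u \<and> dl z u \<le> - D1" by (rule dl) (use in_L in_U z that in auto)
    then have "(l' - l) * - D2 \<le> (l' - l) * dl z u" "(l' - l) * dl z u \<le> (l' - l) * - D1"
      using lt by (intro mult_left_mono; simp)+
    then show ?thesis using z(3) by (simp add: algebra_simps)
  qed simp
  \<comment> \<open>Taylor expansion only on the slice \<open>l0\<close>, where the values of
    \<open>d\<close> and \<open>du\<close> are controlled; \<open>incr\<close> carries the bound to
    other l.\<close>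
  have conv: "d l0 u \<ge> d l0 u0 + du l0 u0 * (u - u0) + c * (u - u0)\<^sup>2 / 2" if u: "u \<in> ?J" for u
  proof (cases "u = u0")
    case False
    define D where "D m = (if m = 0 then d l0 else if m = 1 then du l0 else duu l0)" for m :: nat
    have "\<exists>t. (if u < u0 then u < t \<and> t < u0 else u0 < t \<and> t < u) \<and>
        d l0 u = (\<Sum>m<2. (D m u0 / fact m) * (u - u0) ^ m) + (D 2 t / fact 2) * (u - u0) ^ 2"
    proof (rule Taylor[of 2 D "d l0" "u0 - k" "u0 + k"])
      show "\<forall>m t. m < 2 \<and> u0 - k \<le> t \<and> t \<le> u0 + k \<longrightarrow> (D m has_real_derivative D (Suc m) t) (at t)"
      proof (intro allI impI)
        fix m t assume "m < (2 :: nat) \<and> u0 - k \<le> t \<and> t \<le> u0 + k"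
        then have "m = 0 \<or> m = 1" and t: "t \<in> ?J" by auto
        then show "(D m has_real_derivative D (Suc m) t) (at t)"
          using pu[OF l0 t] der2[OF in_L[OF l0] in_U[OF t]] by (auto simp: D_def)
      qed
    qed (use u u0 False in \<open>auto simp: D_def\<close>)
    then obtain t where t: "if u < u0 then u < t \<and> t < u0 else u0 < t \<and> t < u"
      "d l0 u = d l0 u0 + du l0 u0 * (u - u0) + duu l0 t / 2 * (u - u0)\<^sup>2"
      by (auto simp: D_def numeral_2_eq_2)
    have "t \<in> ?J" using t(1) u by (auto split: if_splits)
    from duu[OF in_L[OF l0] in_U[OF this]]
    have "c / 2 * (u - u0)\<^sup>2 \<le> duu l0 t / 2 * (u - u0)\<^sup>2" by (intro mult_right_mono) auto
    then show ?thesis using t(2) by simp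
  qed simp
  have lin: "du l0 u0 * (u - u0) \<ge> - (e1 * k)" if "u \<in> ?J" for u
  proof -
    have "\<bar>du l0 u0 * (u - u0)\<bar> \<le> e1 * k"
      unfolding abs_mult using that e(2) by (intro mult_mono) auto
    then show ?thesis by linarith
  qed
  have "0 \<le> D1 * h" using small(1) e hk by (smt (verit) mult_nonneg_nonneg)
  then have D1: "0 \<le> D1" using hk by (simp add: zero_le_mult_iff)
  then have D2: "0 \<le> D2" using dl[OF in_L[OF l0] in_U[OF u0]] by linarith
  \<comment> \<open>First inequality of \<open>small\<close>: moving left by h raises d by at least
    \<open>D1 * h\<close>, more than the errors at the centre can take away.\<close>
  have low: "d (l0 - h) u > 0" if u: "u \<in> ?J" for u
  proof -
    have "c * (u - u0)\<^sup>2 / 2 \<ge> 0" using c by simp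
    then show ?thesis
      using incr[of "l0 - h" l0 u] conv[OF u] lin[OF u] e(1) small(1) u hk by auto
  qed
  \<comment> \<open>Second inequality of \<open>small\<close>: at distance k the parabola outweighs
    the errors and the largest drop \<open>D2 * h\<close>, so no zero sits on the boundary in
    u.\<close>
  have edge: "d l u > 0" if l: "l \<in> ?I" and u: "u = u0 - k \<or> u = u0 + k" for l u
  proof -
    have uJ: "u \<in> ?J" using u hk by auto
    have k2: "(u - u0)\<^sup>2 = k\<^sup>2" using u by auto
    have "d l0 u - d l u \<le> D2 * h"
    proof (cases "l \<le> l0")
      case True
      then have "0 \<le> D1 * (l0 - l)" "0 \<le> D2 * h" using D1 D2 hk by simp_all
      then show ?thesis using incr[OF l l0 True uJ] by linarith
    next
      case False
      have "D2 * (l - l0) \<le> D2 * h" using D2 l by (intro mult_left_mono) auto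
      then show ?thesis using incr[OF l0 l _ uJ] False by linarith
    qed
    then show ?thesis using conv[OF uJ] lin[OF uJ] e(1) small(2) unfolding k2 by linarith
  qed
  \<comment> \<open>Makes \<open>Z\<close> nonempty.\<close>
  have high: "d (l0 + h) u0 < 0"
  proof -
    have "0 \<le> e1 * k" using e hk by (auto intro: mult_nonneg_nonneg order_trans[OF abs_ge_zero])
    moreover have "D1 * h \<le> d l0 u0 - d (l0 + h) u0"
      using incr[of l0 "l0 + h" u0] hk by auto
    ultimately show ?thesis using e(1) small(1) by linarith
  qed
  define Z where "Z = {z \<in> ?I \<times> ?J. (\<lambda>(l, u). d l u) z \<le> 0}"
  have contd: "continuous_on (?I \<times> ?J) (\<lambda>(l, u). d l u)"
    by (intro continuous_at_imp_continuous_on ballI)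
      (auto intro!: has_derivative_continuous[OF der] in_L in_U)
  have "closed Z" unfolding Z_def
    by (rule continuous_on_closed_Collect_le[OF contd]) (auto intro!: continuous_intros closed_Times)
  moreover have "Z \<subseteq> ?I \<times> ?J" unfolding Z_def by blast
  ultimately have "compact Z"
    using compact_Times[of ?I ?J] compact_Int_closed[of "?I \<times> ?J" Z]
    by (simp add: Int_absorb1)
  moreover have "(l0 + h, u0) \<in> Z" using high hk by (auto simp: Z_def)
  ultimately have "\<exists>z\<in>Z. \<forall>z'\<in>Z. fst z \<le> fst z'"
    by (intro continuous_attains_inf continuous_on_fst continuous_on_id) auto
  then obtain z where z: "z \<in> Z" "\<And>z'. z' \<in> Z \<Longrightarrow> fst z \<le> fst z'" by blast
  obtain l u where lu: "z = (l, u)" by force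
  from z lu have l: "l \<in> ?I" and u: "u \<in> ?J" and du0: "d l u \<le> 0" by (auto simp: Z_def)
  have l': "l0 - h < l" using low[OF u] du0 l by (cases "l = l0 - h") auto
  have nonneg: "0 \<le> d l v" if v: "v \<in> ?J" for v
  proof (rule ccontr)
    assume "\<not> 0 \<le> d l v"
    then have neg: "d l v < 0" by simp
    \<comment> \<open>A leftward step this short raises d by at most \<open>- d l v\<close>, so the
      shifted point would still lie in \<open>Z\<close>, against minimality of l. The summand 1
      keeps the denominator positive when \<open>D2\<close> is 0.\<close>
    define m where "m = min (l - (l0 - h)) (- d l v / (D2 + 1))"
    have m: "0 < m" "m \<le> l - (l0 - h)" using neg l' D2 by (auto simp: m_def divide_neg_pos)
    have "D2 * m \<le> (D2 + 1) * (- d l v / (D2 + 1))"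
      using D2 m by (intro mult_mono) (auto simp: m_def)
    also have "\<dots> = - d l v" using D2 by simp
    finally have "D2 * m \<le> - d l v" .
    moreover have "l - m \<in> ?I" using m l by auto
    moreover from this have "d (l - m) v - d l v \<le> D2 * m" using incr[of "l - m" l v] l v m by simp
    ultimately have "(l - m, v) \<in> Z" using v by (auto simp: Z_def)
    from z(2)[OF this] m show False by (simp add: lu)
  qed
  have d0: "d l u = 0" using nonneg[OF u] du0 by simp
  have u': "u \<in> {u0 - k<..<u0 + k}"
    using edge[OF l, of u] d0 u by (cases "u = u0 - k"; cases "u = u0 + k") auto
  have "du l u = 0"
  proof (rule DERIV_local_min[OF pu[OF l u]])
    show "0 < min (u - (u0 - k)) (u0 + k - u)" using u' by auto
    show "\<forall>y. \<bar>u - y\<bar> < min (u - (u0 - k)) (u0 + k - u) \<longrightarrow> d l u \<le> d l y"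
      using nonneg unfolding d0 by (auto simp: abs_if split: if_splits)
  qed
  moreover have "l < l0 + h"
    using high nonneg[OF u0] l by (cases "l = l0 + h") auto
  ultimately show ?thesis using that[of l u] l' u' d0 by auto
qed

section \<open>Jets\<close>

text \<open>Operations without laws: the same program is run on reals, on jets and on balls, and rounding destroys the
  ring axioms for balls.\<close>

class field_ops = plus + minus + uminus + times +
  fixes lit :: "int \<Rightarrow> 'a" and recip :: "'a \<Rightarrow> 'a"

instantiation real :: field_ops
begin
definition "lit k = (of_int k :: real)"
definition "recip x = inverse (x :: real)"
instance ..
end

text \<open>Value, first and second derivative in the curve parameter u, and derivative in the family parameter l.\<close>

datatype 'a jet = Jet (jv: 'a) (ju: 'a) (juu: 'a) (jl: 'a)

instantiation jet :: (field_ops) field_ops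
begin
definition "J + K = Jet (jv J + jv K) (ju J + ju K) (juu J + juu K) (jl J + jl K)"
definition "J - K = Jet (jv J - jv K) (ju J - ju K) (juu J - juu K) (jl J - jl K)"
definition "- J = Jet (- jv J) (- ju J) (- juu J) (- jl J)"
definition "J * K = (let w = ju J * ju K in
  Jet (jv J * jv K) (ju J * jv K + jv J * ju K)
    (juu J * jv K + (w + w) + jv J * juu K) (jl J * jv K + jv J * jl K))"
definition "lit k = Jet (lit k) (lit 0) (lit 0) (lit 0)"
definition "recip J = (let r = recip (jv J); q = r * r; w = q * ju J; v = w * r * ju J in
  Jet r (- w) (v + v - q * juu J) (- (q * jl J)))"
instance ..
end

lemmas jet_ops = plus_jet_def minus_jet_def uminus_jet_def times_jet_def lit_jet_def recip_jet_def

text \<open>A joint derivative in (l, u) is demanded, not just partial ones, since l also enters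
  through the implicitly defined parameter of the stable curve. Openness of \<open>U\<close> allows
  identities valid on \<open>U\<close> to be differentiated once more in u.\<close>

definition jet_on ::
  "real set \<Rightarrow> real set \<Rightarrow> (real \<Rightarrow> real \<Rightarrow> real) \<Rightarrow> (real \<Rightarrow> real \<Rightarrow> real jet) \<Rightarrow> bool" where
  "jet_on L U f J \<longleftrightarrow> open U \<and> (\<forall>l\<in>L. \<forall>u\<in>U. jv (J l u) = f l u \<and>
     ((\<lambda>(l, u). f l u) has_derivative (\<lambda>(h, k). jl (J l u) * h + ju (J l u) * k)) (at (l, u)) \<and>
     ((\<lambda>u. ju (J l u)) has_real_derivative juu (J l u)) (at u))"

lemma jet_onI:
  assumes "open U"
    and "\<And>l u. l \<in> L \<Longrightarrow> u \<in> U \<Longrightarrow> jv (J l u) = f l u"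
    and "\<And>l u. l \<in> L \<Longrightarrow> u \<in> U \<Longrightarrow> ((\<lambda>z. f (fst z) (snd z)) has_derivative
      (\<lambda>h. jl (J l u) * fst h + ju (J l u) * snd h)) (at (l, u))"
    and "\<And>l u. l \<in> L \<Longrightarrow> u \<in> U \<Longrightarrow> ((\<lambda>u. ju (J l u)) has_real_derivative juu (J l u)) (at u)"
  shows "jet_on L U f J"
  using assms unfolding jet_on_def case_prod_unfold by blast

lemma jet_onD:
  assumes "jet_on L U f J" "l \<in> L" "u \<in> U"
  shows "jv (J l u) = f l u"
    "((\<lambda>(l, u). f l u) has_derivative (\<lambda>(h, k). jl (J l u) * h + ju (J l u) * k)) (at (l, u))"
    "((\<lambda>u. ju (J l u)) has_real_derivative juu (J l u)) (at u)"
    "(f l has_real_derivative ju (J l u)) (at u)"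
    "((\<lambda>l. f l u) has_real_derivative jl (J l u)) (at l)"
    "((\<lambda>z. f (fst z) (snd z)) has_derivative (\<lambda>h. jl (J l u) * fst h + ju (J l u) * snd h)) (at (l, u))"
  using assms partial_snd[of f "jl (J l u)" "ju (J l u)" l u] partial_fst[of f "jl (J l u)" "ju (J l u)" l u]
  unfolding jet_on_def case_prod_unfold by blast+

lemma jet_on_open: "jet_on L U f J \<Longrightarrow> open U"
  by (simp add: jet_on_def)

lemma jet_on_lit: "open U \<Longrightarrow> jet_on L U (\<lambda>_ _. lit k) (\<lambda>_ _. lit k)"
  by (rule jet_onI) (auto simp: jet_ops lit_real_def)

lemma jet_on_fst:
  assumes "open U" and p: "\<And>l. l \<in> L \<Longrightarrow> (p has_real_derivative p' l) (at l)"
  shows "jet_on L U (\<lambda>l _. p l) (\<lambda>l _. Jet (p l) 0 0 (p' l))"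
proof (rule jet_onI)
  fix l u :: real assume l: "l \<in> L"
  have "((\<lambda>z. p (fst z)) has_derivative (\<lambda>h. p' l * fst h)) (at (l, u))"
    by (rule has_derivative_compose[of fst fst "(l, u)" UNIV p])
      (use p[OF l] in \<open>auto intro!: bounded_linear_imp_has_derivative bounded_linear_fst simp: has_field_derivative_def\<close>)
  then show "((\<lambda>z. p (fst z)) has_derivative
      (\<lambda>h. jl (Jet (p l) 0 0 (p' l)) * fst h + ju (Jet (p l) 0 0 (p' l)) * snd h)) (at (l, u))"
    by simp
qed (use assms in auto)

lemma jet_on_snd: "open U \<Longrightarrow> jet_on L U (\<lambda>_ u. u) (\<lambda>_ u. Jet u 1 0 0)"
  by (rule jet_onI) (auto intro!: bounded_linear_imp_has_derivative bounded_linear_snd)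

lemma jet_on_add:
  assumes "jet_on L U f J" "jet_on L U g K"
  shows "jet_on L U (\<lambda>l u. f l u + g l u) (\<lambda>l u. J l u + K l u)"
proof (rule jet_onI)
  fix l u assume lu: "l \<in> L" "u \<in> U"
  note f = jet_onD[OF assms(1) lu] and g = jet_onD[OF assms(2) lu]
  show "jv (J l u + K l u) = f l u + g l u" using f g by (simp add: jet_ops)
  show "((\<lambda>u. ju (J l u + K l u)) has_real_derivative juu (J l u + K l u)) (at u)"
    using DERIV_add[OF f(3) g(3)] by (simp add: jet_ops)
  show "((\<lambda>z. f (fst z) (snd z) + g (fst z) (snd z)) has_derivative
      (\<lambda>h. jl (J l u + K l u) * fst h + ju (J l u + K l u) * snd h)) (at (l, u))"
    by (rule has_derivative_eq_rhs[OF has_derivative_add[OF f(6) g(6)]]) (simp add: jet_ops fun_eq_iff algebra_simps)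
qed (use jet_on_open[OF assms(1)] in auto)

lemma jet_on_diff:
  assumes "jet_on L U f J" "jet_on L U g K"
  shows "jet_on L U (\<lambda>l u. f l u - g l u) (\<lambda>l u. J l u - K l u)"
proof (rule jet_onI)
  fix l u assume lu: "l \<in> L" "u \<in> U"
  note f = jet_onD[OF assms(1) lu] and g = jet_onD[OF assms(2) lu]
  show "jv (J l u - K l u) = f l u - g l u" using f g by (simp add: jet_ops)
  show "((\<lambda>u. ju (J l u - K l u)) has_real_derivative juu (J l u - K l u)) (at u)"
    using DERIV_diff[OF f(3) g(3)] by (simp add: jet_ops)
  show "((\<lambda>z. f (fst z) (snd z) - g (fst z) (snd z)) has_derivative
      (\<lambda>h. jl (J l u - K l u) * fst h + ju (J l u - K l u) * snd h)) (at (l, u))"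
    by (rule has_derivative_eq_rhs[OF has_derivative_diff[OF f(6) g(6)]]) (simp add: jet_ops fun_eq_iff algebra_simps)
qed (use jet_on_open[OF assms(1)] in auto)

lemma jet_on_uminus:
  assumes "jet_on L U f J"
  shows "jet_on L U (\<lambda>l u. - f l u) (\<lambda>l u. - J l u)"
proof (rule jet_onI)
  fix l u assume lu: "l \<in> L" "u \<in> U"
  note f = jet_onD[OF assms(1) lu]
  show "jv (- J l u) = - f l u" using f by (simp add: jet_ops)
  show "((\<lambda>u. ju (- J l u)) has_real_derivative juu (- J l u)) (at u)"
    using DERIV_minus[OF f(3)] by (simp add: jet_ops)
  show "((\<lambda>z. - f (fst z) (snd z)) has_derivative
      (\<lambda>h. jl (- J l u) * fst h + ju (- J l u) * snd h)) (at (l, u))"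
    by (rule has_derivative_eq_rhs[OF has_derivative_minus[OF f(6)]]) (simp add: jet_ops fun_eq_iff algebra_simps)
qed (use jet_on_open[OF assms(1)] in auto)

lemma jet_on_mult:
  assumes "jet_on L U f J" "jet_on L U g K"
  shows "jet_on L U (\<lambda>l u. f l u * g l u) (\<lambda>l u. J l u * K l u)"
proof (rule jet_onI)
  fix l u assume lu: "l \<in> L" "u \<in> U"
  note f = jet_onD[OF assms(1) lu] and g = jet_onD[OF assms(2) lu]
  show "jv (J l u * K l u) = f l u * g l u" using f g by (simp add: jet_ops Let_def)
  have "((\<lambda>u. ju (J l u) * g l u + f l u * ju (K l u)) has_real_derivative juu (J l u * K l u)) (at u)"
    by (rule derivative_eq_intros f g refl)+ (simp add: jet_ops Let_def f g algebra_simps)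
  then show "((\<lambda>u. ju (J l u * K l u)) has_real_derivative juu (J l u * K l u)) (at u)"
    by (rule has_field_derivative_transform_within_open[OF _ jet_on_open[OF assms(1)] lu(2)])
      (use lu jet_onD(1)[OF assms(1)] jet_onD(1)[OF assms(2)] in \<open>auto simp: jet_ops Let_def\<close>)
  show "((\<lambda>z. f (fst z) (snd z) * g (fst z) (snd z)) has_derivative
      (\<lambda>h. jl (J l u * K l u) * fst h + ju (J l u * K l u) * snd h)) (at (l, u))"
    by (rule has_derivative_eq_rhs[OF has_derivative_mult[OF f(6) g(6)]])
      (simp add: jet_ops Let_def f g fun_eq_iff algebra_simps)
qed (use jet_on_open[OF assms(1)] in auto)

lemma jet_on_recip:
  assumes "jet_on L U f J" and nz: "\<And>l u. l \<in> L \<Longrightarrow> u \<in> U \<Longrightarrow> f l u \<noteq> 0"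
  shows "jet_on L U (\<lambda>l u. recip (f l u)) (\<lambda>l u. recip (J l u))"
proof (rule jet_onI)
  fix l u assume lu: "l \<in> L" "u \<in> U"
  note f = jet_onD[OF assms(1) lu] and nz0 = nz[OF lu]
  show "jv (recip (J l u)) = recip (f l u)" using f by (simp add: jet_ops Let_def)
  have "((\<lambda>u. - (ju (J l u) / (f l u * f l u))) has_real_derivative juu (recip (J l u))) (at u)"
    by (rule DERIV_cong[OF DERIV_minus[OF DERIV_divide[OF f(3) DERIV_mult[OF f(4) f(4)]]]])
      (use nz0 in \<open>simp_all add: jet_ops Let_def f recip_real_def field_simps\<close>)
  then show "((\<lambda>u. ju (recip (J l u))) has_real_derivative juu (recip (J l u))) (at u)"
    by (rule has_field_derivative_transform_within_open[OF _ jet_on_open[OF assms(1)] lu(2)])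
      (use lu nz jet_onD(1)[OF assms(1)] in \<open>auto simp: jet_ops Let_def recip_real_def field_simps\<close>)
  have "((\<lambda>z. inverse (f (fst z) (snd z))) has_derivative
      (\<lambda>h. - (inverse (f l u) * (jl (J l u) * fst h + ju (J l u) * snd h) * inverse (f l u)))) (at (l, u))"
    using Deriv.has_derivative_inverse[OF _ f(6)] nz0 by simp
  then show "((\<lambda>z. recip (f (fst z) (snd z))) has_derivative
      (\<lambda>h. jl (recip (J l u)) * fst h + ju (recip (J l u)) * snd h)) (at (l, u))"
    unfolding recip_real_def
    by (rule has_derivative_eq_rhs) (simp add: jet_ops Let_def f recip_real_def fun_eq_iff algebra_simps)
qed (use jet_on_open[OF assms(1)] in auto)

text \<open>Serves the series remainders, which are evaluated at l * u, or with eigenvalue -b / l at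
  s and at -b / l * s: \<open>p\<close> transforms the parameter of the family, \<open>n\<close>
  scales the curve parameter.\<close>

lemma jet_on_rescale:
  assumes f: "jet_on L' U' f J" and U: "open U"
    and p: "\<And>l. l \<in> L \<Longrightarrow> (p has_real_derivative p' l) (at l)"
    and n: "\<And>l. l \<in> L \<Longrightarrow> (n has_real_derivative n' l) (at l)"
    and sub: "\<And>l. l \<in> L \<Longrightarrow> p l \<in> L'" "\<And>l u. l \<in> L \<Longrightarrow> u \<in> U \<Longrightarrow> n l * u \<in> U'"
  shows "jet_on L U (\<lambda>l u. f (p l) (n l * u)) (\<lambda>l u. let j = J (p l) (n l * u) in
    Jet (jv j) (n l * ju j) ((n l)\<^sup>2 * juu j) (p' l * jl j + n' l * u * ju j))"
proof (rule jet_onI)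
  fix l u assume lu: "l \<in> L" "u \<in> U"
  note f0 = jet_onD[OF f sub(1)[OF lu(1)] sub(2)[OF lu]]
  show "jv (let j = J (p l) (n l * u) in Jet (jv j) (n l * ju j) ((n l)\<^sup>2 * juu j) (p' l * jl j + n' l * u * ju j))
      = f (p l) (n l * u)"
    using f0 by (simp add: Let_def)
  have "((\<lambda>u. n l * ju (J (p l) (n l * u))) has_real_derivative n l * (juu (J (p l) (n l * u)) * n l)) (at u)"
  proof (rule DERIV_cmult)
    show "((\<lambda>u. ju (J (p l) (n l * u))) has_real_derivative juu (J (p l) (n l * u)) * n l) (at u)"
      by (rule DERIV_chain2[where f = "\<lambda>u. ju (J (p l) u)" and g = "(*) (n l)", OF f0(3)]) (auto intro!: derivative_eq_intros)
  qed
  then show "((\<lambda>u. ju (let j = J (p l) (n l * u) in Jet (jv j) (n l * ju j) ((n l)\<^sup>2 * juu j) (p' l * jl j + n' l * u * ju j)))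
      has_real_derivative juu (let j = J (p l) (n l * u) in
        Jet (jv j) (n l * ju j) ((n l)\<^sup>2 * juu j) (p' l * jl j + n' l * u * ju j))) (at u)"
    by (simp add: Let_def power2_eq_square mult_ac)
  have d: "((\<lambda>z. q (fst z)) has_derivative (\<lambda>h. q' * fst h)) (at (l, u))"
    if "(q has_real_derivative q') (at l)" for q q'
    by (rule has_derivative_compose[of fst fst "(l, u)" UNIV q])
      (use that in \<open>auto intro!: bounded_linear_imp_has_derivative bounded_linear_fst simp: has_field_derivative_def\<close>)
  have s: "(snd has_derivative snd) (at (l, u))"
    by (rule bounded_linear_imp_has_derivative[OF bounded_linear_snd])
  have F: "((\<lambda>(x, y). f x y) has_derivative
      (\<lambda>(h, k). jl (J (p l) (n l * u)) * h + ju (J (p l) (n l * u)) * k)) (at (p (fst (l, u)), n (fst (l, u)) * snd (l, u)))"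
    using f0(2) by simp
  show "((\<lambda>z. f (p (fst z)) (n (fst z) * snd z)) has_derivative
      (\<lambda>h. jl (let j = J (p l) (n l * u) in Jet (jv j) (n l * ju j) ((n l)\<^sup>2 * juu j) (p' l * jl j + n' l * u * ju j)) * fst h +
        ju (let j = J (p l) (n l * u) in Jet (jv j) (n l * ju j) ((n l)\<^sup>2 * juu j) (p' l * jl j + n' l * u * ju j)) * snd h)) (at (l, u))"
    by (rule has_derivative_eq_rhs[OF has_derivative_compose_pair[OF F d[OF p[OF lu(1)]]
          has_derivative_mult[OF d[OF n[OF lu(1)]] s]]])
      (simp add: Let_def fun_eq_iff algebra_simps)
qed (use U in auto)

section \<open>Tangencies of curve families\<close>

text \<open>For curves u \<mapsto> (X1 l u, Y1 l u) and s \<mapsto> (X2 l s, Y2 l s), let S l y solve Y2 l (S l y) = y. The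
  quantities below are the derivatives of the horizontal gap X1 l u - X2 l (S l (Y1 l u)), expressed by
  the jets of the four coordinate functions at u and s = S l (Y1 l u).\<close>

definition slope :: "'a::field_ops jet \<Rightarrow> 'a jet \<Rightarrow> 'a" where
  "slope X Y = ju X * recip (ju Y)"

definition gap_u :: "'a::field_ops jet \<Rightarrow> 'a jet \<Rightarrow> 'a jet \<Rightarrow> 'a jet \<Rightarrow> 'a" where
  "gap_u X1 Y1 X2 Y2 = ju X1 - slope X2 Y2 * ju Y1"

definition gap_uu :: "'a::field_ops jet \<Rightarrow> 'a jet \<Rightarrow> 'a jet \<Rightarrow> 'a jet \<Rightarrow> 'a" where
  "gap_uu X1 Y1 X2 Y2 = juu X1 - slope X2 Y2 * juu Y1
     - (juu X2 * ju Y2 - ju X2 * juu Y2) * (recip (ju Y2) * (recip (ju Y2) * recip (ju Y2))) * (ju Y1 * ju Y1)"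

definition gap_l :: "'a::field_ops jet \<Rightarrow> 'a jet \<Rightarrow> 'a jet \<Rightarrow> 'a jet \<Rightarrow> 'a" where
  "gap_l X1 Y1 X2 Y2 = jl X1 - jl X2 - slope X2 Y2 * (jl Y1 - jl Y2)"

lemma open_contains_square:
  assumes "open V" "(l, y) \<in> V"
  obtains e :: real where "e > 0" "\<And>l' y'. \<bar>l' - l\<bar> < e \<Longrightarrow> \<bar>y' - y\<bar> < e \<Longrightarrow> (l' :: real, y' :: real) \<in> V"
proof -
  obtain A B where AB: "open A" "open B" "(l, y) \<in> A \<times> B" "A \<times> B \<subseteq> V"
    using open_prod_elim[OF assms] by blast
  obtain e1 where e1: "e1 > 0" "\<And>x. dist x l < e1 \<Longrightarrow> x \<in> A"
    using AB open_dist by (metis mem_Sigma_iff)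
  obtain e2 where e2: "e2 > 0" "\<And>x. dist x y < e2 \<Longrightarrow> x \<in> B"
    using AB open_dist by (metis mem_Sigma_iff)
  show ?thesis
    by (rule that[of "min e1 e2"]) (use e1 e2 AB in \<open>auto simp: dist_real_def\<close>)
qed

text \<open>Both curves become graphs over y near the touching point: \<open>gs\<close> is the
  second, \<open>gu\<close> the first, and their difference is the gap at the parameter
  \<open>W\<close> of the first curve. At a common zero of \<open>d\<close> and \<open>du\<close>
  the slopes therefore agree, the second derivatives differ by
  \<open>duu l u / (ju (JY1 l u))\<^sup>2\<close>, and the signed distance changes in l at rate
  \<open>- dl l u\<close>.\<close>

theorem curves_with_quadratic_tangency:
  fixes X1 Y1 X2 Y2 :: "real \<Rightarrow> real \<Rightarrow> real" and JX1 JY1 JX2 JY2 :: "real \<Rightarrow> real \<Rightarrow> real jet"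
  assumes L: "open L" and s12: "s1 < s2" "{s1..s2} \<subseteq> \<Sigma>"
    and X1: "jet_on L U X1 JX1" and Y1: "jet_on L U Y1 JY1"
    and X2: "jet_on L \<Sigma> X2 JX2" and Y2: "jet_on L \<Sigma> Y2 JY2"
    and LU: "{l0 - h..l0 + h} \<subseteq> L" "{u0 - k..u0 + k} \<subseteq> U" and hk: "h > 0" "k > 0"
    and Y2_mono: "\<And>l s. l \<in> L \<Longrightarrow> s \<in> {s1..s2} \<Longrightarrow> ju (JY2 l s) > 0"
    and Y1_mono: "\<And>l u. l \<in> L \<Longrightarrow> u \<in> U \<Longrightarrow> ju (JY1 l u) < 0"
    and bracket: "\<And>l u. l \<in> L \<Longrightarrow> u \<in> U \<Longrightarrow> Y2 l s1 < Y1 l u \<and> Y1 l u < Y2 l s2"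
    and gl: "\<And>l u s. l \<in> L \<Longrightarrow> u \<in> U \<Longrightarrow> s \<in> {s1..s2} \<Longrightarrow>
      - D2 \<le> gap_l (JX1 l u) (JY1 l u) (JX2 l s) (JY2 l s) \<and> gap_l (JX1 l u) (JY1 l u) (JX2 l s) (JY2 l s) \<le> - D1"
    and guu: "\<And>l u s. l \<in> L \<Longrightarrow> u \<in> U \<Longrightarrow> s \<in> {s1..s2} \<Longrightarrow>
      c \<le> gap_uu (JX1 l u) (JY1 l u) (JX2 l s) (JY2 l s)"
    and centre: "\<And>s. s \<in> {s1..s2} \<Longrightarrow> Y2 l0 s = Y1 l0 u0 \<Longrightarrow> \<bar>X1 l0 u0 - X2 l0 s\<bar> \<le> e0 \<and>
      \<bar>gap_u (JX1 l0 u0) (JY1 l0 u0) (JX2 l0 s) (JY2 l0 s)\<bar> \<le> e1"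
    and small: "e0 + e1 * k < D1 * h" "e0 + e1 * k + D2 * h < c * k\<^sup>2 / 2" and c: "0 < c" and D1: "0 < D1"
  obtains l u \<epsilon> gs gu gs' gu' gs'' gu'' D where
    "l \<in> {l0 - h<..<l0 + h}" "u \<in> U" "\<epsilon> > 0"
    "\<And>l'. \<bar>l' - l\<bar> < \<epsilon> \<Longrightarrow> l' \<in> L"
    "\<And>l' t. \<bar>l' - l\<bar> < \<epsilon> \<Longrightarrow> \<bar>t\<bar> < \<epsilon> \<Longrightarrow> \<exists>s\<in>{s1..s2}. gs l' t = X2 l' s \<and> Y1 l u + t = Y2 l' s"
    "\<And>l' t. \<bar>l' - l\<bar> < \<epsilon> \<Longrightarrow> \<bar>t\<bar> < \<epsilon> \<Longrightarrow> \<exists>u'\<in>U. gu l' t = X1 l' u' \<and> Y1 l u + t = Y1 l' u'"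
    "\<And>l' t. \<bar>l' - l\<bar> < \<epsilon> \<Longrightarrow> \<bar>t\<bar> < \<epsilon> \<Longrightarrow> isCont (\<lambda>(l, t). gs l t) (l', t)"
    "\<And>l' t. \<bar>l' - l\<bar> < \<epsilon> \<Longrightarrow> \<bar>t\<bar> < \<epsilon> \<Longrightarrow> isCont (\<lambda>(l, t). gu l t) (l', t)"
    "gs l 0 = X1 l u" "gu l 0 = X1 l u"
    "\<And>t. \<bar>t\<bar> < \<epsilon> \<Longrightarrow> (gs l has_real_derivative gs' t) (at t)"
    "\<And>t. \<bar>t\<bar> < \<epsilon> \<Longrightarrow> (gu l has_real_derivative gu' t) (at t)"
    "gs' 0 = gu' 0"
    "(gs' has_real_derivative gs'') (at 0)" "(gu' has_real_derivative gu'') (at 0)" "gs'' \<noteq> gu''"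
    "((\<lambda>l. gs l 0 - gu l 0) has_real_derivative D) (at l)" "D \<noteq> 0"
proof -
  have in\<Sigma>: "s \<in> \<Sigma>" if "s \<in> {s1..s2}" for s using s12 that by blast
  define V2 where "V2 = {(l, y). l \<in> L \<and> Y2 l s1 < y \<and> y < Y2 l s2}"
  obtain S where openV2: "open V2"
    and S: "\<And>l y. (l, y) \<in> V2 \<Longrightarrow> S l y \<in> {s1<..<s2} \<and> Y2 l (S l y) = y"
    and derS: "\<And>l y. (l, y) \<in> V2 \<Longrightarrow> ((\<lambda>(l, y). S l y) has_derivative
      (\<lambda>(h, k). (- jl (JY2 l (S l y)) / ju (JY2 l (S l y))) * h + (1 / ju (JY2 l (S l y))) * k)) (at (l, y))"
    unfolding V2_def
    by (rule implicit_branch[OF L s12(1), of Y2 "\<lambda>l s. jl (JY2 l s)" "\<lambda>l s. ju (JY2 l s)"])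
      (use jet_onD(2)[OF Y2 _ in\<Sigma>] Y2_mono in blast)+
  have inV2: "(l, Y1 l u) \<in> V2" if "l \<in> L" "u \<in> U" for l u
    using bracket[OF that] that by (simp add: V2_def)
  define s where "s l u = S l (Y1 l u)" for l u
  have s: "s l u \<in> {s1..s2}" "s l u \<in> \<Sigma>" "Y2 l (s l u) = Y1 l u" if "l \<in> L" "u \<in> U" for l u
    using S[OF inV2[OF that]] in\<Sigma>[of "s l u"] by (auto simp: s_def)
  define d where "d l u = X1 l u - X2 l (s l u)" for l u
  define dl where "dl l u = gap_l (JX1 l u) (JY1 l u) (JX2 l (s l u)) (JY2 l (s l u))" for l u
  define du where "du l u = gap_u (JX1 l u) (JY1 l u) (JX2 l (s l u)) (JY2 l (s l u))" for l u
  define duu where "duu l u = gap_uu (JX1 l u) (JY1 l u) (JX2 l (s l u)) (JY2 l (s l u))" for l u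
  have s_der: "((\<lambda>(l, u). s l u) has_derivative
      (\<lambda>(h, k). ((jl (JY1 l u) - jl (JY2 l (s l u))) / ju (JY2 l (s l u))) * h + (ju (JY1 l u) / ju (JY2 l (s l u))) * k)) (at (l, u))"
    if lu: "l \<in> L" "u \<in> U" for l u
  proof -
    have D: "((\<lambda>(l, y). S l y) has_derivative
      (\<lambda>(h, k). (- jl (JY2 l (s l u)) / ju (JY2 l (s l u))) * h + (1 / ju (JY2 l (s l u))) * k)) (at (fst (l, u), Y1 (fst (l, u)) (snd (l, u))))"
      using derS[OF inV2[OF lu]] by (simp add: s_def)
    have "ju (JY2 l (s l u)) > 0" using Y2_mono lu s(1) by blast
    then show ?thesis
      using has_derivative_compose_pair[OF D bounded_linear_imp_has_derivative[OF bounded_linear_fst] jet_onD(6)[OF Y1 lu]]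
      unfolding s_def[symmetric] case_prod_unfold
      by (elim has_derivative_eq_rhs) (simp add: fun_eq_iff field_simps)
  qed
  have d_der: "((\<lambda>(l, u). d l u) has_derivative (\<lambda>(x, y). dl l u * x + du l u * y)) (at (l, u))"
    if lu: "l \<in> L" "u \<in> U" for l u
  proof -
    have D: "((\<lambda>(l, s). X2 l s) has_derivative
      (\<lambda>(h, k). jl (JX2 l (s l u)) * h + ju (JX2 l (s l u)) * k)) (at (fst (l, u), s (fst (l, u)) (snd (l, u))))"
      using jet_onD(2)[OF X2 lu(1) s(2)[OF lu]] by simp
    have pos: "ju (JY2 l (s l u)) > 0" using Y2_mono lu s(1) by blast
    show ?thesis
      unfolding d_def case_prod_unfold
      by (rule has_derivative_eq_rhs[OF has_derivative_diff[OF jet_onD(6)[OF X1 lu]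
            has_derivative_compose_pair[OF D bounded_linear_imp_has_derivative[OF bounded_linear_fst]
              s_der[OF lu, unfolded case_prod_unfold]]]])
        (use pos in \<open>simp add: fun_eq_iff dl_def du_def gap_l_def gap_u_def slope_def recip_real_def field_simps\<close>)
  qed
  have du_der: "(du l has_real_derivative duu l u) (at u)" if lu: "l \<in> L" "u \<in> U" for l u
  proof -
    have pos: "ju (JY2 l (s l u)) > 0" using Y2_mono lu s(1) by blast
    have su: "(s l has_real_derivative ju (JY1 l u) / ju (JY2 l (s l u))) (at u)"
      using partial_snd[OF s_der[OF lu]] .
    have a: "((\<lambda>u. ju (JX2 l (s l u))) has_real_derivative juu (JX2 l (s l u)) * (ju (JY1 l u) / ju (JY2 l (s l u)))) (at u)"
      using DERIV_chain2[OF jet_onD(3)[OF X2 lu(1) s(2)[OF lu]] su] .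
    have b: "((\<lambda>u. ju (JY2 l (s l u))) has_real_derivative juu (JY2 l (s l u)) * (ju (JY1 l u) / ju (JY2 l (s l u)))) (at u)"
      using DERIV_chain2[OF jet_onD(3)[OF Y2 lu(1) s(2)[OF lu]] su] .
    have "((\<lambda>u. ju (JX1 l u) - ju (JX2 l (s l u)) / ju (JY2 l (s l u)) * ju (JY1 l u)) has_real_derivative duu l u) (at u)"
      by (rule DERIV_cong[OF DERIV_diff[OF jet_onD(3)[OF X1 lu] DERIV_mult[OF DERIV_divide[OF a b] jet_onD(3)[OF Y1 lu]]]])
        (use pos in \<open>simp_all add: duu_def gap_uu_def slope_def recip_real_def field_simps\<close>)
    then show ?thesis by (simp add: du_def[abs_def] gap_u_def slope_def recip_real_def divide_inverse)
  qed
  have l0: "l0 \<in> L" "u0 \<in> U" using LU hk by (auto simp: subset_eq)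
  obtain l u where l: "l \<in> {l0 - h<..<l0 + h}" and u: "u \<in> {u0 - k<..<u0 + k}" and d0: "d l u = 0" and du0: "du l u = 0"
  proof (rule convex_family_touches_zero[OF LU hk d_der du_der, of D2 D1 c e0 e1])
    show "\<bar>d l0 u0\<bar> \<le> e0" "\<bar>du l0 u0\<bar> \<le> e1"
      using centre[OF s(1)[OF l0] s(3)[OF l0]] by (auto simp: d_def du_def)
  qed (use gl guu s small c in \<open>auto simp: dl_def duu_def\<close>)
  have lL: "l \<in> L" and uU: "u \<in> U" using l u LU by (auto simp: subset_eq)
  define y where "y = Y1 l u"
  \<comment> \<open>\<open>implicit_branch\<close> wants an increasing function, hence the sign
    change of \<open>Y1\<close>; \<open>W\<close> below undoes it.\<close>
  define V1 where "V1 = {(l, y). l \<in> L \<and> - Y1 l (u0 - k) < y \<and> y < - Y1 l (u0 + k)}"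
  have nY1: "jet_on L U (\<lambda>l u. - Y1 l u) (\<lambda>l u. - JY1 l u)" by (rule jet_on_uminus[OF Y1])
  have u0k: "u0 - k < u0 + k" using hk by simp
  have nY1_mono: "ju (- JY1 l u) > 0" if "l \<in> L" "u \<in> {u0 - k..u0 + k}" for l u
    using Y1_mono[OF that(1) subsetD[OF LU(2) that(2)]] by (simp add: uminus_jet_def)
  obtain T where openV1: "open V1"
    and T: "\<And>l y. (l, y) \<in> V1 \<Longrightarrow> T l y \<in> {u0 - k<..<u0 + k} \<and> - Y1 l (T l y) = y"
    and T_Y1: "\<And>l u. l \<in> L \<Longrightarrow> u \<in> {u0 - k<..<u0 + k} \<Longrightarrow> (l, - Y1 l u) \<in> V1 \<and> T l (- Y1 l u) = u"
    and derT: "\<And>l y. (l, y) \<in> V1 \<Longrightarrow> ((\<lambda>(l, y). T l y) has_derivative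
      (\<lambda>(h, k). (- jl (- JY1 l (T l y)) / ju (- JY1 l (T l y))) * h + (1 / ju (- JY1 l (T l y))) * k)) (at (l, y))"
    unfolding V1_def
    by (rule implicit_branch[OF L u0k, of "\<lambda>l u. - Y1 l u" "\<lambda>l u. jl (- JY1 l u)" "\<lambda>l u. ju (- JY1 l u)"])
      (use jet_onD(2)[OF nY1 _ subsetD[OF LU(2)]] nY1_mono in blast)+
  define W where "W l y = T l (- y)" for l y
  have W: "W l y \<in> U" "Y1 l (W l y) = y" if "(l, - y) \<in> V1" for l y
    using T[OF that] LU(2) by (auto simp: W_def subset_eq)
  have derW: "((\<lambda>(l, y). W l y) has_derivative
      (\<lambda>(h, k). (- jl (JY1 l (W l y)) / ju (JY1 l (W l y))) * h + (1 / ju (JY1 l (W l y))) * k)) (at (l, y))"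
    if "(l, - y) \<in> V1" for l y
  proof -
    have D: "((\<lambda>(l, y). T l y) has_derivative
      (\<lambda>(h, k). (- jl (- JY1 l (W l y)) / ju (- JY1 l (W l y))) * h + (1 / ju (- JY1 l (W l y))) * k)) (at (fst (l, y), - snd (l, y)))"
      using derT[OF that] by (simp add: W_def)
    show ?thesis
      unfolding W_def[of "fst _"] case_prod_unfold
      by (rule has_derivative_eq_rhs[OF has_derivative_compose_pair[OF D bounded_linear_imp_has_derivative[OF bounded_linear_fst]
              has_derivative_minus[OF bounded_linear_imp_has_derivative[OF bounded_linear_snd]]]])
        (simp add: fun_eq_iff uminus_jet_def)
  qed
  have y1: "(l, - y) \<in> V1" and Wy: "W l y = u" using T_Y1[OF lL u] by (simp_all add: y_def W_def)
  have y2: "(l, y) \<in> V2" using inV2[OF lL uU] by (simp add: y_def)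
  obtain \<epsilon>1 where \<epsilon>1: "\<epsilon>1 > 0" "\<And>l' y'. \<bar>l' - l\<bar> < \<epsilon>1 \<Longrightarrow> \<bar>y' - (- y)\<bar> < \<epsilon>1 \<Longrightarrow> (l', y') \<in> V1"
    using open_contains_square[OF openV1 y1] by blast
  obtain \<epsilon>2 where \<epsilon>2: "\<epsilon>2 > 0" "\<And>l' y'. \<bar>l' - l\<bar> < \<epsilon>2 \<Longrightarrow> \<bar>y' - y\<bar> < \<epsilon>2 \<Longrightarrow> (l', y') \<in> V2"
    using open_contains_square[OF openV2 y2] by blast
  define \<epsilon> where "\<epsilon> = min \<epsilon>1 \<epsilon>2"
  have \<epsilon>: "\<epsilon> > 0" using \<epsilon>1 \<epsilon>2 by (simp add: \<epsilon>_def)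
  have v1: "(l', - (y + t)) \<in> V1" and v2: "(l', y + t) \<in> V2" if "\<bar>l' - l\<bar> < \<epsilon>" "\<bar>t\<bar> < \<epsilon>" for l' t
    using that \<epsilon>1(2)[of l' "- (y + t)"] \<epsilon>2(2)[of l' "y + t"] by (auto simp: \<epsilon>_def)
  have in_L: "l' \<in> L" if "(l', y') \<in> V2" for l' y' using that by (simp add: V2_def)
  have SS: "S l' y' \<in> {s1..s2}" "S l' y' \<in> \<Sigma>" if "(l', y') \<in> V2" for l' y'
    using S[OF that] in\<Sigma>[of "S l' y'"] by auto
  define gs where "gs l t = X2 l (S l (y + t))" for l t
  define gu where "gu l t = X1 l (W l (y + t))" for l t
  define sl where "sl t = ju (JX2 l (S l (y + t))) / ju (JY2 l (S l (y + t)))" for t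
  \<comment> \<open>The slope \<open>du\<close> of the gap is kept as a separate summand: it
    vanishes at the tangency, so differentiating the quotient at 0 leaves only the
    \<open>duu\<close> term.\<close>
  define gu' where "gu' t = sl t + du l (W l (y + t)) / ju (JY1 l (W l (y + t)))" for t
  have gu_d: "gu l' t = gs l' t + d l' (W l' (y + t))" if "\<bar>l' - l\<bar> < \<epsilon>" "\<bar>t\<bar> < \<epsilon>" for l' t
    using W(2)[OF v1[OF that]] by (simp add: gu_def gs_def d_def s_def)
  have shift: "((\<lambda>t. y + t) has_real_derivative 1) (at t)" for t by (auto intro!: derivative_eq_intros)
  have St: "((\<lambda>t. S l (y + t)) has_real_derivative 1 / ju (JY2 l (S l (y + t)))) (at t)" if "\<bar>t\<bar> < \<epsilon>" for t
    using DERIV_chain2[OF partial_snd[OF derS[OF v2[of l t]]] shift] that \<epsilon> by simp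
  have Wt: "((\<lambda>t. W l (y + t)) has_real_derivative 1 / ju (JY1 l (W l (y + t)))) (at t)" if "\<bar>t\<bar> < \<epsilon>" for t
    using DERIV_chain2[OF partial_snd[OF derW[OF v1[of l t]]] shift] that \<epsilon> by simp
  have gs_der: "(gs l has_real_derivative sl t) (at t)" if t: "\<bar>t\<bar> < \<epsilon>" for t
  proof -
    have v: "(l, y + t) \<in> V2" using v2[of l t] t \<epsilon> by simp
    show ?thesis
      unfolding gs_def[abs_def] sl_def
      using DERIV_chain2[OF jet_onD(4)[OF X2 lL SS(2)[OF v]] St[OF t]] by simp
  qed
  have gu_der: "(gu l has_real_derivative gu' t) (at t)" if t: "\<bar>t\<bar> < \<epsilon>" for t
  proof -
    have w: "W l (y + t) \<in> U" using W(1) v1[of l t] t \<epsilon> by simp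
    have "((\<lambda>t. gs l t + d l (W l (y + t))) has_real_derivative gu' t) (at t)"
      unfolding gu'_def
      using DERIV_add[OF gs_der[OF t] DERIV_chain2[OF partial_snd[OF d_der[OF lL w]] Wt[OF t]]] by simp
    then show ?thesis
      by (rule has_field_derivative_transform_within_open[where S = "{- \<epsilon><..<\<epsilon>}"])
        (use t gu_d[of l] \<epsilon> in auto)
  qed
  have S0: "S l y = s l u" by (simp add: s_def y_def)
  define gs'' where "gs'' = (juu (JX2 l (s l u)) * ju (JY2 l (s l u)) - ju (JX2 l (s l u)) * juu (JY2 l (s l u)))
      / (ju (JY2 l (s l u)))^3"
  have pos: "ju (JY2 l (s l u)) > 0" using Y2_mono lL uU s(1) by blast
  have neg: "ju (JY1 l u) < 0" using Y1_mono lL uU by blast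
  have sl_der: "(sl has_real_derivative gs'') (at 0)"
  proof -
    have v: "(l, y) \<in> V2" by (rule y2)
    have sn: "((\<lambda>t. S l (y + t)) has_real_derivative 1 / ju (JY2 l (s l u))) (at 0)" using St[of 0] \<epsilon> by (simp add: S0)
    have a: "((\<lambda>t. ju (JX2 l (S l (y + t)))) has_real_derivative juu (JX2 l (s l u)) * (1 / ju (JY2 l (s l u)))) (at 0)"
      using DERIV_chain2[OF _ sn, of "\<lambda>s. ju (JX2 l s)" "juu (JX2 l (s l u))"] jet_onD(3)[OF X2 lL s(2)[OF lL uU]] by (simp add: S0)
    have b: "((\<lambda>t. ju (JY2 l (S l (y + t)))) has_real_derivative juu (JY2 l (s l u)) * (1 / ju (JY2 l (s l u)))) (at 0)"
      using DERIV_chain2[OF _ sn, of "\<lambda>s. ju (JY2 l s)" "juu (JY2 l (s l u))"] jet_onD(3)[OF Y2 lL s(2)[OF lL uU]] by (simp add: S0)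
    show ?thesis
      unfolding sl_def[abs_def]
      by (rule DERIV_cong[OF DERIV_divide[OF a b]])
        (use pos in \<open>simp_all add: S0 gs''_def field_simps power3_eq_cube\<close>)
  qed
  define gu'' where "gu'' = gs'' + duu l u / (ju (JY1 l u))\<^sup>2"
  have gu'_der: "(gu' has_real_derivative gu'') (at 0)"
  proof -
    have wn: "((\<lambda>t. W l (y + t)) has_real_derivative 1 / ju (JY1 l u)) (at 0)" using Wt[of 0] \<epsilon> by (simp add: Wy)
    have a: "((\<lambda>t. du l (W l (y + t))) has_real_derivative duu l u * (1 / ju (JY1 l u))) (at 0)"
      using DERIV_chain2[OF _ wn, of "du l" "duu l u"] du_der[OF lL uU] by (simp add: Wy)
    have b: "((\<lambda>t. ju (JY1 l (W l (y + t)))) has_real_derivative juu (JY1 l u) * (1 / ju (JY1 l u))) (at 0)"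
      using DERIV_chain2[OF _ wn, of "\<lambda>u. ju (JY1 l u)" "juu (JY1 l u)"] jet_onD(3)[OF Y1 lL uU] by (simp add: Wy)
    show ?thesis
      unfolding gu'_def[abs_def]
      by (rule DERIV_cong[OF DERIV_add[OF sl_der DERIV_divide[OF a b]]])
        (use neg du0 in \<open>simp_all add: Wy gu''_def field_simps power2_eq_square\<close>)
  qed
  have ne: "gs'' \<noteq> gu''"
    using guu[OF lL uU s(1)[OF lL uU]] c neg by (simp add: gu''_def duu_def)
  \<comment> \<open>The parameter \<open>W l y\<close> moves with l as well, but its contribution is
    multiplied by \<open>du l u = 0\<close>.\<close>
  have D_der: "((\<lambda>l. gs l 0 - gu l 0) has_real_derivative - dl l u) (at l)"
  proof -
    have D: "((\<lambda>(l, u). d l u) has_derivative (\<lambda>(x, y). dl l u * x + du l u * y)) (at (l, W l y))"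
      using d_der[OF lL uU] by (simp add: Wy)
    have "((\<lambda>l. - d l (W l y)) has_real_derivative - dl l u) (at l)"
      using DERIV_minus[OF has_real_derivative_compose_pair[OF D DERIV_ident partial_fst[OF derW[OF y1]]]] du0 by simp
    then show ?thesis
      by (rule has_field_derivative_transform_within_open[where S = "{l - \<epsilon><..<l + \<epsilon>}"])
        (use gu_d[of _ 0] \<epsilon> in \<open>auto simp: abs_less_iff\<close>)
  qed
  have contgs: "isCont (\<lambda>(l, t). gs l t) (l', t)" if lt: "\<bar>l' - l\<bar> < \<epsilon>" "\<bar>t\<bar> < \<epsilon>" for l' t
  proof -
    note v = v2[OF lt]
    have "isCont (\<lambda>(l, y). S l y) (l', y + t)" using derS[OF v] by (rule has_derivative_continuous)
    then have "isCont (\<lambda>z. S (fst z) (y + snd z)) (l', t)"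
      using isCont_o2[of "(l', t)" "\<lambda>z. (fst z, y + snd z)" "\<lambda>(l, y). S l y"] by (simp add: case_prod_unfold)
    moreover have "isCont (\<lambda>(l, y). X2 l y) (l', S l' (y + t))"
      using jet_onD(2)[OF X2 in_L[OF v] SS(2)[OF v]] by (rule has_derivative_continuous)
    ultimately have "isCont (\<lambda>z. X2 (fst z) (S (fst z) (y + snd z))) (l', t)"
      using isCont_o2[of "(l', t)" "\<lambda>z. (fst z, S (fst z) (y + snd z))" "\<lambda>(l, y). X2 l y"] by (simp add: case_prod_unfold)
    then show ?thesis by (simp add: gs_def case_prod_unfold)
  qed
  have contgu: "isCont (\<lambda>(l, t). gu l t) (l', t)" if lt: "\<bar>l' - l\<bar> < \<epsilon>" "\<bar>t\<bar> < \<epsilon>" for l' t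
  proof -
    note v = v1[OF lt]
    have "isCont (\<lambda>(l, y). W l y) (l', y + t)" using derW[OF v] by (rule has_derivative_continuous)
    then have "isCont (\<lambda>z. W (fst z) (y + snd z)) (l', t)"
      using isCont_o2[of "(l', t)" "\<lambda>z. (fst z, y + snd z)" "\<lambda>(l, y). W l y"] by (simp add: case_prod_unfold)
    moreover have "isCont (\<lambda>(l, y). X1 l y) (l', W l' (y + t))"
      using jet_onD(2)[OF X1 in_L[OF v2[OF lt]] W(1)[OF v]] by (rule has_derivative_continuous)
    ultimately have "isCont (\<lambda>z. X1 (fst z) (W (fst z) (y + snd z))) (l', t)"
      using isCont_o2[of "(l', t)" "\<lambda>z. (fst z, W (fst z) (y + snd z))" "\<lambda>(l, y). X1 l y"] by (simp add: case_prod_unfold)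
    then show ?thesis by (simp add: gu_def case_prod_unfold)
  qed
  show ?thesis
  proof (rule that[of l u \<epsilon> gs gu sl gu' gs'' gu'' "- dl l u"])
    show "l' \<in> L" if "\<bar>l' - l\<bar> < \<epsilon>" for l' using in_L v2[of l' 0] that \<epsilon> by auto
    show "\<exists>s\<in>{s1..s2}. gs l' t = X2 l' s \<and> Y1 l u + t = Y2 l' s" if "\<bar>l' - l\<bar> < \<epsilon>" "\<bar>t\<bar> < \<epsilon>" for l' t
      using S[OF v2[OF that]] by (intro bexI[of _ "S l' (y + t)"]) (auto simp: gs_def y_def)
    show "\<exists>u'\<in>U. gu l' t = X1 l' u' \<and> Y1 l u + t = Y1 l' u'" if "\<bar>l' - l\<bar> < \<epsilon>" "\<bar>t\<bar> < \<epsilon>" for l' t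
      using W[OF v1[OF that]] by (intro bexI[of _ "W l' (y + t)"]) (auto simp: gu_def y_def)
    show "gs l 0 = X1 l u" "gu l 0 = X1 l u" using d0 by (simp_all add: gs_def gu_def Wy S0 d_def)
    show "sl 0 = gu' 0" using du0 by (simp add: gu'_def Wy)
    show "- dl l u \<noteq> 0" using gl[OF lL uU s(1)[OF lL uU]] D1 by (auto simp: dl_def)
  qed (use l uU \<epsilon> gs_der gu_der sl_der gu'_der ne D_der contgs contgu in auto)
qed

section \<open>Power series of the invariant manifolds\<close>

lemma geometric_bound:
  fixes a :: "nat \<Rightarrow> real"
  assumes "\<And>n. \<bar>a n\<bar> \<le> M * (1 / 2) ^ n"
  shows "summable a" "\<bar>suminf a\<bar> \<le> 2 * M" "\<bar>(\<Sum>i<n. a i) - suminf a\<bar> \<le> 2 * M * (1 / 2) ^ n"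
proof -
  have g: "summable (\<lambda>n. M * (1 / 2 :: real) ^ n)" by (intro summable_mult summable_geometric) auto
  show s: "summable a" by (rule summable_comparison_test'[OF g]) (use assms in auto)
  have tail: "\<bar>suminf (\<lambda>i. a (i + n))\<bar> \<le> 2 * M * (1 / 2) ^ n" for n
  proof -
    have g': "summable (\<lambda>i. M * (1 / 2) ^ n * (1 / 2 :: real) ^ i)" by (intro summable_mult summable_geometric) auto
    have "norm (suminf (\<lambda>i. a (i + n))) \<le> (\<Sum>i. M * (1 / 2) ^ n * (1 / 2 :: real) ^ i)"
      by (rule norm_suminf_le[OF _ g']) (use assms[of "_ + n"] in \<open>auto simp: power_add mult_ac\<close>)
    also have "\<dots> = M * (1 / 2) ^ n * (\<Sum>i. (1 / 2 :: real) ^ i)"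
      by (intro suminf_mult summable_geometric) auto
    also have "(\<Sum>i. (1 / 2 :: real) ^ i) = 2" by (subst suminf_geometric) auto
    finally show ?thesis by simp
  qed
  show "\<bar>suminf a\<bar> \<le> 2 * M" using tail[of 0] by simp
  show "\<bar>(\<Sum>i<n. a i) - suminf a\<bar> \<le> 2 * M * (1 / 2) ^ n"
    using tail[of n] suminf_split_initial_segment[OF s, of n] by simp
qed

text \<open>The joint derivative needs the differentials to converge uniformly in operator norm; the
  second u-derivative comes separately, from the one-variable theorem applied to the series of first
  u-derivatives.\<close>

lemma jet_on_suminf:
  assumes L: "open L" "convex L" and U: "open U" "convex U"
    and f: "\<And>n. jet_on L U (f n) (J n)"
    and bd: "\<And>n l u. l \<in> L \<Longrightarrow> u \<in> U \<Longrightarrow> \<bar>jv (J n l u)\<bar> \<le> M * (1 / 2) ^ n"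
      "\<And>n l u. l \<in> L \<Longrightarrow> u \<in> U \<Longrightarrow> \<bar>ju (J n l u)\<bar> \<le> M * (1 / 2) ^ n"
      "\<And>n l u. l \<in> L \<Longrightarrow> u \<in> U \<Longrightarrow> \<bar>juu (J n l u)\<bar> \<le> M * (1 / 2) ^ n"
      "\<And>n l u. l \<in> L \<Longrightarrow> u \<in> U \<Longrightarrow> \<bar>jl (J n l u)\<bar> \<le> M * (1 / 2) ^ n"
  shows "jet_on L U (\<lambda>l u. \<Sum>n. f n l u) (\<lambda>l u. Jet (\<Sum>n. jv (J n l u)) (\<Sum>n. ju (J n l u))
    (\<Sum>n. juu (J n l u)) (\<Sum>n. jl (J n l u)))"
proof (rule jet_onI)
  fix l u assume lu: "l \<in> L" "u \<in> U"
  have M: "M \<ge> 0" using bd(1)[OF lu, of 0] by simp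
  have fv: "f n l u = jv (J n l u)" if "l \<in> L" "u \<in> U" for n l u
    using jet_onD(1)[OF f that] by simp
  show "jv (Jet (\<Sum>n. jv (J n l u)) (\<Sum>n. ju (J n l u)) (\<Sum>n. juu (J n l u)) (\<Sum>n. jl (J n l u))) = (\<Sum>n. f n l u)"
    using fv[OF lu] by simp
  \<comment> \<open>Each geometric tail costs 2 * M, and there are two partial derivatives.\<close>
  have tendM: "(\<lambda>n. 4 * M * (1 / 2 :: real) ^ n) \<longlonglongrightarrow> 0"
    by (intro tendsto_mult_right_zero LIMSEQ_power_zero) auto
  define F where "F n z = f n (fst z) (snd z)" for n z
  define F' where "F' n z h = jl (J n (fst z) (snd z)) * fst h + ju (J n (fst z) (snd z)) * snd h" for n z and h :: "real \<times> real"
  define G where "G z h = (\<Sum>n. jl (J n (fst z) (snd z))) * fst h + (\<Sum>n. ju (J n (fst z) (snd z))) * snd h" for z and h :: "real \<times> real"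
  have conv: "convex (L \<times> U)" using L U by (intro convex_Times)
  have F: "(F n has_derivative F' n z) (at z within L \<times> U)" if z: "z \<in> L \<times> U" for n z
  proof -
    have z': "fst z \<in> L" "snd z \<in> U" using z by auto
    have "F n = (\<lambda>z. f n (fst z) (snd z))" "F' n z = (\<lambda>h. jl (J n (fst z) (snd z)) * fst h + ju (J n (fst z) (snd z)) * snd h)"
      by (simp_all add: F_def F'_def fun_eq_iff)
    with jet_onD(6)[OF f z', of n] have "(F n has_derivative F' n z) (at z)" by (simp only: prod.collapse)
    then show ?thesis by (rule has_derivative_at_withinI)
  qed
  have sums: "(\<lambda>n. F n (l, u)) sums (\<Sum>n. f n l u)"
    using geometric_bound(1)[of "\<lambda>n. f n l u" M] bd(1)[OF lu] fv[OF lu] by (auto simp: F_def intro: summable_sums)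
  have unif: "\<forall>\<^sub>F n in sequentially. \<forall>z\<in>L \<times> U. \<forall>h. norm ((\<Sum>i<n. F' i z h) - G z h) \<le> e * norm h" if e: "e > 0" for e
  proof -
    have "\<forall>\<^sub>F n in sequentially. 4 * M * (1 / 2 :: real) ^ n < e"
      using order_tendstoD(2)[OF tendM e] .
    then show ?thesis
      unfolding F'_def G_def
    proof (eventually_elim, intro ballI allI)
      fix n z and h :: "real \<times> real" assume n: "4 * M * (1 / 2) ^ n < e" and z: "z \<in> L \<times> U"
      have z': "fst z \<in> L" "snd z \<in> U" using z by auto
      let ?A = "(\<Sum>i<n. jl (J i (fst z) (snd z))) - (\<Sum>n. jl (J n (fst z) (snd z)))"
      let ?B = "(\<Sum>i<n. ju (J i (fst z) (snd z))) - (\<Sum>n. ju (J n (fst z) (snd z)))"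
      have AB: "\<bar>?A\<bar> \<le> 2 * M * (1 / 2) ^ n" "\<bar>?B\<bar> \<le> 2 * M * (1 / 2) ^ n"
        using geometric_bound(3)[OF bd(4)[OF z']] geometric_bound(3)[OF bd(2)[OF z']] by auto
      have h: "\<bar>fst h\<bar> \<le> norm h" "\<bar>snd h\<bar> \<le> norm h"
        using norm_fst_le[of "fst h" "snd h"] norm_snd_le[of "snd h" "fst h"] by auto
      have regroup: "a * x + b * y - (c * x + d * y) = (a - c) * x + (b - d) * y" for a b c d x y :: real
        by (simp add: algebra_simps)
      have "norm ((\<Sum>i<n. jl (J i (fst z) (snd z)) * fst h + ju (J i (fst z) (snd z)) * snd h) -
          ((\<Sum>n. jl (J n (fst z) (snd z))) * fst h + (\<Sum>n. ju (J n (fst z) (snd z))) * snd h))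
        = \<bar>?A * fst h + ?B * snd h\<bar>"
        unfolding sum.distrib sum_distrib_right[symmetric] real_norm_def
        by (simp only: regroup)
      also have "\<dots> \<le> \<bar>?A\<bar> * \<bar>fst h\<bar> + \<bar>?B\<bar> * \<bar>snd h\<bar>"
        by (rule order_trans[OF abs_triangle_ineq]) (simp add: abs_mult)
      also have "\<dots> \<le> (2 * M * (1 / 2) ^ n) * norm h + (2 * M * (1 / 2) ^ n) * norm h"
        using AB h M by (intro add_mono mult_mono) auto
      also have "\<dots> = (4 * M * (1 / 2) ^ n) * norm h" by simp
      also have "\<dots> \<le> e * norm h" using n by (intro mult_right_mono) auto
      finally show "norm ((\<Sum>i<n. jl (J i (fst z) (snd z)) * fst h + ju (J i (fst z) (snd z)) * snd h) -
          ((\<Sum>n. jl (J n (fst z) (snd z))) * fst h + (\<Sum>n. ju (J n (fst z) (snd z))) * snd h)) \<le> e * norm h" .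
    qed
  qed
  obtain g where g: "\<And>z. z \<in> L \<times> U \<Longrightarrow> (\<lambda>n. F n z) sums (g z)" "(g has_derivative G (l, u)) (at (l, u) within L \<times> U)"
    using has_derivative_series[OF conv F unif _ sums] lu by blast
  have "open (L \<times> U)" using L U by (intro open_Times)
  then have "(g has_derivative (\<lambda>h. (\<Sum>n. jl (J n l u)) * fst h + (\<Sum>n. ju (J n l u)) * snd h)) (at (l, u))"
    using g(2) lu by (simp add: at_within_open[of "(l, u)" "L \<times> U"] G_def[abs_def])
  then have "((\<lambda>z. \<Sum>n. f n (fst z) (snd z)) has_derivative
      (\<lambda>h. (\<Sum>n. jl (J n l u)) * fst h + (\<Sum>n. ju (J n l u)) * snd h)) (at (l, u))"
    by (rule has_derivative_transform_within_open[OF _ \<open>open (L \<times> U)\<close>])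
      (use lu g(1) in \<open>auto simp: F_def dest!: sums_unique\<close>)
  then show "((\<lambda>z. \<Sum>n. f n (fst z) (snd z)) has_derivative
      (\<lambda>h. jl (Jet (\<Sum>n. jv (J n l u)) (\<Sum>n. ju (J n l u)) (\<Sum>n. juu (J n l u)) (\<Sum>n. jl (J n l u))) * fst h +
        ju (Jet (\<Sum>n. jv (J n l u)) (\<Sum>n. ju (J n l u)) (\<Sum>n. juu (J n l u)) (\<Sum>n. jl (J n l u))) * snd h)) (at (l, u))"
    by simp
  have "((\<lambda>u. \<Sum>n. ju (J n l u)) has_field_derivative (\<Sum>n. juu (J n l u))) (at u)"
  proof (rule has_field_derivative_series'(2)[OF U(2)])
    show "((\<lambda>u. ju (J n l u)) has_real_derivative juu (J n l u)) (at u within U)" if "u \<in> U" for n u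
      using jet_onD(3)[OF f lu(1) that] by (rule has_field_derivative_at_within)
    show "uniformly_convergent_on U (\<lambda>n u. \<Sum>i<n. juu (J i l u))"
      by (rule Weierstrass_m_test'[where M = "\<lambda>n. M * (1 / 2) ^ n"])
        (use bd(3) lu in \<open>auto intro!: summable_mult summable_geometric\<close>)
    show "summable (\<lambda>n. ju (J n l u))" using geometric_bound(1)[OF bd(2)[OF lu]] .
    show "u \<in> interior U" using lu U by (simp add: interior_open)
  qed (use lu in auto)
  then show "((\<lambda>u. ju (Jet (\<Sum>n. jv (J n l u)) (\<Sum>n. ju (J n l u)) (\<Sum>n. juu (J n l u)) (\<Sum>n. jl (J n l u)))) has_real_derivative
      juu (Jet (\<Sum>n. jv (J n l u)) (\<Sum>n. ju (J n l u)) (\<Sum>n. juu (J n l u)) (\<Sum>n. jl (J n l u)))) (at u)"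
    by simp
qed (use U in auto)

text \<open>If the parametrisation s \<mapsto> (P (l s), P s), with P s = \<Sum>k. c k * s ^ k, is to conjugate the Henon map to
  s \<mapsto> l s, then P (l s) = a - (P s)^2 + b P (s / l). Comparing constant terms makes c 0 the fixed point, and
  the linear terms give l + 2 c 0 - b / l = 0, that is, l is an eigenvalue at the fixed point and
  c 0 = (b / l - l) / 2; the coefficient l ^ k + 2 c 0 - b / l ^ k of c k is the quantity \<open>denom b l k\<close>. Normalising c 1 = 1
  determines all other c k. The same formulas serve both invariant manifolds, with l one eigenvalue or the
  other (their product is - b), and for fixed b the eigenvalue can replace a as the parameter of the family.\<close>

definition denom :: "real \<Rightarrow> real \<Rightarrow> nat \<Rightarrow> real" where
  "denom b l k = l ^ k - l + b / l - b / l ^ k"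

definition denom' :: "real \<Rightarrow> real \<Rightarrow> nat \<Rightarrow> real" where
  "denom' b l k = k * l ^ (k - 1) - 1 - b / l\<^sup>2 + k * b / l ^ (k + 1)"

fun curve_coeff :: "real \<Rightarrow> real \<Rightarrow> nat \<Rightarrow> real" where
  "curve_coeff b l k = (if k = 0 then (b / l - l) / 2 else if k = 1 then 1
     else - (\<Sum>j\<in>{1..<k}. curve_coeff b l j * curve_coeff b l (k - j)) / denom b l k)"

declare curve_coeff.simps [simp del]

definition curve :: "real \<Rightarrow> real \<Rightarrow> real \<Rightarrow> real" where
  "curve b l s = (\<Sum>k. curve_coeff b l k * s ^ k)"

text \<open>Starts at degree 5 because the coefficients up to degree 4 are computed
  explicitly.\<close>

definition curve_tail :: "real \<Rightarrow> real \<Rightarrow> real \<Rightarrow> real" where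
  "curve_tail b l s = (\<Sum>n. curve_coeff b l (n + 5) * s ^ (n + 5))"

text \<open>Termwise derivatives. The l-derivative of a coefficient is left as \<open>deriv\<close>,
  since only its size matters; \<open>coeff_deriv\<close> bounds it along the recursion.\<close>

definition curve_tail_jet :: "real \<Rightarrow> real \<Rightarrow> real \<Rightarrow> real jet" where
  "curve_tail_jet b l s = Jet (\<Sum>n. curve_coeff b l (n + 5) * s ^ (n + 5))
     (\<Sum>n. real (n + 5) * curve_coeff b l (n + 5) * s ^ (n + 4))
     (\<Sum>n. real (n + 5) * real (n + 4) * curve_coeff b l (n + 5) * s ^ (n + 3))
     (\<Sum>n. deriv (\<lambda>l. curve_coeff b l (n + 5)) l * s ^ (n + 5))"

lemma coeff_0: "curve_coeff b l 0 = (b / l - l) / 2" and coeff_1: "curve_coeff b l (Suc 0) = 1"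
  and coeff_rec: "k \<ge> 2 \<Longrightarrow> curve_coeff b l k = - (\<Sum>j\<in>{1..<k}. curve_coeff b l j * curve_coeff b l (k - j)) / denom b l k"
  by (subst curve_coeff.simps; simp)+

text \<open>The factors caused by differentiating twice in s, or once in l, are absorbed into 2 ^ n,
  so that a ratio 1/4 still leaves a majorant of ratio 1/2.\<close>

lemma linear_le_power2: "real (n + 5) \<le> 5 * 2 ^ n" "real (n + 5) * real (n + 4) \<le> 20 * 2 ^ n" "real (n + 4) \<le> 4 * 2 ^ n"
proof -
  show 1: "real (n + 5) \<le> 5 * 2 ^ n" for n by (induction n) auto
  show "real (n + 4) \<le> 4 * 2 ^ n" by (induction n) auto
  show "real (n + 5) * real (n + 4) \<le> 20 * 2 ^ n"
  proof (induction n)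
    case (Suc n)
    have "real (Suc n + 5) * real (Suc n + 4) = real (n + 5) * real (n + 4) + 2 * real (n + 5)" by (simp add: algebra_simps)
    also have "\<dots> \<le> 20 * 2 ^ n + 2 * (5 * 2 ^ n)" by (intro add_mono mult_left_mono Suc 1) auto
    also have "\<dots> \<le> 20 * 2 ^ Suc n" by simp
    finally show ?case .
  qed simp
qed

text \<open>Conditions for convergence of the recursion, met by both eigenvalues with different
  constants. \<open>denom_ge\<close> compares the divisor with the number k - 1 of terms in the
  convolution; its factor 2 is the room that closes the induction for l-derivatives in
  \<open>coeff_deriv\<close>. \<open>denom'_le\<close> bounds the logarithmic derivative of the
  divisor, and \<open>\<rho> * r \<le> 1 / 4\<close> keeps |s| < r well inside the disc of
  convergence.\<close>

locale curve_series =
  fixes b :: real and L :: "real set" and \<rho> \<kappa> r :: real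
  assumes L: "open L" "convex L" "\<And>l. l \<in> L \<Longrightarrow> l > 0"
    and \<rho>: "\<rho> > 0" and \<kappa>: "\<kappa> \<ge> 0" and r: "r > 0" "\<rho> * r \<le> 1 / 4"
    and denom_ge: "\<And>l k. l \<in> L \<Longrightarrow> k \<ge> 2 \<Longrightarrow> 2 * (real k - 1) \<le> \<rho> * \<bar>denom b l k\<bar>"
    and denom'_le: "\<And>l k. l \<in> L \<Longrightarrow> k \<ge> 2 \<Longrightarrow> \<bar>denom' b l k\<bar> \<le> \<kappa> * real k * \<bar>denom b l k\<bar>"
begin

lemma denom_nz: "l \<in> L \<Longrightarrow> k \<ge> 2 \<Longrightarrow> denom b l k \<noteq> 0"
  using denom_ge[of l k] by auto

lemma denom_der:
  assumes l: "l \<in> L" and k: "k \<ge> 1"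
  shows "((\<lambda>l. denom b l k) has_real_derivative denom' b l k) (at l)"
proof -
  have l0: "l \<noteq> 0" using L(3)[OF l] by simp
  obtain n where n: "k = Suc n" using k by (cases k) auto
  have 1: "((\<lambda>l. l ^ k) has_real_derivative k * l ^ (k - 1)) (at l)"
    by (rule DERIV_cong[OF DERIV_power[OF DERIV_ident]]) simp
  have 2: "((\<lambda>l. b / l ^ k) has_real_derivative - (k * b / l ^ (k + 1))) (at l)"
    by (rule DERIV_cong[OF DERIV_divide[OF DERIV_const 1]]) (use l0 in \<open>simp_all add: n field_simps\<close>)
  have 3: "((\<lambda>l. b / l) has_real_derivative - (b / l\<^sup>2)) (at l)"
    by (rule DERIV_cong[OF DERIV_divide[OF DERIV_const DERIV_ident]]) (use l0 in \<open>simp_all add: power2_eq_square\<close>)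
  show ?thesis
    unfolding denom_def denom'_def
    by (rule DERIV_cong[OF DERIV_diff[OF DERIV_add[OF DERIV_diff[OF 1 DERIV_ident] 3] 2]]) simp
qed

text \<open>In the convolution the exponents of \<rho> always add up to k - 1, over k terms; the
  division supplies the missing factor \<rho>.\<close>

lemma coeff_bound: "l \<in> L \<Longrightarrow> \<bar>curve_coeff b l (Suc k)\<bar> \<le> \<rho> ^ k"
proof (induction k rule: less_induct)
  case (less k)
  show ?case
  proof (cases "k = 0")
    case False
    define n where "n = Suc k"
    have n: "n \<ge> 2" using False by (simp add: n_def)
    have E: "2 * (real n - 1) \<le> \<rho> * \<bar>denom b l n\<bar>" by (rule denom_ge[OF less.prems n])
    have t: "\<bar>curve_coeff b l j * curve_coeff b l (n - j)\<bar> \<le> \<rho> ^ (k - 1)" if jn: "j \<in> {1..<n}" for j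
    proof -
      from jn obtain i where i: "j = Suc i" "i < k" by (cases j) (auto simp: n_def)
      have "n - j = Suc (k - 1 - i)" using i by (auto simp: n_def)
      then have "\<bar>curve_coeff b l j * curve_coeff b l (n - j)\<bar> \<le> \<rho> ^ i * \<rho> ^ (k - 1 - i)"
        unfolding abs_mult using less.IH[of i] less.IH[of "k - 1 - i"] i less.prems \<rho> by (intro mult_mono) auto
      also have "\<dots> = \<rho> ^ (k - 1)" using i by (simp flip: power_add)
      finally show ?thesis .
    qed
    have "\<bar>\<Sum>j\<in>{1..<n}. curve_coeff b l j * curve_coeff b l (n - j)\<bar> \<le> (\<Sum>j\<in>{1..<n}. \<rho> ^ (k - 1))"
      by (rule order_trans[OF sum_abs sum_mono[OF t]])
    also have "\<dots> = (real n - 1) * \<rho> ^ (k - 1)" using n by (simp add: of_nat_diff)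
    finally have S: "\<bar>\<Sum>j\<in>{1..<n}. curve_coeff b l j * curve_coeff b l (n - j)\<bar> \<le> (real n - 1) * \<rho> ^ (k - 1)" .
    have "(real n - 1) * \<rho> ^ (k - 1) \<le> (\<rho> * \<bar>denom b l n\<bar>) * \<rho> ^ (k - 1)"
      using E n \<rho> by (intro mult_right_mono) auto
    also have "\<dots> = \<rho> ^ k * \<bar>denom b l n\<bar>" using False by (cases k) auto
    finally show ?thesis
      using S denom_nz[OF less.prems n] coeff_rec[OF n, of b l] by (simp add: n_def[symmetric] divide_le_eq)
  qed (simp add: coeff_1)
qed

text \<open>Differentiability and bound go through one induction. Apart from the factor
  \<open>\<rho> ^ k\<close>, the differentiated convolution contributes
  \<open>\<kappa> * (k - 1)\<close> and the logarithmic derivative of the divisor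
  \<open>\<kappa> * (k + 1)\<close>, together exactly \<open>2 * \<kappa> * k\<close>.\<close>

lemma coeff_deriv:
  "l \<in> L \<Longrightarrow> ((\<lambda>l. curve_coeff b l (Suc k)) has_real_derivative deriv (\<lambda>l. curve_coeff b l (Suc k)) l) (at l) \<and>
     \<bar>deriv (\<lambda>l. curve_coeff b l (Suc k)) l\<bar> \<le> 2 * \<kappa> * k * \<rho> ^ k"
proof (induction k arbitrary: l rule: less_induct)
  case (less k)
  show ?case
  proof (cases "k = 0")
    case True
    then show ?thesis by (simp add: coeff_1)
  next
    case False
    define n where "n = Suc k"
    have n: "n \<ge> 2" using False by (simp add: n_def)
    define c' where "c' j = deriv (\<lambda>l. curve_coeff b l j) l" for j
    define N' where "N' = (\<Sum>j\<in>{1..<n}. c' j * curve_coeff b l (n - j) + curve_coeff b l j * c' (n - j))"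
    have j: "((\<lambda>l. curve_coeff b l j) has_real_derivative c' j) (at l)" "\<bar>c' j\<bar> \<le> 2 * \<kappa> * real (j - 1) * \<rho> ^ (j - 1)"
      "\<bar>curve_coeff b l j\<bar> \<le> \<rho> ^ (j - 1)"
      if jn: "j \<in> {1..<n}" for j
    proof -
      obtain i where i: "j = Suc i" "i < k" using jn by (cases j) (auto simp: n_def)
      show "((\<lambda>l. curve_coeff b l j) has_real_derivative c' j) (at l)" "\<bar>c' j\<bar> \<le> 2 * \<kappa> * real (j - 1) * \<rho> ^ (j - 1)"
        "\<bar>curve_coeff b l j\<bar> \<le> \<rho> ^ (j - 1)"
        using less.IH[OF i(2) less.prems] coeff_bound[OF less.prems, of i] by (simp_all add: i c'_def)
    qed
    have nj: "n - j \<in> {1..<n}" if "j \<in> {1..<n}" for j using that by auto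
    have der: "((\<lambda>l. curve_coeff b l n) has_real_derivative (- N' / denom b l n - curve_coeff b l n * (denom' b l n / denom b l n))) (at l)"
    proof -
      define N where "N x = - (\<Sum>j\<in>{1..<n}. curve_coeff b x j * curve_coeff b x (n - j))" for x
      have N: "curve_coeff b x n = N x / denom b x n" for x using coeff_rec[OF n, of b x] by (simp add: N_def)
      have dN: "(N has_real_derivative - N') (at l)"
        unfolding N'_def N_def[abs_def]
        by (intro DERIV_minus DERIV_sum DERIV_cong[OF DERIV_mult[OF j(1) j(1)[OF nj]]]) auto
      have "((\<lambda>x. N x / denom b x n) has_real_derivative
        (- N' / denom b l n - N l / denom b l n * (denom' b l n / denom b l n))) (at l)"
        by (rule DERIV_cong[OF DERIV_divide[OF dN denom_der[OF less.prems, of n] denom_nz[OF less.prems n]]])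
          (use n denom_nz[OF less.prems n] in \<open>simp_all add: diff_divide_distrib\<close>)
      then show ?thesis by (simp add: N)
    qed
    have E: "2 * (real n - 1) \<le> \<rho> * \<bar>denom b l n\<bar>" by (rule denom_ge[OF less.prems n])
    have Epos: "\<bar>denom b l n\<bar> > 0" using denom_nz[OF less.prems n] by simp
    have t: "\<bar>c' j * curve_coeff b l (n - j) + curve_coeff b l j * c' (n - j)\<bar> \<le> 2 * \<kappa> * (real k - 1) * \<rho> ^ (k - 1)" if jn: "j \<in> {1..<n}" for j
    proof -
      have 1: "\<bar>c' j * curve_coeff b l (n - j)\<bar> \<le> (2 * \<kappa> * real (j - 1) * \<rho> ^ (j - 1)) * \<rho> ^ (n - j - 1)"
        unfolding abs_mult by (rule mult_mono[OF j(2)[OF jn] j(3)[OF nj[OF jn]]]) (use \<kappa> \<rho> in simp_all)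
      have 2: "\<bar>curve_coeff b l j * c' (n - j)\<bar> \<le> \<rho> ^ (j - 1) * (2 * \<kappa> * real (n - j - 1) * \<rho> ^ (n - j - 1))"
        unfolding abs_mult by (rule mult_mono[OF j(3)[OF jn] j(2)[OF nj[OF jn]]]) (use \<kappa> \<rho> in simp_all)
      have "(2 * \<kappa> * real (j - 1) * \<rho> ^ (j - 1)) * \<rho> ^ (n - j - 1) + \<rho> ^ (j - 1) * (2 * \<kappa> * real (n - j - 1) * \<rho> ^ (n - j - 1))
          = 2 * \<kappa> * (real (j - 1) + real (n - j - 1)) * (\<rho> ^ (j - 1) * \<rho> ^ (n - j - 1))"
        by (simp add: algebra_simps)
      also have "\<rho> ^ (j - 1) * \<rho> ^ (n - j - 1) = \<rho> ^ (k - 1)"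
        using jn by (simp add: n_def flip: power_add)
      also have "real (j - 1) + real (n - j - 1) = real k - 1" using jn by (simp add: n_def of_nat_diff)
      finally show ?thesis using order_trans[OF abs_triangle_ineq add_mono[OF 1 2]] by simp
    qed
    have "\<bar>N'\<bar> \<le> (\<Sum>j\<in>{1..<n}. 2 * \<kappa> * (real k - 1) * \<rho> ^ (k - 1))"
      unfolding N'_def by (rule order_trans[OF sum_abs sum_mono[OF t]])
    also have "\<dots> = (real n - 1) * (2 * \<kappa> * (real k - 1) * \<rho> ^ (k - 1))" using n by (simp add: of_nat_diff)
    also have "\<dots> = (2 * (real n - 1)) * (\<kappa> * (real k - 1) * \<rho> ^ (k - 1))" by simp
    also have "\<dots> \<le> (\<rho> * \<bar>denom b l n\<bar>) * (\<kappa> * (real k - 1) * \<rho> ^ (k - 1))"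
      using E \<kappa> \<rho> False by (intro mult_right_mono) auto
    also have "\<dots> = \<kappa> * (real k - 1) * \<rho> ^ k * \<bar>denom b l n\<bar>" using False by (cases k) auto
    finally have 1: "\<bar>N'\<bar> / \<bar>denom b l n\<bar> \<le> \<kappa> * (real k - 1) * \<rho> ^ k"
      using Epos by (simp add: divide_le_eq)
    have "\<bar>denom' b l n\<bar> / \<bar>denom b l n\<bar> \<le> \<kappa> * real n"
      using denom'_le[OF less.prems n] Epos by (simp add: divide_le_eq)
    then have 2: "\<bar>curve_coeff b l n\<bar> * (\<bar>denom' b l n\<bar> / \<bar>denom b l n\<bar>) \<le> \<rho> ^ k * (\<kappa> * real n)"
      using coeff_bound[OF less.prems, of k] \<rho> by (intro mult_mono) (auto simp: n_def)
    have "\<bar>- N' / denom b l n - curve_coeff b l n * (denom' b l n / denom b l n)\<bar>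
        \<le> \<bar>N'\<bar> / \<bar>denom b l n\<bar> + \<bar>curve_coeff b l n\<bar> * (\<bar>denom' b l n\<bar> / \<bar>denom b l n\<bar>)"
      by (rule order_trans[OF abs_triangle_ineq4]) (simp add: abs_mult)
    also have "\<dots> \<le> \<kappa> * (real k - 1) * \<rho> ^ k + \<rho> ^ k * (\<kappa> * real n)" using 1 2 by (rule add_mono)
    also have "\<dots> = 2 * \<kappa> * k * \<rho> ^ k" by (simp add: n_def algebra_simps)
    finally show ?thesis using der DERIV_imp_deriv[OF der] by (simp add: n_def)
  qed
qed

text \<open>Splitting off \<open>\<rho> ^ 4\<close> and the lowest power of \<sigma> leaves
  \<open>(\<rho> * \<sigma>) ^ n\<close>, at most (1/4) ^ n. Bounding by the range \<sigma> actually
  used, not by \<open>r\<close>, is what makes the remainders numerically negligible.\<close>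

lemma tail_term_bounds:
  assumes l: "l \<in> L" and s: "\<bar>s\<bar> \<le> \<sigma>" and \<sigma>: "\<sigma> \<le> r"
  shows "\<bar>curve_coeff b l (n + 5) * s ^ (n + 5)\<bar> \<le> \<rho> ^ 4 * \<sigma> ^ 5 * (1 / 2) ^ n"
    "\<bar>real (n + 5) * curve_coeff b l (n + 5) * s ^ (n + 4)\<bar> \<le> 5 * \<rho> ^ 4 * \<sigma> ^ 4 * (1 / 2) ^ n"
    "\<bar>real (n + 5) * real (n + 4) * curve_coeff b l (n + 5) * s ^ (n + 3)\<bar> \<le> 20 * \<rho> ^ 4 * \<sigma> ^ 3 * (1 / 2) ^ n"
    "\<bar>deriv (\<lambda>l. curve_coeff b l (n + 5)) l * s ^ (n + 5)\<bar> \<le> 8 * \<kappa> * \<rho> ^ 4 * \<sigma> ^ 5 * (1 / 2) ^ n"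
proof -
  have \<sigma>0: "\<sigma> \<ge> 0" using s by linarith
  have "\<rho> * \<sigma> \<le> \<rho> * r" using \<rho> \<sigma> by simp
  then have q: "0 \<le> \<rho> * \<sigma>" "\<rho> * \<sigma> \<le> 1 / 4" using \<rho> \<sigma>0 r by (simp, linarith)
  have pw: "w * (\<rho> ^ (n + 4) * \<sigma> ^ (n + m)) \<le> a * \<rho> ^ 4 * \<sigma> ^ m * (1 / 2) ^ n" if "w \<le> a * 2 ^ n" "a \<ge> 0" for w a m
  proof -
    have "w * (\<rho> ^ (n + 4) * \<sigma> ^ (n + m)) \<le> (a * 2 ^ n) * (\<rho> ^ (n + 4) * \<sigma> ^ (n + m))"
      using that \<rho> \<sigma>0 by (intro mult_right_mono) auto
    also have "\<dots> = a * \<rho> ^ 4 * \<sigma> ^ m * (2 ^ n * (\<rho> * \<sigma>) ^ n)" by (simp add: power_add power_mult_distrib)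
    also have "\<dots> \<le> a * \<rho> ^ 4 * \<sigma> ^ m * (2 ^ n * (1 / 4) ^ n)"
      using that \<rho> \<sigma>0 q by (intro mult_left_mono power_mono) auto
    also have "2 ^ n * (1 / 4 :: real) ^ n = (1 / 2) ^ n" by (simp flip: power_mult_distrib)
    finally show ?thesis .
  qed
  have c: "\<bar>curve_coeff b l (n + 5)\<bar> \<le> \<rho> ^ (n + 4)" using coeff_bound[OF l, of "n + 4"] by (simp add: add.commute)
  have d: "\<bar>deriv (\<lambda>l. curve_coeff b l (n + 5)) l\<bar> \<le> 2 * \<kappa> * real (n + 4) * \<rho> ^ (n + 4)"
    using coeff_deriv[OF l, of "n + 4"] by (simp add: eval_nat_numeral)
  have sp: "\<bar>s ^ m\<bar> \<le> \<sigma> ^ m" for m using s by (simp add: power_abs power_mono)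
  have cs: "\<bar>curve_coeff b l (n + 5)\<bar> * \<bar>s ^ (n + m)\<bar> \<le> \<rho> ^ (n + 4) * \<sigma> ^ (n + m)" for m
    using c sp[of "n + m"] \<rho> by (intro mult_mono) auto
  show "\<bar>curve_coeff b l (n + 5) * s ^ (n + 5)\<bar> \<le> \<rho> ^ 4 * \<sigma> ^ 5 * (1 / 2) ^ n"
    using cs[of 5] pw[of 1 1 5] by (simp add: abs_mult)
  have "real (n + 5) * (\<bar>curve_coeff b l (n + 5)\<bar> * \<bar>s ^ (n + 4)\<bar>) \<le> real (n + 5) * (\<rho> ^ (n + 4) * \<sigma> ^ (n + 4))"
    by (intro mult_left_mono cs) auto
  also have "\<dots> \<le> 5 * \<rho> ^ 4 * \<sigma> ^ 4 * (1 / 2) ^ n" by (rule pw[OF linear_le_power2(1)]) auto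
  finally show "\<bar>real (n + 5) * curve_coeff b l (n + 5) * s ^ (n + 4)\<bar> \<le> 5 * \<rho> ^ 4 * \<sigma> ^ 4 * (1 / 2) ^ n"
    by (simp add: abs_mult mult.assoc)
  have "(real (n + 5) * real (n + 4)) * (\<bar>curve_coeff b l (n + 5)\<bar> * \<bar>s ^ (n + 3)\<bar>) \<le> (real (n + 5) * real (n + 4)) * (\<rho> ^ (n + 4) * \<sigma> ^ (n + 3))"
    by (intro mult_left_mono cs) auto
  also have "\<dots> \<le> 20 * \<rho> ^ 4 * \<sigma> ^ 3 * (1 / 2) ^ n" by (rule pw[OF linear_le_power2(2)]) auto
  finally show "\<bar>real (n + 5) * real (n + 4) * curve_coeff b l (n + 5) * s ^ (n + 3)\<bar> \<le> 20 * \<rho> ^ 4 * \<sigma> ^ 3 * (1 / 2) ^ n"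
    by (simp add: abs_mult mult.assoc)
  have "\<bar>deriv (\<lambda>l. curve_coeff b l (n + 5)) l * s ^ (n + 5)\<bar> \<le> (2 * \<kappa> * real (n + 4) * \<rho> ^ (n + 4)) * \<sigma> ^ (n + 5)"
    unfolding abs_mult using d sp[of "n + 5"] \<rho> \<kappa> by (intro mult_mono) auto
  also have "\<dots> = (2 * \<kappa> * real (n + 4)) * (\<rho> ^ (n + 4) * \<sigma> ^ (n + 5))" by simp
  also have "\<dots> \<le> 8 * \<kappa> * \<rho> ^ 4 * \<sigma> ^ 5 * (1 / 2) ^ n"
    by (rule pw) (use mult_left_mono[OF linear_le_power2(3)[of n], of "2 * \<kappa>"] \<kappa> in auto)
  finally show "\<bar>deriv (\<lambda>l. curve_coeff b l (n + 5)) l * s ^ (n + 5)\<bar> \<le> 8 * \<kappa> * \<rho> ^ 4 * \<sigma> ^ 5 * (1 / 2) ^ n" .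
qed

lemma tail_bounds:
  assumes "l \<in> L" "\<bar>s\<bar> \<le> \<sigma>" "\<sigma> \<le> r"
  shows "\<bar>jv (curve_tail_jet b l s)\<bar> \<le> 2 * \<rho> ^ 4 * \<sigma> ^ 5"
    "\<bar>ju (curve_tail_jet b l s)\<bar> \<le> 10 * \<rho> ^ 4 * \<sigma> ^ 4"
    "\<bar>juu (curve_tail_jet b l s)\<bar> \<le> 40 * \<rho> ^ 4 * \<sigma> ^ 3"
    "\<bar>jl (curve_tail_jet b l s)\<bar> \<le> 16 * \<kappa> * \<rho> ^ 4 * \<sigma> ^ 5"
  using tail_term_bounds[OF assms, THEN geometric_bound(2)] by (simp_all add: curve_tail_jet_def)

lemma jet_on_tail: "jet_on L {- r<..<r} (curve_tail b) (curve_tail_jet b)"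
proof -
  define T where "T n l s = Jet (curve_coeff b l (n + 5) * s ^ (n + 5))
     (real (n + 5) * curve_coeff b l (n + 5) * s ^ (n + 4))
     (real (n + 5) * real (n + 4) * curve_coeff b l (n + 5) * s ^ (n + 3))
     (deriv (\<lambda>l. curve_coeff b l (n + 5)) l * s ^ (n + 5))" for n l s
  define M where "M = \<rho> ^ 4 * r ^ 5 + 5 * \<rho> ^ 4 * r ^ 4 + 20 * \<rho> ^ 4 * r ^ 3 + 8 * \<kappa> * \<rho> ^ 4 * r ^ 5"
  have M: "\<rho> ^ 4 * r ^ 5 \<le> M" "5 * \<rho> ^ 4 * r ^ 4 \<le> M" "20 * \<rho> ^ 4 * r ^ 3 \<le> M" "8 * \<kappa> * \<rho> ^ 4 * r ^ 5 \<le> M"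
    using \<rho> \<kappa> r by (auto simp: M_def)
  have MM: "x * (1 / 2) ^ n \<le> M * (1 / 2) ^ n" if "x \<le> M" for x and n :: nat
    using that by (intro mult_right_mono) auto
  have "jet_on L {- r<..<r} (\<lambda>l s. \<Sum>n. curve_coeff b l (n + 5) * s ^ (n + 5))
    (\<lambda>l s. Jet (\<Sum>n. jv (T n l s)) (\<Sum>n. ju (T n l s)) (\<Sum>n. juu (T n l s)) (\<Sum>n. jl (T n l s)))"
  proof (rule jet_on_suminf[where M = M])
    fix n
    show "jet_on L {- r<..<r} (\<lambda>l s. curve_coeff b l (n + 5) * s ^ (n + 5)) (T n)"
    proof (rule jet_onI)
      fix l s :: real assume l: "l \<in> L"
      have "((\<lambda>l. curve_coeff b l (n + 5)) has_real_derivative deriv (\<lambda>l. curve_coeff b l (n + 5)) l) (at l)"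
        using coeff_deriv[OF l, of "n + 4"] by (simp add: eval_nat_numeral)
      then have "((\<lambda>z. curve_coeff b (fst z) (n + 5)) has_derivative (\<lambda>h. deriv (\<lambda>l. curve_coeff b l (n + 5)) l * fst h)) (at (l, s))"
        by (intro has_derivative_compose[of fst fst "(l, s)" UNIV "\<lambda>l. curve_coeff b l (n + 5)"])
          (auto intro!: bounded_linear_imp_has_derivative bounded_linear_fst simp: has_field_derivative_def)
      moreover have "((\<lambda>z. snd z ^ (n + 5)) has_derivative (\<lambda>h. real (n + 5) * s ^ (n + 4) * snd h)) (at (l, s))"
        by (rule has_derivative_eq_rhs[OF has_derivative_power[OF bounded_linear_imp_has_derivative[OF bounded_linear_snd]]])
          (simp add: fun_eq_iff mult_ac add.commute)
      ultimately show "((\<lambda>z. curve_coeff b (fst z) (n + 5) * snd z ^ (n + 5)) has_derivative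
          (\<lambda>h. jl (T n l s) * fst h + ju (T n l s) * snd h)) (at (l, s))"
        unfolding T_def by (rule has_derivative_eq_rhs[OF has_derivative_mult]) (simp add: fun_eq_iff algebra_simps)
      have "((\<lambda>s. (real (n + 5) * curve_coeff b l (n + 5)) * s ^ (n + 4)) has_real_derivative
          (real (n + 5) * curve_coeff b l (n + 5)) * (real (n + 4) * s ^ (n + 3))) (at s)"
        by (rule DERIV_cmult[OF DERIV_cong[OF DERIV_power[OF DERIV_ident]]]) (simp add: add.commute)
      then show "((\<lambda>s. ju (T n l s)) has_real_derivative juu (T n l s)) (at s)"
        by (simp add: T_def mult_ac)
    qed (auto simp: T_def)
  next
    fix n l u assume l: "l \<in> L" and u: "u \<in> {- r<..<r}"
    have u': "\<bar>u\<bar> \<le> r" using u by auto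
    note * = tail_term_bounds[OF l u' order_refl, of n]
    show "\<bar>jv (T n l u)\<bar> \<le> M * (1 / 2) ^ n" "\<bar>ju (T n l u)\<bar> \<le> M * (1 / 2) ^ n"
      "\<bar>juu (T n l u)\<bar> \<le> M * (1 / 2) ^ n" "\<bar>jl (T n l u)\<bar> \<le> M * (1 / 2) ^ n"
      unfolding T_def jet.sel
      by (rule order_trans[OF *(1) MM[OF M(1)]] order_trans[OF *(2) MM[OF M(2)]]
          order_trans[OF *(3) MM[OF M(3)]] order_trans[OF *(4) MM[OF M(4)]])+
  qed (use L in auto)
  then show ?thesis by (simp add: T_def curve_tail_def[abs_def] curve_tail_jet_def[abs_def])
qed

end

section \<open>The invariance equation and membership in the stable and unstable sets\<close>

context curve_series
begin

lemma curve_term_bound: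
  assumes l: "l \<in> L" and s: "\<bar>s\<bar> < r"
  shows "\<bar>curve_coeff b l k * s ^ k\<bar> \<le> (\<bar>curve_coeff b l 0\<bar> + 2 * r) * (1 / 2) ^ k"
proof (cases k)
  case (Suc n)
  have "\<bar>curve_coeff b l (Suc n) * s ^ Suc n\<bar> \<le> \<rho> ^ n * r ^ Suc n"
    unfolding abs_mult power_abs using coeff_bound[OF l, of n] s \<rho> by (intro mult_mono power_mono) auto
  also have "\<dots> = r * (\<rho> * r) ^ n" by (simp add: power_mult_distrib)
  also have "\<dots> \<le> r * (1 / 2) ^ n"
    using \<rho> r by (intro mult_left_mono power_mono) (auto simp: less_imp_le)
  also have "\<dots> = 2 * r * (1 / 2) ^ k" by (simp add: Suc)
  also have "\<dots> \<le> (\<bar>curve_coeff b l 0\<bar> + 2 * r) * (1 / 2) ^ k" by (intro mult_right_mono) auto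
  finally show ?thesis by (simp add: Suc)
qed (use r in simp)

lemma curve_summable:
  assumes "l \<in> L" "\<bar>s\<bar> < r"
  shows "summable (\<lambda>k. norm (curve_coeff b l k * s ^ k))" "(\<lambda>k. curve_coeff b l k * s ^ k) sums curve b l s"
proof -
  show *: "summable (\<lambda>k. norm (curve_coeff b l k * s ^ k))"
    by (rule geometric_bound(1)[where M = "\<bar>curve_coeff b l 0\<bar> + 2 * r"]) (use curve_term_bound[OF assms] in simp)
  show "(\<lambda>k. curve_coeff b l k * s ^ k) sums curve b l s"
    unfolding curve_def using summable_norm_cancel[OF *] by (rule summable_sums)
qed

lemma curve_split:
  assumes "l \<in> L" "\<bar>s\<bar> < r"
  shows "curve b l s = (b / l - l) / 2 + s * (1 + s * (curve_coeff b l 2 + s * (curve_coeff b l 3 + s * curve_coeff b l 4))) + curve_tail b l s"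
proof -
  have "curve b l s = curve_tail b l s + (\<Sum>k<5. curve_coeff b l k * s ^ k)"
    unfolding curve_def curve_tail_def
    by (rule suminf_split_initial_segment[OF sums_summable[OF curve_summable(2)[OF assms]]])
  then show ?thesis by (simp add: eval_nat_numeral coeff_0 coeff_1 algebra_simps)
qed

text \<open>Invariance compared coefficient by coefficient: k = 0 leaves the value of a for which c
  0 is the fixed coordinate, k = 1 holds by the choice of c 0, and k \<ge> 2 is the recursion solved
  for c k.\<close>

lemma coeff_invariance:
  assumes l: "l \<in> L"
  shows "curve_coeff b l k * l ^ k + (\<Sum>i\<le>k. curve_coeff b l i * curve_coeff b l (k - i)) - b * (curve_coeff b l k / l ^ k)
    = (if k = 0 then (curve_coeff b l 0)\<^sup>2 + (1 - b) * curve_coeff b l 0 else 0)"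
proof -
  have l0: "l \<noteq> 0" using L(3)[OF l] by simp
  consider "k = 0" | "k = 1" | "k \<ge> 2" by linarith
  then show ?thesis
  proof cases
    case 1
    then show ?thesis by (simp add: power2_eq_square algebra_simps)
  next
    case 2
    then show ?thesis using l0 by (simp add: coeff_0 coeff_1 field_simps)
  next
    case 3
    have "{..k} = insert 0 (insert k {1..<k})" using 3 by auto
    then have C: "(\<Sum>i\<le>k. curve_coeff b l i * curve_coeff b l (k - i))
        = 2 * curve_coeff b l 0 * curve_coeff b l k + (\<Sum>i\<in>{1..<k}. curve_coeff b l i * curve_coeff b l (k - i))"
      using 3 by simp
    have "(\<Sum>i\<in>{1..<k}. curve_coeff b l i * curve_coeff b l (k - i)) = - curve_coeff b l k * denom b l k"
      using coeff_rec[OF 3, of b l] denom_nz[OF l 3] by simp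
    then show ?thesis using 3 l0 unfolding C by (simp add: denom_def coeff_0 field_simps)
  qed
qed

text \<open>By \<open>coeff_invariance\<close> the series is a formal solution; absolute convergence
  and the Cauchy product make it an actual one once all three arguments lie within radius
  \<open>r\<close>.\<close>

lemma curve_functional_equation:
  assumes l: "l \<in> L" and s: "\<bar>s\<bar> < r" "\<bar>l * s\<bar> < r" "\<bar>s / l\<bar> < r"
  shows "curve b l (l * s) = (curve_coeff b l 0)\<^sup>2 + (1 - b) * curve_coeff b l 0 - (curve b l s)\<^sup>2 + b * curve b l (s / l)"
proof -
  let ?c = "curve_coeff b l"
  let ?a = "(?c 0)\<^sup>2 + (1 - b) * ?c 0"
  have "(\<lambda>k. \<Sum>i\<le>k. (?c i * s ^ i) * (?c (k - i) * s ^ (k - i))) sums (curve b l s * curve b l s)"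
    using Cauchy_product_sums[OF curve_summable(1)[OF l s(1)] curve_summable(1)[OF l s(1)]]
    by (simp add: curve_def)
  from sums_diff[OF sums_add[OF curve_summable(2)[OF l s(2)] this] sums_mult[OF curve_summable(2)[OF l s(3)], of b]]
  have "(\<lambda>k. ?c k * (l * s) ^ k + (\<Sum>i\<le>k. (?c i * s ^ i) * (?c (k - i) * s ^ (k - i))) - b * (?c k * (s / l) ^ k))
      sums (curve b l (l * s) + curve b l s * curve b l s - b * curve b l (s / l))" .
  moreover have "?c k * (l * s) ^ k + (\<Sum>i\<le>k. (?c i * s ^ i) * (?c (k - i) * s ^ (k - i))) - b * (?c k * (s / l) ^ k)
      = (if k = 0 then ?a else 0)" for k
  proof -
    have "(\<Sum>i\<le>k. (?c i * s ^ i) * (?c (k - i) * s ^ (k - i))) = (\<Sum>i\<le>k. ?c i * ?c (k - i)) * s ^ k"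
      unfolding sum_distrib_right
    proof (rule sum.cong[OF refl])
      fix i assume "i \<in> {..k}"
      then have "s ^ k = s ^ i * s ^ (k - i)" by (simp flip: power_add)
      then show "(?c i * s ^ i) * (?c (k - i) * s ^ (k - i)) = ?c i * ?c (k - i) * s ^ k" by simp
    qed
    then have "?c k * (l * s) ^ k + (\<Sum>i\<le>k. (?c i * s ^ i) * (?c (k - i) * s ^ (k - i))) - b * (?c k * (s / l) ^ k)
        = (?c k * l ^ k + (\<Sum>i\<le>k. ?c i * ?c (k - i)) - b * (?c k / l ^ k)) * s ^ k"
      by (simp add: power_mult_distrib power_divide algebra_simps)
    then show ?thesis unfolding coeff_invariance[OF l] by simp
  qed
  ultimately have "(\<lambda>k. if k = 0 then ?a else 0) sums (curve b l (l * s) + curve b l s * curve b l s - b * curve b l (s / l))"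
    by simp
  then have "curve b l (l * s) + curve b l s * curve b l s - b * curve b l (s / l) = ?a"
    using sums_single[of 0 "\<lambda>_. ?a"] sums_unique2 by fastforce
  then show ?thesis by (simp add: power2_eq_square)
qed

lemma curve_tendsto:
  assumes l: "l \<in> L" and s: "s \<longlonglongrightarrow> 0" "\<And>n. \<bar>s n\<bar> < r"
  shows "(\<lambda>n. curve b l (s n)) \<longlonglongrightarrow> curve_coeff b l 0"
proof -
  have "isCont (curve_tail b l) 0"
    using jet_onD(4)[OF jet_on_tail l, of 0] r by (auto intro: DERIV_isCont)
  then have "(\<lambda>n. curve_tail b l (s n)) \<longlonglongrightarrow> curve_tail b l 0"
    using s(1) by (rule isCont_tendsto_compose)
  moreover have "curve_tail b l 0 = 0" by (simp add: curve_tail_def power_0_left)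
  ultimately have "(\<lambda>n. (b / l - l) / 2 + s n * (1 + s n * (curve_coeff b l 2 + s n * (curve_coeff b l 3 + s n * curve_coeff b l 4))) + curve_tail b l (s n))
      \<longlonglongrightarrow> (b / l - l) / 2 + 0 * (1 + 0 * (curve_coeff b l 2 + 0 * (curve_coeff b l 3 + 0 * curve_coeff b l 4))) + 0"
    by (intro tendsto_intros s) auto
  then show ?thesis by (simp add: coeff_0 curve_split[OF l s(2)])
qed

abbreviation "par l \<equiv> (curve_coeff b l 0)\<^sup>2 + (1 - b) * curve_coeff b l 0"

text \<open>The backward orbit divides s by l at every step; the invariance equation at s / l ^ n
  links consecutive points.\<close>

lemma curve_in_unstable_set:
  assumes l: "l \<in> L" "l > 1" and s: "\<bar>l * s\<bar> < r"
  shows "(curve b l (l * s), curve b l s) \<in> unstable_set (par l) b (curve_coeff b l 0, curve_coeff b l 0)"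
  unfolding unstable_set_def mem_Collect_eq
proof (intro exI conjI allI)
  let ?s = "\<lambda>n. (curve b l (l * (s / l ^ n)), curve b l (s / l ^ n))"
  have small: "\<bar>l * (s / l ^ n)\<bar> < r" "\<bar>s / l ^ n\<bar> < r" for n
  proof -
    have "\<bar>s\<bar> \<le> \<bar>l * s\<bar>" using l(2) by (simp add: abs_mult mult_le_cancel_right1)
    moreover have "\<bar>x / l ^ n\<bar> \<le> \<bar>x\<bar>" for x :: real
      using l(2) by (simp add: abs_divide divide_le_eq one_le_power mult_le_cancel_left1 less_imp_le)
    ultimately show "\<bar>l * (s / l ^ n)\<bar> < r" "\<bar>s / l ^ n\<bar> < r"
      using s order_le_less_trans by (metis times_divide_eq_right, metis order_trans)
  qed
  show "?s 0 = (curve b l (l * s), curve b l s)" by simp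
  show "henon (par l) b (?s (Suc n)) = ?s n" for n
  proof -
    have e: "l * (s / l ^ Suc n) = s / l ^ n" "s / l ^ n / l = s / l ^ Suc n" using l(2) by (auto simp: field_simps)
    have "curve b l (l * (s / l ^ n)) = par l - (curve b l (s / l ^ n))\<^sup>2 + b * curve b l (s / l ^ n / l)"
      by (rule curve_functional_equation[OF l(1)]) (simp_all only: e small)
    then show ?thesis unfolding e henon_def by simp
  qed
  have "(\<lambda>n. s / l ^ n) \<longlonglongrightarrow> 0"
    using LIMSEQ_divide_realpow_zero[OF l(2), of s] .
  moreover from tendsto_mult_right_zero[OF this, of l] have "(\<lambda>n. l * (s / l ^ n)) \<longlonglongrightarrow> 0" .
  ultimately show "?s \<longlonglongrightarrow> (curve_coeff b l 0, curve_coeff b l 0)"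
    by (intro tendsto_Pair curve_tendsto[OF l(1)] small)
qed

lemma curve_in_stable_set:
  assumes l: "l \<in> L" "l < 1" and s: "\<bar>s\<bar> < r"
  shows "(curve b l (l * s), curve b l s) \<in> stable_set (par l) b (curve_coeff b l 0, curve_coeff b l 0)"
proof -
  have l0: "l > 0" using L(3)[OF l(1)] .
  have small: "\<bar>l ^ n * s\<bar> < r" for n
  proof -
    have "l ^ n \<le> 1" using l0 l(2) by (simp add: power_le_one)
    then have "\<bar>l ^ n * s\<bar> \<le> \<bar>s\<bar>" using mult_right_mono[of "l ^ n" 1 "\<bar>s\<bar>"] l0 by (simp add: abs_mult)
    then show ?thesis using s by simp
  qed
  have it: "(henon (par l) b ^^ n) (curve b l (l * s), curve b l s) = (curve b l (l ^ Suc n * s), curve b l (l ^ n * s))" for n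
  proof (induction n)
    case (Suc n)
    \<comment> \<open>The equation is used one step ahead, at \<open>l ^ Suc n * s\<close>, so that
      division by l returns the argument of the second coordinate.\<close>
    have "curve b l (l * (l ^ Suc n * s)) = par l - (curve b l (l ^ Suc n * s))\<^sup>2 + b * curve b l (l ^ Suc n * s / l)"
      by (rule curve_functional_equation[OF l(1)])
        (use small[of "Suc n"] small[of "Suc (Suc n)"] small[of n] l0 in \<open>auto simp: mult.assoc\<close>)
    then show ?case using Suc l0 by (simp add: henon_def mult.assoc)
  qed simp
  have "(\<lambda>n. l ^ n * s) \<longlonglongrightarrow> 0"
    using l0 l(2) by (intro tendsto_mult_left_zero LIMSEQ_power_zero) auto
  then have "(\<lambda>n. (curve b l (l ^ Suc n * s), curve b l (l ^ n * s))) \<longlonglongrightarrow> (curve_coeff b l 0, curve_coeff b l 0)"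
    using LIMSEQ_Suc by (intro tendsto_Pair curve_tendsto[OF l(1)] small) blast+
  then show ?thesis unfolding stable_set_def mem_Collect_eq it .
qed

end

lemma henon_in_unstable_set:
  assumes "z \<in> unstable_set a b p"
  shows "henon a b z \<in> unstable_set a b p"
proof -
  obtain s where s: "s 0 = z" "\<And>n. henon a b (s (Suc n)) = s n" "s \<longlonglongrightarrow> p"
    using assms unfolding unstable_set_def by blast
  define t where "t n = (case n of 0 \<Rightarrow> henon a b z | Suc m \<Rightarrow> s m)" for n
  have "t \<longlonglongrightarrow> p" using s(3) by (intro LIMSEQ_imp_Suc[of t]) (simp add: t_def)
  moreover have "henon a b (t (Suc n)) = t n" for n using s by (cases n) (auto simp: t_def)
  ultimately show ?thesis unfolding unstable_set_def by (intro CollectI exI[of _ t]) (auto simp: t_def)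
qed

lemma stable_set_henon_iff: "henon a b z \<in> stable_set a b p \<longleftrightarrow> z \<in> stable_set a b p"
proof -
  have "(\<lambda>n. (henon a b ^^ n) (henon a b z)) = (\<lambda>n. (henon a b ^^ Suc n) z)"
    by (simp add: funpow_swap1)
  then show ?thesis unfolding stable_set_def using filterlim_sequentially_Suc[of "\<lambda>n. (henon a b ^^ n) z" "nhds p"] by simp
qed

section \<open>Ball arithmetic\<close>

text \<open>\<open>Ball m r\<close> stands for the reals within r / 2^32 of m / 2^32, and \<open>Any\<close> for all reals.\<close>

datatype ball = Ball int int | Any

instantiation ball :: field_ops
begin
fun plus_ball :: "ball \<Rightarrow> ball \<Rightarrow> ball" where
  "plus_ball (Ball m r) (Ball n q) = Ball (m + n) (r + q)" | "plus_ball _ _ = Any"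
fun minus_ball :: "ball \<Rightarrow> ball \<Rightarrow> ball" where
  "minus_ball (Ball m r) (Ball n q) = Ball (m - n) (r + q)" | "minus_ball _ _ = Any"
fun uminus_ball :: "ball \<Rightarrow> ball" where
  "uminus_ball (Ball m r) = Ball (- m) r" | "uminus_ball Any = Any"
text \<open>Jets contain many exact zeros (derivatives of constants); the separate case keeps
  rounding errors out of them. The added 2 pays for rounding down both the centre and the
  radius.\<close>

fun times_ball :: "ball \<Rightarrow> ball \<Rightarrow> ball" where
  "times_ball (Ball m r) (Ball n q) =
     (if m = 0 \<and> r = 0 \<or> n = 0 \<and> q = 0 then Ball 0 0
      else Ball (drop_bit 32 (m * n)) (drop_bit 32 (\<bar>m\<bar> * q + \<bar>n\<bar> * r + r * q) + 2))"
| "times_ball _ _ = Any"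
definition lit_ball :: "int \<Rightarrow> ball" where "lit_ball k = Ball (push_bit 32 k) 0"
text \<open>At scale 2 ^ 32 the reciprocal of m is 2 ^ 64 / m. The radius bounds the residual of z
  at any point of the ball, divided by the least modulus |m| - r; the 1 covers rounding of that
  division. A ball that may contain 0 yields \<open>Any\<close>.\<close>

fun recip_ball :: "ball \<Rightarrow> ball" where
  "recip_ball (Ball m r) = (if 0 \<le> r \<and> r < \<bar>m\<bar> then let z = 2 ^ 64 div m in
     Ball z ((\<bar>2 ^ 64 - z * m\<bar> + \<bar>z\<bar> * r) div (\<bar>m\<bar> - r) + 1) else Any)"
| "recip_ball Any = Any"
instance ..
end

fun encl :: "ball \<Rightarrow> real \<Rightarrow> bool" where
  "encl (Ball m r) x = (\<bar>x * 2 ^ 32 - m\<bar> \<le> r)" | "encl Any x = True"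

text \<open>The program below computes, from b and the unstable eigenvalue l, the fixed point (\<open>mid\<close>), the parameter a
  (\<open>par_of\<close>), the power series of the invariant curves up to degree 4 (the remainder R is an input), and then
  moves the unstable curve four steps forward and the stable curve one step backward to the tangency.
  Intermediate results are passed as arguments so that evaluation shares them.\<close>

definition mid :: "'a::field_ops \<Rightarrow> 'a \<Rightarrow> 'a" where
  "mid b l = (b * recip l - l) * recip (lit 2)"

definition par_of :: "'a::field_ops \<Rightarrow> 'a \<Rightarrow> 'a" where
  "par_of b x = x * x + (lit 1 - b) * x"

definition inv_denoms :: "'a::field_ops \<Rightarrow> 'a \<Rightarrow> 'a \<Rightarrow> 'a \<times> 'a \<times> 'a" where
  "inv_denoms b l p = (recip (l * l - l + b * p - b * (p * p)),
     recip (l * (l * l) - l + b * p - b * (p * (p * p))),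
     recip (l * (l * (l * l)) - l + b * p - b * (p * (p * (p * p)))))"

text \<open>The recursion unrolled with c 1 = 1, where e2, e3, e4 are the inverted divisors: c 2 = -
  e2, c 3 = - 2 c 2 e3, and c 4 = - e4 times (2 c 3 plus the square of c 2).\<close>

definition coeffs_of_inv :: "'a::field_ops \<times> 'a \<times> 'a \<Rightarrow> 'a \<times> 'a \<times> 'a" where
  "coeffs_of_inv e = (case e of (e2, e3, e4) \<Rightarrow>
     (- e2, (e2 + e2) * e3, - (((e2 + e2) * e3 + (e2 + e2) * e3 + e2 * e2) * e4)))"

definition low_coeffs :: "'a::field_ops \<Rightarrow> 'a \<Rightarrow> 'a \<times> 'a \<times> 'a" where
  "low_coeffs b l = coeffs_of_inv (inv_denoms b l (recip l))"

definition curve_val :: "'a::field_ops \<Rightarrow> 'a \<times> 'a \<times> 'a \<Rightarrow> 'a \<Rightarrow> 'a \<Rightarrow> 'a" where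
  "curve_val x c s R = (case c of (c2, c3, c4) \<Rightarrow> x + s * (lit 1 + s * (c2 + s * (c3 + s * c4))) + R)"

definition hstep :: "'a::field_ops \<Rightarrow> 'a \<Rightarrow> 'a \<times> 'a \<Rightarrow> 'a \<times> 'a" where
  "hstep a b z = (case z of (x, y) \<Rightarrow> (a - x * x + b * y, x))"

definition hback :: "'a::field_ops \<Rightarrow> 'a \<Rightarrow> 'a \<times> 'a \<Rightarrow> 'a \<times> 'a" where
  "hback a b z = (case z of (x, y) \<Rightarrow> (y, (x - a + y * y) * recip b))"

definition unstable_from where
  "unstable_from b l x a c u R0 R1 =
     hstep a b (hstep a b (hstep a b (hstep a b (curve_val x c (l * u) R1, curve_val x c u R0))))"

definition stable_from where
  "stable_from b m x a c s R1 R2 = hback a b (curve_val x c (m * s) R2, curve_val x c s R1)"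

definition unstable_xy :: "'a::field_ops \<Rightarrow> 'a \<Rightarrow> 'a \<Rightarrow> 'a \<Rightarrow> 'a \<Rightarrow> 'a \<times> 'a" where
  "unstable_xy b l u R0 R1 = unstable_from b l (mid b l) (par_of b (mid b l)) (low_coeffs b l) u R0 R1"

definition stable_xy :: "'a::field_ops \<Rightarrow> 'a \<Rightarrow> 'a \<Rightarrow> 'a \<Rightarrow> 'a \<Rightarrow> 'a \<times> 'a" where
  "stable_xy b l s R1 R2 = stable_from b (- (b * recip l)) (mid b l) (par_of b (mid b l))
     (low_coeffs b (- (b * recip l))) s R1 R2"

text \<open>The centres approximate the parameters of the tangency for b = -0.3, found by Newton iteration; the balls in
  the last two definitions enclose the jets of the series remainders.\<close>

definition "ball_b = (Jet (Ball (- 1288490189) 10) (lit 0) (lit 0) (lit 0) :: ball jet)"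
definition "ball_l r = (Jet (Ball 16570711405 r) (lit 0) (lit 0) (lit 1) :: ball jet)"
definition "ball_u r = (Jet (Ball 183617686 r) (lit 1) (lit 0) (lit 0) :: ball jet)"
definition "ball_s r = (Jet (Ball 1351350306 r) (lit 1) (lit 0) (lit 0) :: ball jet)"

definition "unstable_ball rl ru = unstable_xy ball_b (ball_l rl) (ball_u ru)
   (Jet (Ball 0 5) (Ball 0 500) (Ball 0 30000) (Ball 0 20))
   (Jet (Ball 0 2000) (Ball 0 200000) (Ball 0 20000000) (Ball 0 10000))"

definition "stable_ball rl rs = stable_xy ball_b (ball_l rl) (ball_s rs)
   (Jet (Ball 0 200) (Ball 0 3000) (Ball 0 40000) (Ball 0 600))
   (Jet (Ball 0 5) (Ball 0 5) (Ball 0 5) (Ball 0 5))"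

section \<open>Soundness of the ball operations and of programs built from them\<close>

lemma div_near: "n / d - 1 \<le> real_of_int (n div d)" "real_of_int (n div d) \<le> n / d"
  using real_of_int_div2[of n d] real_of_int_div3[of n d] by linarith+

lemma drop_bit_near: "n / 2 ^ 32 - 1 \<le> real_of_int (drop_bit 32 n)" "real_of_int (drop_bit 32 n) \<le> n / 2 ^ 32"
  using div_near[of n "2 ^ 32"] by (simp_all add: drop_bit_eq_div)

lemma encl_plus: "encl B x \<Longrightarrow> encl C y \<Longrightarrow> encl (B + C) (x + y)"
  by (cases B; cases C) (auto simp: algebra_simps)

lemma encl_minus: "encl B x \<Longrightarrow> encl C y \<Longrightarrow> encl (B - C) (x - y)"
  by (cases B; cases C) (auto simp: algebra_simps)

lemma encl_uminus: "encl B x \<Longrightarrow> encl (- B) (- x)"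
  by (cases B) auto

lemma encl_lit: "encl (lit k) (lit k)"
  by (simp add: lit_ball_def lit_real_def push_bit_eq_mult)

lemma encl_times:
  assumes "encl B x" "encl C y"
  shows "encl (B * C) (x * y)"
proof (cases B; cases C)
  fix m r n q assume B: "B = Ball m r" and C: "C = Ball n q"
  define X Y where "X = x * 2 ^ 32" and "Y = y * 2 ^ 32"
  have X: "\<bar>X - m\<bar> \<le> r" and Y: "\<bar>Y - n\<bar> \<le> q" using assms by (auto simp: B C X_def Y_def)
  show ?thesis
  proof (cases "m = 0 \<and> r = 0 \<or> n = 0 \<and> q = 0")
    case True
    then have "X = 0 \<or> Y = 0" using X Y by auto
    with True show ?thesis by (auto simp: B C X_def Y_def)
  next
    case False
    let ?t = "\<bar>m\<bar> * q + \<bar>n\<bar> * r + r * q"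
    have "\<bar>X * Y - m * n\<bar> = \<bar>m * (Y - n) + n * (X - m) + (X - m) * (Y - n)\<bar>" by (simp add: algebra_simps)
    also have "\<dots> \<le> \<bar>m * (Y - n)\<bar> + \<bar>n * (X - m)\<bar> + \<bar>(X - m) * (Y - n)\<bar>" by linarith
    also have "\<dots> \<le> \<bar>real_of_int m\<bar> * q + \<bar>real_of_int n\<bar> * r + real_of_int r * q"
      unfolding abs_mult using X Y by (intro add_mono mult_mono) auto
    finally have "\<bar>X * Y - m * n\<bar> \<le> real_of_int ?t" by simp
    then have "\<bar>(X * Y - m * n) / 2 ^ 32\<bar> \<le> real_of_int ?t / 2 ^ 32"
      by (simp only: abs_divide) (simp add: divide_right_mono)
    then have "\<bar>X * Y / 2 ^ 32 - real_of_int (m * n) / 2 ^ 32\<bar> \<le> real_of_int ?t / 2 ^ 32"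
      by (simp add: diff_divide_distrib)
    moreover have "x * y * 2 ^ 32 = X * Y / 2 ^ 32" by (simp add: X_def Y_def)
    ultimately have "\<bar>x * y * 2 ^ 32 - real_of_int (drop_bit 32 (m * n))\<bar> \<le> real_of_int (drop_bit 32 ?t) + 2"
      using drop_bit_near[of "m * n"] drop_bit_near[of ?t] by linarith
    then show ?thesis unfolding B C times_ball.simps if_not_P[OF False] by simp
  qed
qed (use assms in auto)

lemma encl_recip:
  assumes "encl B x"
  shows "encl (recip B) (recip x)"
proof (cases B)
  case (Ball m r)
  show ?thesis
  proof (cases "0 \<le> r \<and> r < \<bar>m\<bar>")
    case True
    define X where "X = x * 2 ^ 32"
    define z :: int where "z = 2 ^ 64 div m"
    define t where "t = \<bar>2 ^ 64 - z * m\<bar> + \<bar>z\<bar> * r"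
    have X: "\<bar>X - m\<bar> \<le> r" using assms by (simp add: Ball X_def)
    have "\<bar>real_of_int m\<bar> - r \<le> \<bar>X\<bar>" using X by linarith
    moreover have pos: "0 < real_of_int (\<bar>m\<bar> - r)" using True by linarith
    ultimately have X0: "X \<noteq> 0" and Xm: "real_of_int (\<bar>m\<bar> - r) \<le> \<bar>X\<bar>" by auto
    have "\<bar>2 ^ 64 - z * X\<bar> = \<bar>(2 ^ 64 - real_of_int z * m) - real_of_int z * (X - m)\<bar>" by (simp add: algebra_simps)
    also have "\<dots> \<le> \<bar>2 ^ 64 - real_of_int z * m\<bar> + \<bar>real_of_int z * (X - m)\<bar>" by linarith
    also have "\<dots> \<le> \<bar>2 ^ 64 - real_of_int z * m\<bar> + \<bar>real_of_int z\<bar> * r"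
      unfolding abs_mult using X by (intro add_left_mono mult_left_mono) auto
    also have "\<dots> = real_of_int t" by (simp add: t_def)
    finally have "\<bar>2 ^ 64 - z * X\<bar> \<le> real_of_int t" .
    then have "\<bar>2 ^ 64 - z * X\<bar> / \<bar>X\<bar> \<le> real_of_int t / real_of_int (\<bar>m\<bar> - r)"
      using Xm pos by (intro frac_le) auto
    moreover have "recip x * 2 ^ 32 - z = (2 ^ 64 - z * X) / X"
      using X0 by (simp add: X_def recip_real_def field_simps)
    ultimately have "\<bar>recip x * 2 ^ 32 - z\<bar> \<le> real_of_int (t div (\<bar>m\<bar> - r)) + 1"
      using div_near[of t "\<bar>m\<bar> - r"] by (simp add: abs_divide)
    then show ?thesis unfolding Ball recip_ball.simps if_P[OF True] Let_def z_def t_def encl.simps by simp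
  next
    case False
    show ?thesis unfolding Ball recip_ball.simps if_not_P[OF False] by simp
  qed
qed simp

definition encl_jet :: "ball jet \<Rightarrow> real jet \<Rightarrow> bool" where
  "encl_jet B J \<longleftrightarrow> encl (jv B) (jv J) \<and> encl (ju B) (ju J) \<and> encl (juu B) (juu J) \<and> encl (jl B) (jl J)"

lemmas encl_intros = encl_plus encl_minus encl_uminus encl_lit encl_times encl_recip

lemma encl_jet_Jet: "encl a x \<Longrightarrow> encl b y \<Longrightarrow> encl c z \<Longrightarrow> encl d w \<Longrightarrow> encl_jet (Jet a b c d) (Jet x y z w)"
  by (simp add: encl_jet_def)

lemma encl_jet_plus: "encl_jet B x \<Longrightarrow> encl_jet C y \<Longrightarrow> encl_jet (B + C) (x + y)"
  by (simp add: encl_jet_def jet_ops encl_intros)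

lemma encl_jet_minus: "encl_jet B x \<Longrightarrow> encl_jet C y \<Longrightarrow> encl_jet (B - C) (x - y)"
  by (simp add: encl_jet_def jet_ops encl_intros)

lemma encl_jet_uminus: "encl_jet B x \<Longrightarrow> encl_jet (- B) (- x)"
  by (simp add: encl_jet_def jet_ops encl_intros)

lemma encl_jet_lit: "encl_jet (lit k) (lit k)"
  by (simp add: encl_jet_def jet_ops encl_intros)

lemma encl_jet_times: "encl_jet B x \<Longrightarrow> encl_jet C y \<Longrightarrow> encl_jet (B * C) (x * y)"
  unfolding encl_jet_def jet_ops Let_def jet.sel by (elim conjE, intro conjI encl_intros; assumption)

lemma encl_jet_recip: "encl_jet B x \<Longrightarrow> encl_jet (recip B) (recip x)"
  unfolding encl_jet_def jet_ops Let_def jet.sel by (elim conjE, intro conjI encl_intros; assumption)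

lemmas encl_jet_intros = encl_jet_plus encl_jet_minus encl_jet_uminus encl_jet_lit encl_jet_times encl_jet_recip

definition encl_pair :: "ball jet \<times> ball jet \<Rightarrow> real jet \<times> real jet \<Rightarrow> bool" where
  "encl_pair B J \<longleftrightarrow> encl_jet (fst B) (fst J) \<and> encl_jet (snd B) (snd J)"

lemma encl_mid: "encl_jet b b' \<Longrightarrow> encl_jet l l' \<Longrightarrow> encl_jet (mid b l) (mid b' l')"
  unfolding mid_def by (intro encl_jet_intros)

lemma encl_par_of: "encl_jet b b' \<Longrightarrow> encl_jet x x' \<Longrightarrow> encl_jet (par_of b x) (par_of b' x')"
  unfolding par_of_def by (intro encl_jet_intros)

lemma encl_curve_val:
  assumes "encl_jet b b'" "encl_jet l l'" "encl_jet x x'" "encl_jet s s'" "encl_jet R R'"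
  shows "encl_jet (curve_val x (low_coeffs b l) s R) (curve_val x' (low_coeffs b' l') s' R')"
  unfolding curve_val_def low_coeffs_def coeffs_of_inv_def inv_denoms_def prod.case
  by (intro encl_jet_intros assms)

lemma encl_hstep:
  assumes "encl_jet a a'" "encl_jet b b'" "encl_pair z z'"
  shows "encl_pair (hstep a b z) (hstep a' b' z')"
  using assms unfolding encl_pair_def hstep_def case_prod_unfold by (auto intro!: encl_jet_intros)

lemma encl_hback:
  assumes "encl_jet a a'" "encl_jet b b'" "encl_pair z z'"
  shows "encl_pair (hback a b z) (hback a' b' z')"
  using assms unfolding encl_pair_def hback_def case_prod_unfold by (auto intro!: encl_jet_intros)

lemma encl_unstable_xy:
  assumes "encl_jet b b'" "encl_jet l l'" "encl_jet u u'" "encl_jet R0 R0'" "encl_jet R1 R1'"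
  shows "encl_pair (unstable_xy b l u R0 R1) (unstable_xy b' l' u' R0' R1')"
proof -
  note i = encl_mid[OF assms(1,2)] encl_par_of[OF assms(1) encl_mid[OF assms(1,2)]]
  show ?thesis
    unfolding unstable_xy_def unstable_from_def
    by (intro encl_hstep i assms(1)) (auto simp: encl_pair_def intro!: encl_curve_val i assms encl_jet_times)
qed

lemma encl_stable_xy:
  assumes "encl_jet b b'" "encl_jet l l'" "encl_jet s s'" "encl_jet R1 R1'" "encl_jet R2 R2'"
  shows "encl_pair (stable_xy b l s R1 R2) (stable_xy b' l' s' R1' R2')"
proof -
  note i = encl_mid[OF assms(1,2)] encl_par_of[OF assms(1) encl_mid[OF assms(1,2)]]
  show ?thesis
    unfolding stable_xy_def stable_from_def
    by (intro encl_hback i assms(1)) (auto simp: encl_pair_def intro!: encl_curve_val i assms encl_jet_intros)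
qed

lemma encl_gaps:
  assumes "encl_jet X1 X1'" "encl_jet Y1 Y1'" "encl_jet X2 X2'" "encl_jet Y2 Y2'"
  shows "encl (gap_l X1 Y1 X2 Y2) (gap_l X1' Y1' X2' Y2')"
    "encl (gap_u X1 Y1 X2 Y2) (gap_u X1' Y1' X2' Y2')"
    "encl (gap_uu X1 Y1 X2 Y2) (gap_uu X1' Y1' X2' Y2')"
  using assms unfolding gap_l_def gap_u_def gap_uu_def slope_def encl_jet_def
  by (auto intro!: encl_intros)

section \<open>Jets of the invariant curves\<close>

lemma unstable_curve_series:
  assumes b: "- 0.3001 < b" "b < - 0.2999"
  shows "curve_series b {3.85<..<3.87} (19 / 100) (1 / 2) (6 / 5)"
proof
  fix l :: real and k :: nat assume l: "l \<in> {3.85<..<3.87}" and k: "2 \<le> k"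
  have grow: "3.96 + 10.6 * (real k - 1) \<le> 3.85 ^ k"
    using k
  proof (induction k rule: dec_induct)
    case (step n)
    obtain x where x: "real n = x + 2" "0 \<le> x" using step by (metis add.commute diff_add_cancel diff_ge_0_iff_ge of_nat_le_iff of_nat_numeral)
    have "3.96 + 10.6 * (real (Suc n) - 1) \<le> 3.85 * (3.96 + 10.6 * (real n - 1))" using x(2) unfolding of_nat_Suc x(1) by (simp add: field_simps)
    also have "\<dots> \<le> 3.85 * 3.85 ^ n" using step by (intro mult_left_mono) auto
    finally show ?case by simp
  qed (simp add: power2_eq_square)
  have pw: "3.85 ^ k \<le> l ^ k" using l by (intro power_mono) auto
  have "(3.85 :: real) ^ 2 \<le> 3.85 ^ k" using k by (intro power_increasing) auto
  then have big: "14.5 \<le> l ^ k" using pw by (simp add: power2_eq_square)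
  have lk: "l ^ k > 0" using l by simp
  have q: "- (0.3001 / 3.85) \<le> b / l" "b / l ^ k \<le> 0"
  proof -
    have "- b / l \<le> 0.3001 / 3.85" using b l by (intro frac_le) auto
    then show "- (0.3001 / 3.85) \<le> b / l" by simp
    show "b / l ^ k \<le> 0" using b lk by (simp add: divide_nonpos_pos)
  qed
  have den: "l ^ k - 3.96 \<le> denom b l k"
    unfolding denom_def using q l by simp
  define y where "y = real k - 1"
  have y: "0 \<le> y" using k by (simp add: y_def)
  have "3.96 + 10.6 * y \<le> l ^ k" using grow pw unfolding y_def[symmetric] by linarith
  then have "10.6 * y \<le> denom b l k" using den by simp
  then have "2 * y \<le> 19 / 100 * \<bar>denom b l k\<bar>" using y by simp
  then show "2 * (real k - 1) \<le> 19 / 100 * \<bar>denom b l k\<bar>" by (simp add: y_def)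
  obtain n where n: "k = Suc n" "n \<ge> 1" using k by (cases k) auto
  have ln: "3.85 \<le> l ^ n" using l n(2) power_increasing[of 1 n l] by simp
  have "- b / l ^ (k + 1) \<le> 0.3001 / 1"
    using b l one_le_power[of l "k + 1"] by (intro frac_le) auto
  then have b1: "- 0.3001 \<le> b / l ^ (k + 1)" "b / l ^ (k + 1) \<le> 0"
    using b l by (auto simp: divide_nonpos_pos)
  have "- b / l\<^sup>2 \<le> 0.3001 / 1"
    using b l one_le_power[of l 2] by (intro frac_le) auto
  then have b2: "- 0.3001 \<le> b / l\<^sup>2" "b / l\<^sup>2 \<le> 0"
    using b l by (auto simp: divide_nonpos_pos)
  have up: "denom' b l k \<le> k * l ^ n"
    using b1 b2 mult_nonneg_nonpos[of "real k" "b / l ^ (k + 1)"] unfolding denom'_def n(1) by simp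
  have d'_eq: "denom' b l k = real k * l ^ n - 1 - b / l\<^sup>2 + real k * (b / l ^ (k + 1))"
    by (simp add: denom'_def n(1))
  have "real k * (77 / 20) \<le> real k * l ^ n" using ln by (intro mult_left_mono) auto
  moreover have "real k * - (3001 / 10000) \<le> real k * (b / l ^ (k + 1))" using b1 by (intro mult_left_mono) auto
  moreover have "real k \<ge> 2" using k by simp
  ultimately have lo: "0 \<le> denom' b l k"
    using b2(2) unfolding d'_eq by linarith
  have "3.85 * l ^ n \<le> l ^ k" using l by (simp add: n(1))
  then have "l ^ n \<le> 1 / 2 * denom b l k" using den big by simp
  then have "k * l ^ n \<le> k * (1 / 2 * denom b l k)" by (intro mult_left_mono) auto
  then show "\<bar>denom' b l k\<bar> \<le> 1 / 2 * real k * \<bar>denom b l k\<bar>"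
    using up lo den big by simp
qed auto

text \<open>Here - b / l ^ k dominates, so everything is written in w = 1 / l, at least 12.8. The
  remaining terms of the divisor cost at most 3.95, and 40 * (1 / 20) = 2 fixes \<rho>.
  Differentiating the dominant term produces a factor k * w, at most 12.88 k; \<kappa> = 15 absorbs
  the 3.95 as well.\<close>

lemma stable_curve_series:
  assumes b: "- 0.3001 < b" "b < - 0.2999"
  shows "curve_series b {0.0777<..<0.0779} (1 / 20) 15 4"
proof
  fix l :: real and k :: nat assume l: "l \<in> {0.0777<..<0.0779}" and k: "2 \<le> k"
  define w where "w = 1 / l"
  have lw: "l = 1 / w" by (simp add: w_def)
  have w: "12.8 \<le> w" "w \<le> 12.88" using l by (auto simp: w_def field_simps)
  have grow: "3.95 + 40 * (real k - 1) \<le> 0.2999 * 12.8 ^ k"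
    using k
  proof (induction k rule: dec_induct)
    case (step n)
    obtain x where x: "real n = x + 2" "0 \<le> x" using step by (metis add.commute diff_add_cancel diff_ge_0_iff_ge of_nat_le_iff of_nat_numeral)
    have "3.95 + 40 * (real (Suc n) - 1) \<le> 12.8 * (3.95 + 40 * (real n - 1))" using x(2) unfolding of_nat_Suc x(1) by (simp add: field_simps)
    also have "\<dots> \<le> 12.8 * (0.2999 * 12.8 ^ n)" using step by (intro mult_left_mono) auto
    finally show ?case by simp
  qed (simp add: power2_eq_square)
  have "12.8 ^ k \<le> w ^ k" using w by (intro power_mono) auto
  then have pw: "0.2999 * 12.8 ^ k \<le> - b * w ^ k" using b w by (intro mult_mono) auto
  have bw: "- b * w \<le> 0.3001 * 12.88" using b w by (intro mult_mono) auto
  have lk: "0 \<le> l ^ k" using l by simp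
  have den_eq: "denom b l k = l ^ k - l + b * w - b * w ^ k"
    by (simp add: denom_def w_def power_divide)
  have "- (79 / 20) \<le> b * w - l" using l bw by simp
  then have den: "- b * w ^ k - 79 / 20 \<le> denom b l k"
    unfolding den_eq using lk by linarith
  then show "2 * (real k - 1) \<le> 1 / 20 * \<bar>denom b l k\<bar>"
    using grow pw k by (simp add: abs_if)
  have big: "43.9 \<le> - b * w ^ k" using grow pw k by simp
  have den'_eq: "denom' b l k = k * l ^ (k - 1) - 1 - b * w\<^sup>2 + k * (b * w ^ (k + 1))"
    by (simp add: denom'_def w_def power_divide)
  have l1: "l ^ (k - 1) \<le> 1" using l by (intro power_le_one) auto
  have l2: "0 \<le> real k * l ^ (k - 1)" using l by simp
  have kl: "real k * l ^ (k - 1) \<le> real k * 1" using l1 by (intro mult_left_mono) auto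
  have "12.8\<^sup>2 \<le> w\<^sup>2" using w by (intro power_mono) auto
  then have "0.2999 * 12.8\<^sup>2 \<le> - b * w\<^sup>2" using b by (intro mult_mono) auto
  then have b2: "1 \<le> - b * w\<^sup>2" by (simp add: power2_eq_square)
  have "w\<^sup>2 \<le> 12.88\<^sup>2" using w by (intro power_mono) auto
  then have "- b * w\<^sup>2 \<le> 0.3001 * 12.88\<^sup>2" using b by (intro mult_mono) auto
  then have b3: "- b * w\<^sup>2 \<le> 50" by (simp add: power2_eq_square)
  have wk: "12.8 * (- b * w ^ k) \<le> - b * w ^ (k + 1)" "- b * w ^ (k + 1) \<le> 12.88 * (- b * w ^ k)"
    using mult_right_mono[of "12.8" w "- b * w ^ k"] mult_right_mono[of w "12.88" "- b * w ^ k"] w big by (simp_all add: mult_ac)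
  have "real k * 500 \<le> real k * (- b * w ^ (k + 1))" using wk big by (intro mult_left_mono) auto
  moreover have "real k * (- b * w ^ (k + 1)) = - (real k * (b * w ^ (k + 1)))" by simp
  moreover have "real k \<ge> 2" using k by simp
  ultimately have le0: "denom' b l k \<le> 0"
    using kl b3 unfolding den'_eq by linarith
  have "- denom' b l k \<le> real k * (- b * w ^ (k + 1))"
    using b2 l2 unfolding den'_eq by simp
  also have "\<dots> \<le> real k * (15 * denom b l k)"
    using wk big den by (intro mult_left_mono) auto
  finally show "\<bar>denom' b l k\<bar> \<le> 15 * real k * \<bar>denom b l k\<bar>"
    using le0 den big by simp
qed auto

section \<open>Correctness and derivatives of the polymorphic program\<close>

lemma curve_val_low_coeffs:
  "curve_val x (low_coeffs b l) s R = x + s * (1 + s * (curve_coeff b l 2 + s * (curve_coeff b l 3 + s * curve_coeff b l 4))) + R"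
proof -
  have e: "recip (denom b l k) = 1 / denom b l k" for k by (simp add: recip_real_def inverse_eq_divide)
  have d: "inv_denoms b l (recip l) = (1 / denom b l 2, 1 / denom b l 3, 1 / denom b l 4)"
    unfolding e[symmetric] inv_denoms_def
    by (simp add: denom_def recip_real_def divide_inverse power_inverse eval_nat_numeral mult_ac)
  have s: "{1..<2 :: nat} = {1}" "{1..<3 :: nat} = {1, 2}" "{1..<4 :: nat} = {1, 2, 3}" by auto
  have c1: "curve_coeff b l 1 = 1" by (simp add: coeff_1)
  have c2: "curve_coeff b l 2 = - (1 / denom b l 2)" using coeff_rec[of 2 b l] by (simp only: s) (simp add: coeff_1)
  have c3: "curve_coeff b l 3 = (1 / denom b l 2 + 1 / denom b l 2) * (1 / denom b l 3)"
    using coeff_rec[of 3 b l] by (simp only: s) (simp add: coeff_1 c2)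
  have c4: "curve_coeff b l 4 = - ((2 * curve_coeff b l 3 + (curve_coeff b l 2)\<^sup>2) / denom b l 4)"
    using coeff_rec[of 4 b l] by (simp only: s) (simp add: coeff_1 power2_eq_square diff_divide_distrib add_divide_distrib)
  have "low_coeffs b l = (curve_coeff b l 2, curve_coeff b l 3, curve_coeff b l 4)"
    unfolding low_coeffs_def d coeffs_of_inv_def prod.case c4 unfolding c2 c3
    by (simp add: power2_eq_square)
  then show ?thesis by (simp add: curve_val_def lit_real_def)
qed

definition jet_on_pair where
  "jet_on_pair L U F J \<longleftrightarrow> jet_on L U (\<lambda>l u. fst (F l u)) (\<lambda>l u. fst (J l u)) \<and> jet_on L U (\<lambda>l u. snd (F l u)) (\<lambda>l u. snd (J l u))"

lemmas jet_on_intros = jet_on_add jet_on_diff jet_on_uminus jet_on_mult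

lemma jet_on_const: "open U \<Longrightarrow> jet_on L U (\<lambda>_ _. c) (\<lambda>_ _. Jet c 0 0 0)"
  by (rule jet_onI) auto

lemma jet_on_mid:
  assumes "jet_on L U b b'" "jet_on L U l l'" "\<And>x u. x \<in> L \<Longrightarrow> u \<in> U \<Longrightarrow> l x u \<noteq> 0"
  shows "jet_on L U (\<lambda>x u. mid (b x u) (l x u)) (\<lambda>x u. mid (b' x u) (l' x u))"
  unfolding mid_def
  by (intro jet_on_intros jet_on_recip assms jet_on_lit jet_on_open[OF assms(1)]) (simp_all add: lit_real_def)

lemma jet_on_par_of:
  assumes "jet_on L U b b'" "jet_on L U x x'"
  shows "jet_on L U (\<lambda>l u. par_of (b l u) (x l u)) (\<lambda>l u. par_of (b' l u) (x' l u))"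
  unfolding par_of_def by (intro jet_on_intros assms jet_on_lit jet_on_open[OF assms(1)])

lemma jet_on_curve_val:
  assumes "jet_on L U b b'" "jet_on L U l l'" "jet_on L U x x'" "jet_on L U s s'" "jet_on L U R R'"
    and "\<And>x u. x \<in> L \<Longrightarrow> u \<in> U \<Longrightarrow> l x u \<noteq> 0"
    and nz: "\<And>x u k. x \<in> L \<Longrightarrow> u \<in> U \<Longrightarrow> k \<ge> 2 \<Longrightarrow> denom (b x u) (l x u) k \<noteq> 0"
  shows "jet_on L U (\<lambda>y u. curve_val (x y u) (low_coeffs (b y u) (l y u)) (s y u) (R y u))
    (\<lambda>y u. curve_val (x' y u) (low_coeffs (b' y u) (l' y u)) (s' y u) (R' y u))"
  unfolding curve_val_def low_coeffs_def coeffs_of_inv_def inv_denoms_def prod.case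
  by (intro jet_on_intros jet_on_recip assms jet_on_lit jet_on_open[OF assms(1)])
    (use nz[of _ _ 2] nz[of _ _ 3] nz[of _ _ 4] in
      \<open>simp_all add: denom_def recip_real_def divide_inverse power_inverse eval_nat_numeral mult_ac\<close>)

lemma jet_on_hstep:
  assumes "jet_on L U a a'" "jet_on L U b b'" "jet_on_pair L U z z'"
  shows "jet_on_pair L U (\<lambda>l u. hstep (a l u) (b l u) (z l u)) (\<lambda>l u. hstep (a' l u) (b' l u) (z' l u))"
  using assms unfolding jet_on_pair_def hstep_def case_prod_unfold by (auto intro!: jet_on_intros)

lemma jet_on_hback:
  assumes "jet_on L U a a'" "jet_on L U b b'" "jet_on_pair L U z z'" "\<And>l u. l \<in> L \<Longrightarrow> u \<in> U \<Longrightarrow> b l u \<noteq> 0"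
  shows "jet_on_pair L U (\<lambda>l u. hback (a l u) (b l u) (z l u)) (\<lambda>l u. hback (a' l u) (b' l u) (z' l u))"
  using assms unfolding jet_on_pair_def hback_def case_prod_unfold by (auto intro!: jet_on_intros jet_on_recip)

text \<open>The same program runs on reals and on jets, so its run on the jets of the inputs gives
  the derivatives of its real result; the series remainders are inputs with jets of their
  own.\<close>

lemma jet_on_unstable_xy:
  assumes "open U" "jet_on L U R0 J0" "jet_on L U R1 J1"
    and nz: "\<And>l. l \<in> L \<Longrightarrow> l \<noteq> 0" "\<And>l k. l \<in> L \<Longrightarrow> k \<ge> 2 \<Longrightarrow> denom b l k \<noteq> 0"
  shows "jet_on_pair L U (\<lambda>l u. unstable_xy b l u (R0 l u) (R1 l u))
    (\<lambda>l u. unstable_xy (Jet b 0 0 0) (Jet l 0 0 1) (Jet u 1 0 0) (J0 l u) (J1 l u))"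
proof -
  note b = jet_on_const[OF assms(1), of L b]
  have l: "jet_on L U (\<lambda>l _. l) (\<lambda>l _. Jet l 0 0 1)" by (rule jet_on_fst[OF assms(1)]) simp
  note u = jet_on_snd[OF assms(1), of L]
  have x: "jet_on L U (\<lambda>l u. mid b l) (\<lambda>l u. mid (Jet b 0 0 0) (Jet l 0 0 1))"
    by (rule jet_on_mid[OF b l nz(1)])
  note a = jet_on_par_of[OF b x]
  note c = jet_on_curve_val[OF b l x _ _ nz(1) nz(2)]
  have "jet_on_pair L U
    (\<lambda>l w. (curve_val (mid b l) (low_coeffs b l) (l * w) (R1 l w), curve_val (mid b l) (low_coeffs b l) w (R0 l w)))
    (\<lambda>l w. (curve_val (mid (Jet b 0 0 0) (Jet l 0 0 1)) (low_coeffs (Jet b 0 0 0) (Jet l 0 0 1)) (Jet l 0 0 1 * Jet w 1 0 0) (J1 l w),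
      curve_val (mid (Jet b 0 0 0) (Jet l 0 0 1)) (low_coeffs (Jet b 0 0 0) (Jet l 0 0 1)) (Jet w 1 0 0) (J0 l w)))"
    unfolding jet_on_pair_def fst_conv snd_conv
    by (intro conjI c jet_on_mult[OF l u] u assms)
  from jet_on_hstep[OF a b jet_on_hstep[OF a b jet_on_hstep[OF a b jet_on_hstep[OF a b this]]]]
  show ?thesis unfolding unstable_xy_def unstable_from_def .
qed

lemma jet_on_stable_xy:
  assumes "open U" "jet_on L U R1 J1" "jet_on L U R2 J2"
    and nz: "\<And>l. l \<in> L \<Longrightarrow> l \<noteq> 0" "\<And>l k. l \<in> L \<Longrightarrow> k \<ge> 2 \<Longrightarrow> denom b (- (b * recip l)) k \<noteq> 0" "b \<noteq> 0"
  shows "jet_on_pair L U (\<lambda>l s. stable_xy b l s (R1 l s) (R2 l s))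
    (\<lambda>l s. stable_xy (Jet b 0 0 0) (Jet l 0 0 1) (Jet s 1 0 0) (J1 l s) (J2 l s))"
proof -
  note b = jet_on_const[OF assms(1), of L b]
  have l: "jet_on L U (\<lambda>l _. l) (\<lambda>l _. Jet l 0 0 1)" by (rule jet_on_fst[OF assms(1)]) simp
  note s = jet_on_snd[OF assms(1), of L]
  have x: "jet_on L U (\<lambda>l s. mid b l) (\<lambda>l s. mid (Jet b 0 0 0) (Jet l 0 0 1))"
    by (rule jet_on_mid[OF b l nz(1)])
  note a = jet_on_par_of[OF b x]
  have m: "jet_on L U (\<lambda>l s. - (b * recip l)) (\<lambda>l s. - (Jet b 0 0 0 * recip (Jet l 0 0 1)))"
    by (intro jet_on_uminus jet_on_mult[OF b] jet_on_recip[OF l]) (rule nz(1))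
  have m0: "- (b * recip l) \<noteq> 0" if "l \<in> L" for l using nz(1)[OF that] nz(3) by (simp add: recip_real_def)
  note c = jet_on_curve_val[OF b m x _ _ m0 nz(2)]
  have "jet_on_pair L U
    (\<lambda>l w. (curve_val (mid b l) (low_coeffs b (- (b * recip l))) (- (b * recip l) * w) (R2 l w),
      curve_val (mid b l) (low_coeffs b (- (b * recip l))) w (R1 l w)))
    (\<lambda>l w. (curve_val (mid (Jet b 0 0 0) (Jet l 0 0 1)) (low_coeffs (Jet b 0 0 0) (- (Jet b 0 0 0 * recip (Jet l 0 0 1))))
        (- (Jet b 0 0 0 * recip (Jet l 0 0 1)) * Jet w 1 0 0) (J2 l w),
      curve_val (mid (Jet b 0 0 0) (Jet l 0 0 1)) (low_coeffs (Jet b 0 0 0) (- (Jet b 0 0 0 * recip (Jet l 0 0 1)))) (Jet w 1 0 0) (J1 l w)))"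
    unfolding jet_on_pair_def fst_conv snd_conv
    by (intro conjI c jet_on_mult[OF m s] s assms)
  from jet_on_hback[OF a b this nz(3)]
  show ?thesis unfolding stable_xy_def stable_from_def .
qed

section \<open>Enclosures near the tangency\<close>

text \<open>Stored as an equation so that later proofs rewrite with the result instead of evaluating
  again. On this box the value radius is about 3e-3, useless for the gap itself but harmless for its
  derivatives; the gap and its slope are therefore enclosed with the radius 0 inputs of the next
  lemma.\<close>

lemma unstable_ball_box: "unstable_ball 12000 430000 =
  (Jet (Ball (- 7110284392) 13745935) (Ball (- 1182885209) 4344876535)
     (Ball 36896152798941 185210879502) (Ball (- 15982000248) 128709686),
   Jet (Ball 7407161141 2456667) (Ball (- 12744475474) 1236601067)
     (Ball (- 10550196802999) 45574194878) (Ball 5888431221 34385852))"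
  by code_simp

lemma unstable_ball_centre: "unstable_ball 0 0 =
  (Jet (Ball (- 7110284392) 16203) (Ball (- 1182885209) 6707958)
     (Ball 36896152798941 1375444102) (Ball (- 15982000248) 226553),
   Jet (Ball 7407161141 2872) (Ball (- 12744475474) 1742162)
     (Ball (- 10550196802999) 366821118) (Ball 5888431221 53854))"
  by code_simp

lemma stable_ball_box: "stable_ball 12000 860000 =
  (Jet (Ball (- 7110284391) 866355) (Ball 4235900172 40754)
     (Ball (- 187452180) 40705) (Ball (- 2099176867) 7118),
   Jet (Ball 7407161139 9912920) (Ball 45637973199 6148098)
     (Ball (- 29916018221) 1237601) (Ball 2425210793 2981061))"
  by code_simp

text \<open>Middle line s = \<open>s\<^sub>0\<close> with l ranging over the box: the starting point
  from which \<open>boxes_bracket\<close> reaches both ends of the s-interval by the slope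
  bound.\<close>

lemma stable_ball_line: "stable_ball 12000 0 =
  (Jet (Ball (- 7110284391) 6346) (Ball 4235900172 3108)
     (Ball (- 187452180) 40351) (Ball (- 2099176867) 711),
   Jet (Ball 7407161139 197847) (Ball 45637973199 77252)
     (Ball (- 29916018221) 488361) (Ball 2425210793 50164))"
  by code_simp

lemma stable_ball_centre: "stable_ball 0 0 =
  (Jet (Ball (- 7110284391) 210) (Ball 4235900172 3012)
     (Ball (- 187452180) 40042) (Ball (- 2099176867) 613),
   Jet (Ball 7407161139 2637) (Ball 45637973199 35045)
     (Ball (- 29916018221) 481894) (Ball 2425210793 7657))"
  by code_simp

text \<open>The stable parameter matching the central unstable point is not exactly
  \<open>s\<^sub>0\<close>; \<open>centre_bounds\<close> locates it within 1000 units of 2 ^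
  -32.\<close>

lemma stable_ball_near_centre: "stable_ball 0 1000 =
  (Jet (Ball (- 7110284391) 1210) (Ball 4235900172 3056)
     (Ball (- 187452180) 40042) (Ball (- 2099176867) 621),
   Jet (Ball 7407161139 13933) (Ball 45637973199 42105)
     (Ball (- 29916018221) 482761) (Ball 2425210793 11074))"
  by code_simp

lemma gap_l_box: "gap_l (fst (unstable_ball 12000 430000)) (snd (unstable_ball 12000 430000))
    (fst (stable_ball 12000 860000)) (snd (stable_ball 12000 860000)) = Ball (- 14204263070) 132231929"
  unfolding unstable_ball_box stable_ball_box by code_simp

lemma gap_uu_box: "gap_uu (fst (unstable_ball 12000 430000)) (snd (unstable_ball 12000 430000))
    (fst (stable_ball 12000 860000)) (snd (stable_ball 12000 860000)) = Ball 37875170103042 189624033821"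
  unfolding unstable_ball_box stable_ball_box by code_simp

lemma gap_u_centre: "gap_u (fst (unstable_ball 0 0)) (snd (unstable_ball 0 0))
    (fst (stable_ball 0 1000)) (snd (stable_ball 0 1000)) = Ball (- 3458) 6871611"
  unfolding unstable_ball_centre stable_ball_near_centre by code_simp

lemma par_ball_box: "jv (par_of ball_b (mid ball_b (ball_l 12000))) = Ball 5645850945 32109"
  by code_simp

lemma encl_zero_ball: "\<bar>x :: real\<bar> \<le> c \<Longrightarrow> c * 2 ^ 32 \<le> r \<Longrightarrow> encl (Ball 0 r) x"
  by (simp add: abs_mult)

lemma encl_unit: "encl (lit 0) 0" "encl (lit 1) 1"
  using encl_lit[of 0] encl_lit[of 1] by (simp_all add: lit_real_def)

locale near_parameter =
  fixes b :: real
  assumes b_near: "\<bar>b + 3 / 10\<bar> < 1 / 10 ^ 9"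
begin

lemma b_bounds: "- 0.3001 < b" "b < - 0.2999" "b < 0" "b \<noteq> 0"
proof -
  have "- 3 / 10 - 1 / 10 ^ 9 < b" "b < - 3 / 10 + 1 / 10 ^ 9" using b_near by linarith+
  then show "- 0.3001 < b" "b < - 0.2999" "b < 0" "b \<noteq> 0" by simp_all
qed

lemma encl_ball_b: "encl_jet ball_b (Jet b 0 0 0)"
proof -
  have "- 3 / 10 - 1 / 10 ^ 9 < b" "b < - 3 / 10 + 1 / 10 ^ 9" using b_near by linarith+
  \<comment> \<open>10 ^ -9 is about 4.3 units of 2 ^ -32, and the centre is -0.3 rounded to a
    unit.\<close>
  then have "\<bar>b * 2 ^ 32 + 1288490189\<bar> \<le> 10" by (simp add: abs_le_iff)
  then show ?thesis unfolding ball_b_def by (intro encl_jet_Jet encl_unit) auto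
qed

sublocale U: curve_series b "{3.85<..<3.87}" "19 / 100" "1 / 2" "6 / 5"
  by (rule unstable_curve_series[OF b_bounds(1,2)])

sublocale S: curve_series b "{0.0777<..<0.0779}" "1 / 20" 15 4
  by (rule stable_curve_series[OF b_bounds(1,2)])

definition "unst l u = unstable_xy b l u (curve_tail b l u) (curve_tail b l (l * u))"
definition "stab l s = stable_xy b l s (curve_tail b (- b / l) s) (curve_tail b (- b / l) (- b / l * s))"

text \<open>Kept in the literal shape that \<open>jet_on_rescale\<close> produces, hence factors
  such as 1 and 0 here and in \<open>stab_jet\<close>, where b / l^2 is the derivative of the stable
  eigenvalue -b / l.\<close>

definition "unst_jet l u = unstable_xy (Jet b 0 0 0) (Jet l 0 0 1) (Jet u 1 0 0) (curve_tail_jet b l u)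
  (let j = curve_tail_jet b l (l * u) in Jet (jv j) (l * ju j) (l\<^sup>2 * juu j) (1 * jl j + 1 * u * ju j))"

definition "stab_jet l s = stable_xy (Jet b 0 0 0) (Jet l 0 0 1) (Jet s 1 0 0)
  (let j = curve_tail_jet b (- b / l) (1 * s) in Jet (jv j) (1 * ju j) (1\<^sup>2 * juu j) (b / l\<^sup>2 * jl j + 0 * s * ju j))
  (let j = curve_tail_jet b (- b / l) (- b / l * s) in Jet (jv j) (- b / l * ju j) ((- b / l)\<^sup>2 * juu j)
     (b / l\<^sup>2 * jl j + b / l\<^sup>2 * s * ju j))"

lemma stable_eigenvalue:
  assumes "l \<in> {3.857<..<3.859}"
  shows "- b / l \<in> {0.0777<..<0.0779}"
proof -
  have l: "3.857 < l" "l < 3.859" using assms by auto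
  have "0.0777 * l < - b" using b_bounds l by simp
  moreover have "- b < 0.0779 * l" using b_bounds l by simp
  ultimately have "0.0777 < - b / l" "- b / l < 0.0779"
    using l by (subst pos_less_divide_eq pos_divide_less_eq; simp)+
  then show ?thesis by simp
qed

lemma jet_on_unst: "jet_on_pair {3.85<..<3.87} {0<..<3/10} unst unst_jet"
proof -
  have "jet_on {3.85<..<3.87} {0<..<3/10} (curve_tail b) (curve_tail_jet b)"
    using U.jet_on_tail unfolding jet_on_def by auto
  moreover have "jet_on {3.85<..<3.87} {0<..<3/10} (\<lambda>l u. curve_tail b l (l * u))
    (\<lambda>l u. let j = curve_tail_jet b l (l * u) in Jet (jv j) (l * ju j) (l\<^sup>2 * juu j) (1 * jl j + 1 * u * ju j))"
  proof (rule jet_on_rescale[OF U.jet_on_tail])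
    fix l u :: real assume "l \<in> {3.85<..<3.87}" "u \<in> {0<..<3/10}"
    then have l: "0 \<le> l" "l \<le> 3.87" "0 < l" and u: "0 < u" "u \<le> 3/10" by auto
    have "l * u \<le> 3.87 * (3 / 10)" using l u by (intro mult_mono) auto
    moreover have "0 < l * u" using l u by simp
    ultimately show "l * u \<in> {- (6 / 5)<..<6 / 5}" by simp
  qed auto
  ultimately show ?thesis
    unfolding unst_def[abs_def] unst_jet_def[abs_def]
    by (intro jet_on_unstable_xy U.denom_nz) auto
qed

lemma jet_on_stab: "jet_on_pair {3.857<..<3.859} {0<..<1} stab stab_jet"
proof -
  have p: "((\<lambda>l. - b / l) has_real_derivative b / l\<^sup>2) (at l)" if "l \<in> {3.857<..<3.859}" for l
    using that by (auto intro!: derivative_eq_intros simp: power2_eq_square)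
  have R1: "jet_on {3.857<..<3.859} {0<..<1} (\<lambda>l s. curve_tail b (- b / l) (1 * s))
    (\<lambda>l s. let j = curve_tail_jet b (- b / l) (1 * s) in Jet (jv j) (1 * ju j) (1\<^sup>2 * juu j) (b / l\<^sup>2 * jl j + 0 * s * ju j))"
    by (rule jet_on_rescale[OF S.jet_on_tail _ p _ stable_eigenvalue, where n = "\<lambda>_. 1" and n' = "\<lambda>_. 0"]) auto
  have R2: "jet_on {3.857<..<3.859} {0<..<1} (\<lambda>l s. curve_tail b (- b / l) (- b / l * s))
    (\<lambda>l s. let j = curve_tail_jet b (- b / l) (- b / l * s) in Jet (jv j) (- b / l * ju j) ((- b / l)\<^sup>2 * juu j)
     (b / l\<^sup>2 * jl j + b / l\<^sup>2 * s * ju j))"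
  proof (rule jet_on_rescale[OF S.jet_on_tail _ p p stable_eigenvalue])
    fix l s :: real assume l: "l \<in> {3.857<..<3.859}" and s: "s \<in> {0<..<1}"
    have "0 < - b / l" "- b / l < 1" using stable_eigenvalue[OF l] by auto
    then have "- b / l * s \<le> 1 * 1" "0 < - b / l * s" using s by (intro mult_mono mult_pos_pos; simp)+
    then show "- b / l * s \<in> {- 4<..<4}" by simp
  qed auto
  have m: "- (b * recip l) = - b / l" for l by (simp add: recip_real_def divide_inverse)
  have "denom b (- (b * recip l)) k \<noteq> 0" if "l \<in> {3.857<..<3.859}" "k \<ge> 2" for l k
    unfolding m by (rule S.denom_nz[OF stable_eigenvalue[OF that(1)] that(2)])
  with jet_on_stable_xy[OF _ R1 R2 _ _ b_bounds(4)] show ?thesis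
    unfolding stab_def[abs_def] stab_jet_def[abs_def] by auto
qed

text \<open>The remainder balls in \<open>unstable_ball\<close> are the bounds of
  \<open>tail_bounds\<close> for |u| \<le> 0.05 and |l u| \<le> 0.17, with the chain rule factors of
  l * u, expressed in units of 2 ^ -32 and rounded up.\<close>

lemma encl_unst:
  assumes l: "\<bar>l * 2 ^ 32 - 16570711405\<bar> \<le> of_int rl" and rl: "rl \<le> 12000"
    and u: "\<bar>u * 2 ^ 32 - 183617686\<bar> \<le> of_int ru" and ru: "ru \<le> 430000"
  shows "encl_pair (unstable_ball rl ru) (unst_jet l u)"
proof -
  have rl': "real_of_int rl \<le> 12000" and ru': "real_of_int ru \<le> 430000" using rl ru by linarith+
  have lb: "3.858 \<le> l" "l \<le> 3.8582" using l rl' by (auto simp: abs_le_iff)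
  have ub: "0 \<le> u" "u \<le> 0.043" using u ru' by (auto simp: abs_le_iff)
  have lU: "l \<in> {3.85<..<3.87}" using lb by simp
  have lu: "\<bar>l * u\<bar> \<le> 17 / 100"
  proof -
    have "l * u \<le> 3.8582 * 0.043" using lb ub by (intro mult_mono) auto
    moreover have "0 \<le> l * u" using lb ub by simp
    ultimately show ?thesis by simp
  qed
  have u5: "\<bar>u\<bar> \<le> 5 / 100" using ub by simp
  have s5: "5 / 100 \<le> (6 / 5 :: real)" by simp
  note t0 = U.tail_bounds[OF lU u5 s5]
  have e0: "encl_jet (Jet (Ball 0 5) (Ball 0 500) (Ball 0 30000) (Ball 0 20)) (curve_tail_jet b l u)"
    unfolding encl_jet_def jet.sel
    by (intro conjI encl_zero_ball[OF t0(1)] encl_zero_ball[OF t0(2)] encl_zero_ball[OF t0(3)] encl_zero_ball[OF t0(4)]; simp add: eval_nat_numeral)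
  define j where "j = curve_tail_jet b l (l * u)"
  have j: "\<bar>jv j\<bar> \<le> 2 * (19 / 100) ^ 4 * (17 / 100) ^ 5" "\<bar>ju j\<bar> \<le> 10 * (19 / 100) ^ 4 * (17 / 100) ^ 4"
     "\<bar>juu j\<bar> \<le> 40 * (19 / 100) ^ 4 * (17 / 100) ^ 3" "\<bar>jl j\<bar> \<le> 16 * (1 / 2) * (19 / 100) ^ 4 * (17 / 100) ^ 5"
    unfolding j_def using U.tail_bounds[OF lU lu] by simp_all
  have l4: "\<bar>l\<bar> \<le> 4" "\<bar>l\<^sup>2\<bar> \<le> 16" using lb power_mono[of l 4 2] by auto
  have j1: "\<bar>l * ju j\<bar> \<le> 4 * (10 * (19 / 100) ^ 4 * (17 / 100) ^ 4)"
    unfolding abs_mult using l4 j by (intro mult_mono) auto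
  have j2: "\<bar>l\<^sup>2 * juu j\<bar> \<le> 16 * (40 * (19 / 100) ^ 4 * (17 / 100) ^ 3)"
    unfolding abs_mult using l4(2) j by (intro mult_mono) auto
  have "\<bar>u * ju j\<bar> \<le> 5 / 100 * (10 * (19 / 100) ^ 4 * (17 / 100) ^ 4)"
    unfolding abs_mult using u5 j by (intro mult_mono) auto
  then have j3: "\<bar>1 * jl j + 1 * u * ju j\<bar> \<le> 16 * (1 / 2) * (19 / 100) ^ 4 * (17 / 100) ^ 5 + 5 / 100 * (10 * (19 / 100) ^ 4 * (17 / 100) ^ 4)"
    using j(4) by linarith
  have e1: "encl_jet (Jet (Ball 0 2000) (Ball 0 200000) (Ball 0 20000000) (Ball 0 10000))
      (Jet (jv j) (l * ju j) (l\<^sup>2 * juu j) (1 * jl j + 1 * u * ju j))"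
    unfolding encl_jet_def jet.sel
    by (intro conjI encl_zero_ball[OF j(1)] encl_zero_ball[OF j1] encl_zero_ball[OF j2] encl_zero_ball[OF j3]; simp add: eval_nat_numeral)
  have eb: "encl_jet ball_b (Jet b 0 0 0)"
    by (rule encl_ball_b)
  have el: "encl_jet (ball_l rl) (Jet l 0 0 1)"
    unfolding ball_l_def using l by (intro encl_jet_Jet encl_unit) auto
  have eu: "encl_jet (ball_u ru) (Jet u 1 0 0)"
    unfolding ball_u_def using u by (intro encl_jet_Jet encl_unit) auto
  show ?thesis
    unfolding unstable_ball_def unst_jet_def Let_def j_def[symmetric]
    by (rule encl_unstable_xy[OF eb el eu e0 e1])
qed

text \<open>As for the unstable curve, with tail ranges 0.32 for s and 0.03 for its image under the
  stable eigenvalue; l-derivatives pass through -b / l and so gain the small factor b / l^2.\<close>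

lemma encl_stab:
  assumes l: "\<bar>l * 2 ^ 32 - 16570711405\<bar> \<le> of_int rl" and rl: "rl \<le> 12000"
    and s: "\<bar>s * 2 ^ 32 - 1351350306\<bar> \<le> of_int rs" and rs: "rs \<le> 860000"
  shows "encl_pair (stable_ball rl rs) (stab_jet l s)"
proof -
  have rl': "real_of_int rl \<le> 12000" and rs': "real_of_int rs \<le> 860000" using rl rs by linarith+
  have lb: "3.858 \<le> l" "l \<le> 3.8582" using l rl' by (auto simp: abs_le_iff)
  have sb: "0 \<le> s" "s \<le> 0.315" using s rs' by (auto simp: abs_le_iff)
  have lL: "l \<in> {3.857<..<3.859}" using lb by simp
  define m where "m = - b / l"
  have m: "m \<in> {0.0777<..<0.0779}" using stable_eigenvalue[OF lL] by (simp add: m_def)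
  have m1: "\<bar>m\<bar> \<le> 1 / 10" "\<bar>m\<^sup>2\<bar> \<le> 1 / 100" using m power_mono[of m "1 / 10" 2] by (auto simp: power2_eq_square)
  have c: "\<bar>b / l\<^sup>2\<bar> \<le> 1 / 40"
  proof -
    have "3.85\<^sup>2 \<le> l\<^sup>2" using lb by (intro power_mono) auto
    then have "\<bar>b\<bar> / l\<^sup>2 \<le> 0.3001 / 3.85\<^sup>2" using b_bounds by (intro frac_le) auto
    then show ?thesis by (simp add: abs_divide power2_eq_square)
  qed
  have s1: "\<bar>1 * s\<bar> \<le> 32 / 100" using sb by simp
  have s2: "\<bar>m * s\<bar> \<le> 3 / 100"
  proof -
    have "m * s \<le> 0.0779 * 0.315" using m sb by (intro mult_mono) auto
    moreover have "0 \<le> m * s" using m sb by simp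
    ultimately show ?thesis by simp
  qed
  define j where "j = curve_tail_jet b m (1 * s)"
  have j: "\<bar>jv j\<bar> \<le> 2 * (1 / 20) ^ 4 * (32 / 100) ^ 5" "\<bar>ju j\<bar> \<le> 10 * (1 / 20) ^ 4 * (32 / 100) ^ 4"
     "\<bar>juu j\<bar> \<le> 40 * (1 / 20) ^ 4 * (32 / 100) ^ 3" "\<bar>jl j\<bar> \<le> 16 * 15 * (1 / 20) ^ 4 * (32 / 100) ^ 5"
    unfolding j_def using S.tail_bounds[OF m s1] by simp_all
  have "\<bar>b / l\<^sup>2 * jl j\<bar> \<le> 1 / 40 * (16 * 15 * (1 / 20) ^ 4 * (32 / 100) ^ 5)"
    unfolding abs_mult[of "b / l\<^sup>2"] using c j by (intro mult_mono) auto
  then have j3: "\<bar>b / l\<^sup>2 * jl j + 0 * s * ju j\<bar> \<le> 1 / 40 * (16 * 15 * (1 / 20) ^ 4 * (32 / 100) ^ 5)" by simp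
  have j1: "\<bar>1 * ju j\<bar> \<le> 10 * (1 / 20) ^ 4 * (32 / 100) ^ 4" and j2: "\<bar>1\<^sup>2 * juu j\<bar> \<le> 40 * (1 / 20) ^ 4 * (32 / 100) ^ 3"
    using j by simp_all
  have e1: "encl_jet (Jet (Ball 0 200) (Ball 0 3000) (Ball 0 40000) (Ball 0 600))
      (Jet (jv j) (1 * ju j) (1\<^sup>2 * juu j) (b / l\<^sup>2 * jl j + 0 * s * ju j))"
    unfolding encl_jet_def jet.sel
    by (intro conjI encl_zero_ball[OF j(1)] encl_zero_ball[OF j1] encl_zero_ball[OF j2] encl_zero_ball[OF j3]; simp add: eval_nat_numeral)
  define i where "i = curve_tail_jet b m (m * s)"
  have i: "\<bar>jv i\<bar> \<le> 2 * (1 / 20) ^ 4 * (3 / 100) ^ 5" "\<bar>ju i\<bar> \<le> 10 * (1 / 20) ^ 4 * (3 / 100) ^ 4"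
     "\<bar>juu i\<bar> \<le> 40 * (1 / 20) ^ 4 * (3 / 100) ^ 3" "\<bar>jl i\<bar> \<le> 16 * 15 * (1 / 20) ^ 4 * (3 / 100) ^ 5"
    unfolding i_def using S.tail_bounds[OF m s2] by simp_all
  have i1: "\<bar>m * ju i\<bar> \<le> 1 / 10 * (10 * (1 / 20) ^ 4 * (3 / 100) ^ 4)"
    unfolding abs_mult using m1 i by (intro mult_mono) auto
  have i2: "\<bar>m\<^sup>2 * juu i\<bar> \<le> 1 / 100 * (40 * (1 / 20) ^ 4 * (3 / 100) ^ 3)"
    unfolding abs_mult using m1(2) i by (intro mult_mono) auto
  have "\<bar>b / l\<^sup>2 * jl i\<bar> \<le> 1 / 40 * (16 * 15 * (1 / 20) ^ 4 * (3 / 100) ^ 5)"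
    unfolding abs_mult[of "b / l\<^sup>2"] using c i by (intro mult_mono) auto
  moreover have "\<bar>b / l\<^sup>2 * s * ju i\<bar> \<le> 1 / 40 * (32 / 100) * (10 * (1 / 20) ^ 4 * (3 / 100) ^ 4)"
    unfolding abs_mult[of "b / l\<^sup>2 * s"] abs_mult[of "b / l\<^sup>2"] using c i s1 by (intro mult_mono) auto
  ultimately have i3: "\<bar>b / l\<^sup>2 * jl i + b / l\<^sup>2 * s * ju i\<bar>
      \<le> 1 / 40 * (16 * 15 * (1 / 20) ^ 4 * (3 / 100) ^ 5) + 1 / 40 * (32 / 100) * (10 * (1 / 20) ^ 4 * (3 / 100) ^ 4)"
    by linarith
  have e2: "encl_jet (Jet (Ball 0 5) (Ball 0 5) (Ball 0 5) (Ball 0 5))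
      (Jet (jv i) (m * ju i) (m\<^sup>2 * juu i) (b / l\<^sup>2 * jl i + b / l\<^sup>2 * s * ju i))"
    unfolding encl_jet_def jet.sel
    by (intro conjI encl_zero_ball[OF i(1)] encl_zero_ball[OF i1] encl_zero_ball[OF i2] encl_zero_ball[OF i3]; simp add: eval_nat_numeral)
  have eb: "encl_jet ball_b (Jet b 0 0 0)"
    by (rule encl_ball_b)
  have el: "encl_jet (ball_l rl) (Jet l 0 0 1)"
    unfolding ball_l_def using l by (intro encl_jet_Jet encl_unit) auto
  have es: "encl_jet (ball_s rs) (Jet s 1 0 0)"
    unfolding ball_s_def using s by (intro encl_jet_Jet encl_unit) auto
  show ?thesis
    unfolding stable_ball_def stab_jet_def Let_def m_def[symmetric] j_def[symmetric] i_def[symmetric]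
    by (rule encl_stable_xy[OF eb el es e1 e2])
qed

end

section \<open>Eigenvalue and parameter\<close>

lemma jet_on_subset: "jet_on L' U' f J \<Longrightarrow> L \<subseteq> L' \<Longrightarrow> U \<subseteq> U' \<Longrightarrow> open U \<Longrightarrow> jet_on L U f J"
  unfolding jet_on_def by blast

lemma hstep_real: "hstep a b z = henon a b (z :: real \<times> real)"
  by (simp add: hstep_def henon_def case_prod_unfold power2_eq_square)

lemma henon_hback: "b \<noteq> 0 \<Longrightarrow> henon a b (hback a b z) = (z :: real \<times> real)"
  by (simp add: hback_def henon_def case_prod_unfold recip_real_def power2_eq_square prod_eq_iff field_simps)

context near_parameter
begin

definition "fixpoint l = mid b l"
definition "par_at l = par_of b (mid b l)"

lemma fixpoint_eq: "fixpoint l = (b / l - l) / 2"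
  unfolding fixpoint_def mid_def recip_real_def lit_real_def divide_inverse by simp

lemma par_at_eq: "par_at l = (fixpoint l)\<^sup>2 + (1 - b) * fixpoint l"
  by (simp add: par_at_def fixpoint_def par_of_def lit_real_def power2_eq_square)

lemma unst_in_unstable_set:
  assumes l: "l \<in> {3.857<..<3.859}" and u: "u \<in> {0<..<3/10}"
  shows "unst l u \<in> unstable_set (par_at l) b (fixpoint l, fixpoint l)"
proof -
  have lU: "l \<in> {3.85<..<3.87}" using l by auto
  have lb: "0 \<le> l" "l \<le> 3.859" using l by auto
  have "l * u \<le> 3.859 * (3 / 10)" using lb u by (intro mult_mono) auto
  moreover have "0 < l * u" using l u by simp
  ultimately have lu: "\<bar>l * u\<bar> < 6 / 5" "\<bar>u\<bar> < 6 / 5" using u by auto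
  have cv: "curve_val (mid b l) (low_coeffs b l) s (curve_tail b l s) = curve b l s" if "\<bar>s\<bar> < 6 / 5" for s
    using U.curve_split[OF lU that] fixpoint_eq[of l] by (simp add: curve_val_low_coeffs fixpoint_def)
  have fp: "curve_coeff b l 0 = fixpoint l" by (simp add: coeff_0 fixpoint_eq)
  have "(curve b l (l * u), curve b l u) \<in> unstable_set (par_at l) b (fixpoint l, fixpoint l)"
    using U.curve_in_unstable_set[OF lU _ lu(1)] l by (simp add: fp par_at_eq)
  then show ?thesis
    unfolding unst_def unstable_xy_def unstable_from_def hstep_real cv[OF lu(1)] cv[OF lu(2)] par_at_def[symmetric]
    by (intro henon_in_unstable_set)
qed

lemma stab_in_stable_set:
  assumes l: "l \<in> {3.857<..<3.859}" and s: "s \<in> {0<..<1}"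
  shows "stab l s \<in> stable_set (par_at l) b (fixpoint l, fixpoint l)"
proof -
  define m where "m = - b / l"
  have mS: "m \<in> {0.0777<..<0.0779}" using stable_eigenvalue[OF l] by (simp add: m_def)
  have l0: "l > 0" using l by simp
  have ms: "\<bar>m * s\<bar> < 4"
  proof -
    have "m * s \<le> 1 * 1" using mS s by (intro mult_mono) auto
    moreover have "0 < m * s" using mS s by simp
    ultimately show ?thesis by simp
  qed
  have s4: "\<bar>s\<bar> < 4" using s by auto
  \<comment> \<open>From m = -b / l one has b / m = -l, so both eigenvalues give the same fixed
    point.\<close>
  have fp: "curve_coeff b m 0 = fixpoint l" "(b / m - m) / 2 = fixpoint l"
    using l0 b_bounds(4) by (simp_all add: coeff_0 fixpoint_eq m_def)
  have cv: "curve_val (mid b l) (low_coeffs b m) s (curve_tail b m s) = curve b m s" if "\<bar>s\<bar> < 4" for s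
    using S.curve_split[OF mS that] fp by (simp add: curve_val_low_coeffs fixpoint_def)
  have m: "- (b * recip l) = m" by (simp add: m_def recip_real_def divide_inverse)
  have "(curve b m (m * s), curve b m s) \<in> stable_set (par_at l) b (fixpoint l, fixpoint l)"
    using S.curve_in_stable_set[OF mS _ s4] mS by (simp add: fp par_at_eq)
  moreover have "henon (par_at l) b (stab l s) = (curve b m (m * s), curve b m s)"
    unfolding stab_def stable_xy_def stable_from_def m m_def[symmetric] cv[OF ms] cv[OF s4] par_at_def[symmetric]
    by (rule henon_hback[OF b_bounds(4)])
  ultimately show ?thesis using stable_set_henon_iff[of "par_at l" b "stab l s"] by simp
qed

text \<open>The larger root of t^2 + 2 x t - b, the characteristic polynomial of the derivative at
  the fixed point with coordinate x.\<close>

definition "eigenvalue_of a = - fst (henon_fp a b) + sqrt ((fst (henon_fp a b))\<^sup>2 + b)"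

lemma henon_fp_bounds:
  assumes "a > 1"
  shows "0 < (b - 1)\<^sup>2 + 4 * a" "fst (henon_fp a b) \<le> - 1.6" "0 < (fst (henon_fp a b))\<^sup>2 + b" "1 < eigenvalue_of a"
proof -
  have "4 \<le> (b - 1)\<^sup>2 + 4 * a" using assms zero_le_power2[of "b - 1"] by linarith
  then have r: "sqrt (2\<^sup>2) \<le> sqrt ((b - 1)\<^sup>2 + 4 * a)" by (intro real_sqrt_le_mono) simp
  show "0 < (b - 1)\<^sup>2 + 4 * a" using assms zero_le_power2[of "b - 1"] by linarith
  show x: "fst (henon_fp a b) \<le> - 1.6" using r b_bounds by (simp add: henon_fp_def Let_def)
  then have "1.6\<^sup>2 \<le> (- fst (henon_fp a b))\<^sup>2" by (intro power_mono) auto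
  then show "0 < (fst (henon_fp a b))\<^sup>2 + b" using b_bounds by (simp add: power2_eq_square)
  then have "0 \<le> sqrt ((fst (henon_fp a b))\<^sup>2 + b)" by simp
  moreover have "1 < - fst (henon_fp a b)" using x by simp
  ultimately show "1 < eigenvalue_of a" unfolding eigenvalue_of_def by linarith
qed

text \<open>With q the square root in \<open>eigenvalue_of\<close>, (q - x) (q + x) = b, so l = q -
  x has b / l = q + x and half of b / l - l is x. Completing the square in the fixed point equation
  then returns a.\<close>

lemma fixpoint_eigenvalue:
  assumes a: "a > 1"
  shows "henon_fp a b = (fixpoint (eigenvalue_of a), fixpoint (eigenvalue_of a))" "par_at (eigenvalue_of a) = a"
proof -
  note bd = henon_fp_bounds[OF a]
  define x where "x = fst (henon_fp a b)"
  define r where "r = sqrt ((b - 1)\<^sup>2 + 4 * a)"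
  define q where "q = sqrt (x\<^sup>2 + b)"
  have r: "r\<^sup>2 = (b - 1)\<^sup>2 + 4 * a" using bd(1) by (simp add: r_def)
  have q: "q\<^sup>2 = x\<^sup>2 + b" using bd(3) by (simp add: q_def x_def)
  have x: "2 * x = b - 1 - r" by (simp add: x_def r_def henon_fp_def Let_def)
  have e: "eigenvalue_of a = q - x" by (simp add: eigenvalue_of_def q_def x_def)
  have "(q - x) * (q + x) = b" using q by (simp add: power2_eq_square algebra_simps)
  moreover have qx: "q - x > 0" using bd(4) e by simp
  ultimately have "b / (q - x) = q + x" by (simp add: field_simps)
  then have f: "fixpoint (eigenvalue_of a) = x" by (simp add: fixpoint_eq e)
  then show "henon_fp a b = (fixpoint (eigenvalue_of a), fixpoint (eigenvalue_of a))"
    by (simp add: x_def henon_fp_def Let_def)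
  have "4 * (x\<^sup>2 + (1 - b) * x) = (2 * x)\<^sup>2 + 2 * (1 - b) * (2 * x)" by (simp add: power2_eq_square algebra_simps)
  also have "\<dots> = r\<^sup>2 - (b - 1)\<^sup>2" unfolding x by (simp add: power2_eq_square algebra_simps)
  also have "\<dots> = 4 * a" using r by simp
  finally show "par_at (eigenvalue_of a) = a" by (simp add: par_at_eq f)
qed

text \<open>Both square roots must pick the right branch: 2 x + 1 - b is negative and l + x positive
  for l near 3.858.\<close>

lemma eigenvalue_of_par_at:
  assumes l: "l \<in> {3.857<..<3.859}"
  shows "eigenvalue_of (par_at l) = l"
proof -
  have m: "0.0777 < - b / l" "- b / l < 0.0779" using stable_eigenvalue[OF l] by auto
  define x where "x = fixpoint l"
  have x: "x = (b / l - l) / 2" by (simp add: x_def fixpoint_eq)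
  have neg: "2 * x + 1 - b \<le> 0" using x m l b_bounds by simp
  have "(b - 1)\<^sup>2 + 4 * par_at l = (2 * x + 1 - b)\<^sup>2"
    by (simp add: par_at_eq x_def[symmetric] power2_eq_square algebra_simps)
  then have "sqrt ((b - 1)\<^sup>2 + 4 * par_at l) = - (2 * x + 1 - b)" using neg by simp
  then have f: "fst (henon_fp (par_at l) b) = x" by (simp add: henon_fp_def Let_def)
  have "x\<^sup>2 + b = (l + x)\<^sup>2" using x l by (simp add: power2_eq_square field_simps)
  moreover have "0 \<le> l + x" using x m l by simp
  ultimately have "sqrt (x\<^sup>2 + b) = l + x" by simp
  then show ?thesis by (simp add: eigenvalue_of_def f)
qed

text \<open>Only existence is recorded here; at the tangency the derivative is shown to be nonzero
  from \<open>par_at\<close> being a left inverse.\<close>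

lemma eigenvalue_of_deriv:
  assumes a: "a > 1"
  obtains d where "(eigenvalue_of has_real_derivative d) (at a)"
proof -
  note bd = henon_fp_bounds[OF a]
  have p: "((\<lambda>a. (b - 1)\<^sup>2 + 4 * a) has_real_derivative 4) (at a)" by (auto intro!: derivative_eq_intros)
  note r = DERIV_chain2[OF DERIV_real_sqrt[OF bd(1)] p]
  have x: "((\<lambda>a. fst (henon_fp a b)) has_real_derivative (0 - inverse (sqrt ((b - 1)\<^sup>2 + 4 * a)) / 2 * 4 - 0) / 2) (at a)"
    unfolding henon_fp_def Let_def fst_conv by (intro DERIV_cdivide DERIV_diff DERIV_const r)
  have "((\<lambda>a. (fst (henon_fp a b))\<^sup>2 + b) has_real_derivative
      2 * fst (henon_fp a b) * ((0 - inverse (sqrt ((b - 1)\<^sup>2 + 4 * a)) / 2 * 4 - 0) / 2)) (at a)"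
    by (rule derivative_eq_intros x refl)+ simp
  from DERIV_add[OF DERIV_minus[OF x] DERIV_chain2[OF DERIV_real_sqrt[OF bd(3)] this]]
  show ?thesis unfolding eigenvalue_of_def[abs_def, symmetric] by (rule that)
qed

lemma par_at_deriv:
  assumes "l \<noteq> 0"
  obtains d where "(par_at has_real_derivative d) (at l)"
proof -
  have "(fixpoint has_real_derivative ((0 * l - b * 1) / (l * l) - 1) / 2) (at l)"
    unfolding fixpoint_eq[abs_def]
    by (intro DERIV_cdivide DERIV_diff DERIV_divide DERIV_const DERIV_ident assms)
  from DERIV_add[OF DERIV_power[OF this, of 2] DERIV_cmult[OF this, of "1 - b"]]
  show ?thesis unfolding par_at_eq[abs_def, symmetric] by (rule that)
qed

section \<open>Explicit boxes around the tangency\<close>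

abbreviation "l\<^sub>0 \<equiv> 16570711405 / 2 ^ 32 :: real"
abbreviation "u\<^sub>0 \<equiv> 183617686 / 2 ^ 32 :: real"
abbreviation "s\<^sub>0 \<equiv> 1351350306 / 2 ^ 32 :: real"
abbreviation "Ls \<equiv> {l\<^sub>0 - 12000 / 2 ^ 32<..<l\<^sub>0 + 12000 / 2 ^ 32}"
abbreviation "Us \<equiv> {u\<^sub>0 - 430000 / 2 ^ 32<..<u\<^sub>0 + 430000 / 2 ^ 32}"
abbreviation "Ss \<equiv> {s\<^sub>0 - 860000 / 2 ^ 32..s\<^sub>0 + 860000 / 2 ^ 32}"

lemma in_boxes:
  "l \<in> Ls \<Longrightarrow> \<bar>l * 2 ^ 32 - 16570711405\<bar> \<le> of_int 12000" "u \<in> Us \<Longrightarrow> \<bar>u * 2 ^ 32 - 183617686\<bar> \<le> of_int 430000"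
  "s \<in> Ss \<Longrightarrow> \<bar>s * 2 ^ 32 - 1351350306\<bar> \<le> of_int 860000"
  "l \<in> Ls \<Longrightarrow> l \<in> {3.857<..<3.859}" "u \<in> Us \<Longrightarrow> u \<in> {0<..<3/10}" "s \<in> Ss \<Longrightarrow> s \<in> {0<..<1}"
  by (auto simp: abs_le_iff)

lemma box_enclosures:
  assumes l: "l \<in> Ls"
  shows "u \<in> Us \<Longrightarrow> encl_pair (unstable_ball 12000 430000) (unst_jet l u)"
    "s \<in> Ss \<Longrightarrow> encl_pair (stable_ball 12000 860000) (stab_jet l s)"
    "encl_pair (stable_ball 12000 0) (stab_jet l s\<^sub>0)"
proof -
  note l' = in_boxes(1)[OF l]
  show "u \<in> Us \<Longrightarrow> encl_pair (unstable_ball 12000 430000) (unst_jet l u)"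
    by (rule encl_unst[OF l' order_refl in_boxes(2) order_refl])
  show "s \<in> Ss \<Longrightarrow> encl_pair (stable_ball 12000 860000) (stab_jet l s)"
    by (rule encl_stab[OF l' order_refl in_boxes(3) order_refl])
  show "encl_pair (stable_ball 12000 0) (stab_jet l s\<^sub>0)"
    by (rule encl_stab[OF l' order_refl]) simp_all
qed

lemma jet_on_boxes:
  "jet_on Ls Us (\<lambda>l u. fst (unst l u)) (\<lambda>l u. fst (unst_jet l u))" "jet_on Ls Us (\<lambda>l u. snd (unst l u)) (\<lambda>l u. snd (unst_jet l u))"
  "jet_on Ls {0<..<1} (\<lambda>l s. fst (stab l s)) (\<lambda>l s. fst (stab_jet l s))" "jet_on Ls {0<..<1} (\<lambda>l s. snd (stab l s)) (\<lambda>l s. snd (stab_jet l s))"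
proof -
  have 1: "Ls \<subseteq> {3.857<..<3.859}" "Us \<subseteq> {0<..<3/10}" using in_boxes by blast+
  have 2: "Ls \<subseteq> {3.85<..<3.87}" by (rule subset_trans[OF 1(1)]) auto
  show "jet_on Ls Us (\<lambda>l u. fst (unst l u)) (\<lambda>l u. fst (unst_jet l u))" "jet_on Ls Us (\<lambda>l u. snd (unst l u)) (\<lambda>l u. snd (unst_jet l u))"
    using jet_on_unst jet_on_subset[OF _ 2 1(2)] unfolding jet_on_pair_def by auto
  show "jet_on Ls {0<..<1} (\<lambda>l s. fst (stab l s)) (\<lambda>l s. fst (stab_jet l s))" "jet_on Ls {0<..<1} (\<lambda>l s. snd (stab l s)) (\<lambda>l s. snd (stab_jet l s))"
    using jet_on_stab jet_on_subset[OF _ 1(1)] unfolding jet_on_pair_def by auto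
qed

text \<open>The enclosed y-velocity of the stable arc is about 10.6; the bound 10 converts distances
  in y into distances in s and back.\<close>

lemma stab_growth:
  assumes l: "l \<in> Ls" and s: "s \<in> Ss" "s' \<in> Ss" "s \<le> s'"
  shows "10 * (s' - s) \<le> snd (stab l s') - snd (stab l s)"
proof (cases "s = s'")
  case False
  with s have lt: "s < s'" by simp
  have "\<exists>z. s < z \<and> z < s' \<and> snd (stab l s') - snd (stab l s) = (s' - s) * ju (snd (stab_jet l z))"
  proof (rule MVT2[OF lt])
    fix z assume "s \<le> z" "z \<le> s'"
    then have "z \<in> Ss" using s by auto
    then show "((\<lambda>s. snd (stab l s)) has_real_derivative ju (snd (stab_jet l z))) (at z)"
      using jet_onD(4)[OF jet_on_boxes(4) l in_boxes(6)] by blast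
  qed
  then obtain z where z: "s < z" "z < s'" "snd (stab l s') - snd (stab l s) = (s' - s) * ju (snd (stab_jet l z))" by blast
  have "z \<in> Ss" using z s by auto
  from box_enclosures(2)[OF l this] have "10 \<le> ju (snd (stab_jet l z))"
    by (simp add: stable_ball_box encl_pair_def encl_jet_def abs_le_iff)
  then have "(s' - s) * 10 \<le> (s' - s) * ju (snd (stab_jet l z))" using lt by (intro mult_left_mono) auto
  then show ?thesis using z(3) by simp
qed simp

text \<open>The slope bound moves y by at least 8600000 units of 2 ^ -32 from
  \<open>s\<^sub>0\<close> to either end, more than the combined radii 2456667 and 197847 of the two
  enclosures.\<close>

lemma boxes_bracket:
  assumes l: "l \<in> Ls" and u: "u \<in> Us"
  shows "snd (stab l (s\<^sub>0 - 860000 / 2 ^ 32)) < snd (unst l u)" "snd (unst l u) < snd (stab l (s\<^sub>0 + 860000 / 2 ^ 32))"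
proof -
  have s0: "s\<^sub>0 \<in> Ss" by simp
  have v: "jv (snd (unst_jet l u)) = snd (unst l u)" "jv (snd (stab_jet l s\<^sub>0)) = snd (stab l s\<^sub>0)"
    using jet_onD(1)[OF jet_on_boxes(2) l u] jet_onD(1)[OF jet_on_boxes(4) l in_boxes(6)[OF s0]] by auto
  have "\<bar>snd (unst l u) * 2 ^ 32 - 7407161141\<bar> \<le> 2456667" "\<bar>snd (stab l s\<^sub>0) * 2 ^ 32 - 7407161139\<bar> \<le> 197847"
    using box_enclosures(1)[OF l u] box_enclosures(3)[OF l]
    unfolding unstable_ball_box stable_ball_line encl_pair_def encl_jet_def v[symmetric] by simp_all
  moreover have "10 * (860000 / 2 ^ 32) \<le> snd (stab l s\<^sub>0) - snd (stab l (s\<^sub>0 - 860000 / 2 ^ 32))"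
    using stab_growth[OF l _ s0, of "s\<^sub>0 - 860000 / 2 ^ 32"] by simp
  moreover have "10 * (860000 / 2 ^ 32) \<le> snd (stab l (s\<^sub>0 + 860000 / 2 ^ 32)) - snd (stab l s\<^sub>0)"
    using stab_growth[OF l s0, of "s\<^sub>0 + 860000 / 2 ^ 32"] by simp
  ultimately show "snd (stab l (s\<^sub>0 - 860000 / 2 ^ 32)) < snd (unst l u)" "snd (unst l u) < snd (stab l (s\<^sub>0 + 860000 / 2 ^ 32))"
    unfolding abs_le_iff by simp_all
qed

text \<open>At the centre the two y-values agree within 10000 units, so slope 10 puts the matching s
  within 1000 units of \<open>s\<^sub>0\<close>; the ball of that radius then encloses the gap and
  its slope.\<close>

lemma centre_bounds:
  assumes s: "s \<in> Ss" and eq: "snd (stab l\<^sub>0 s) = snd (unst l\<^sub>0 u\<^sub>0)"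
  shows "\<bar>fst (unst l\<^sub>0 u\<^sub>0) - fst (stab l\<^sub>0 s)\<bar> \<le> 5 / 10 ^ 6 \<and>
    \<bar>gap_u (fst (unst_jet l\<^sub>0 u\<^sub>0)) (snd (unst_jet l\<^sub>0 u\<^sub>0)) (fst (stab_jet l\<^sub>0 s)) (snd (stab_jet l\<^sub>0 s))\<bar> \<le> 2 / 10 ^ 3"
proof -
  have l: "l\<^sub>0 \<in> Ls" and u: "u\<^sub>0 \<in> Us" and s0: "s\<^sub>0 \<in> Ss" by simp_all
  have U: "encl_pair (unstable_ball 0 0) (unst_jet l\<^sub>0 u\<^sub>0)" by (rule encl_unst) simp_all
  have S0: "encl_pair (stable_ball 0 0) (stab_jet l\<^sub>0 s\<^sub>0)" by (rule encl_stab) simp_all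
  have v: "jv (snd (unst_jet l\<^sub>0 u\<^sub>0)) = snd (unst l\<^sub>0 u\<^sub>0)" "jv (snd (stab_jet l\<^sub>0 s\<^sub>0)) = snd (stab l\<^sub>0 s\<^sub>0)"
    "jv (fst (unst_jet l\<^sub>0 u\<^sub>0)) = fst (unst l\<^sub>0 u\<^sub>0)" "jv (fst (stab_jet l\<^sub>0 s)) = fst (stab l\<^sub>0 s)"
    using jet_onD(1)[OF jet_on_boxes(1) l u] jet_onD(1)[OF jet_on_boxes(2) l u]
      jet_onD(1)[OF jet_on_boxes(3) l in_boxes(6)[OF s]] jet_onD(1)[OF jet_on_boxes(4) l in_boxes(6)[OF s0]] by auto
  have "\<bar>snd (unst l\<^sub>0 u\<^sub>0) * 2 ^ 32 - 7407161141\<bar> \<le> 2872" "\<bar>snd (stab l\<^sub>0 s\<^sub>0) * 2 ^ 32 - 7407161139\<bar> \<le> 2637"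
    using U S0 unfolding unstable_ball_centre stable_ball_centre encl_pair_def encl_jet_def v[symmetric] by simp_all
  then have Y: "\<bar>snd (unst l\<^sub>0 u\<^sub>0) - snd (stab l\<^sub>0 s\<^sub>0)\<bar> \<le> 10000 / 2 ^ 32"
    unfolding abs_le_iff by simp
  have "\<bar>s - s\<^sub>0\<bar> \<le> 1000 / 2 ^ 32"
  proof (cases "s \<le> s\<^sub>0")
    case True
    then show ?thesis using stab_growth[OF l s s0 True] Y eq by (simp add: abs_le_iff)
  next
    case False
    then show ?thesis using stab_growth[OF l s0 s] Y eq by (simp add: abs_le_iff)
  qed
  then have "\<bar>s * 2 ^ 32 - 1351350306\<bar> \<le> of_int 1000" unfolding abs_le_iff by simp
  then have S: "encl_pair (stable_ball 0 1000) (stab_jet l\<^sub>0 s)" by (intro encl_stab) simp_all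
  have "\<bar>fst (unst l\<^sub>0 u\<^sub>0) * 2 ^ 32 + 7110284392\<bar> \<le> 16203" "\<bar>fst (stab l\<^sub>0 s) * 2 ^ 32 + 7110284391\<bar> \<le> 1210"
    using U S unfolding unstable_ball_centre stable_ball_near_centre encl_pair_def encl_jet_def v[symmetric] by simp_all
  then have 1: "\<bar>fst (unst l\<^sub>0 u\<^sub>0) - fst (stab l\<^sub>0 s)\<bar> \<le> 5 / 10 ^ 6" unfolding abs_le_iff by simp
  have "encl (Ball (- 3458) 6871611) (gap_u (fst (unst_jet l\<^sub>0 u\<^sub>0)) (snd (unst_jet l\<^sub>0 u\<^sub>0)) (fst (stab_jet l\<^sub>0 s)) (snd (stab_jet l\<^sub>0 s)))"
    unfolding gap_u_centre[symmetric] using U S unfolding encl_pair_def by (intro encl_gaps) auto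
  then have "\<bar>gap_u (fst (unst_jet l\<^sub>0 u\<^sub>0)) (snd (unst_jet l\<^sub>0 u\<^sub>0)) (fst (stab_jet l\<^sub>0 s)) (snd (stab_jet l\<^sub>0 s))\<bar> \<le> 2 / 10 ^ 3"
    unfolding encl.simps abs_le_iff by simp
  with 1 show ?thesis by blast
qed

text \<open>Keeps a in the required interval: 10 ^ -5 is about 42950 units of 2 ^ -32, and the
  centre is \<open>a0\<close> to within one unit.\<close>

lemma par_at_box:
  assumes "l \<in> Ls"
  shows "\<bar>par_at l * 2 ^ 32 - 5645850945\<bar> \<le> 32109"
proof -
  have "encl_jet (ball_l 12000) (Jet l 0 0 1)"
    unfolding ball_l_def using in_boxes(1)[OF assms] by (intro encl_jet_Jet encl_unit) auto
  from encl_par_of[OF encl_ball_b encl_mid[OF encl_ball_b this]]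
  have "encl (Ball 5645850945 32109) (jv (par_of (Jet b 0 0 0) (mid (Jet b 0 0 0) (Jet l 0 0 1))))"
    unfolding encl_jet_def par_ball_box by blast
  moreover have "jv (par_of (Jet b 0 0 0) (mid (Jet b 0 0 0) (Jet l 0 0 1))) = par_at l"
    by (simp add: par_at_def par_of_def mid_def jet_ops Let_def)
  ultimately show ?thesis by simp
qed

end

section \<open>The tangency\<close>

context near_parameter
begin

text \<open>The tangency is found in the parameter l and transported to a by composing the continued
  arcs with \<open>eigenvalue_of\<close>.\<close>

lemma exists_tangency:
  "\<exists>a. \<bar>a * 2 ^ 32 - 5645850945\<bar> \<le> 32109 \<and> quadratic_generic_homoclinic_tangency a b"
\<comment> \<open>The closed intervals of radius 11000 and 420000 fit into the open boxes of radius
  12000 and 430000. With these choices \<open>D1 * h\<close> is about 8.2e-6 against an error of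
  5.2e-6, and \<open>c * k\<^sup>2 / 2\<close> is about 4.2e-5 against 1.4e-5.\<close>
proof (rule curves_with_quadratic_tangency[where L = Ls and U = Us and \<Sigma> = "{0<..<1}"
    and ?s1.0 = "s\<^sub>0 - 860000 / 2 ^ 32" and ?s2.0 = "s\<^sub>0 + 860000 / 2 ^ 32" and ?l0.0 = "l\<^sub>0" and ?u0.0 = "u\<^sub>0"
    and h = "11000 / 2 ^ 32" and k = "420000 / 2 ^ 32" and ?D1.0 = "32 / 10" and ?D2.0 = "34 / 10"
    and c = 8700 and ?e0.0 = "5 / 10 ^ 6" and ?e1.0 = "2 / 10 ^ 3", OF _ _ _ jet_on_boxes])
  show "open Ls" by simp
  show "s\<^sub>0 - 860000 / 2 ^ 32 < s\<^sub>0 + 860000 / 2 ^ 32" by simp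
  show "Ss \<subseteq> {0<..<1}" using in_boxes(6) by blast
  show "{l\<^sub>0 - 11000 / 2 ^ 32..l\<^sub>0 + 11000 / 2 ^ 32} \<subseteq> Ls" "{u\<^sub>0 - 420000 / 2 ^ 32..u\<^sub>0 + 420000 / 2 ^ 32} \<subseteq> Us" by auto
  show "(0 :: real) < 11000 / 2 ^ 32" "(0 :: real) < 420000 / 2 ^ 32" "(0 :: real) < 8700" "(0 :: real) < 32 / 10" by simp_all
  show "5 / 10 ^ 6 + 2 / 10 ^ 3 * (420000 / 2 ^ 32) < 32 / 10 * (11000 / 2 ^ 32 :: real)" by simp
  show "5 / 10 ^ 6 + 2 / 10 ^ 3 * (420000 / 2 ^ 32) + 34 / 10 * (11000 / 2 ^ 32) < 8700 * (420000 / 2 ^ 32 :: real)\<^sup>2 / 2"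
    by (simp add: power2_eq_square)
  show "0 < ju (snd (stab_jet l s))" if "l \<in> Ls" "s \<in> Ss" for l s
    using box_enclosures(2)[OF that] unfolding stable_ball_box encl_pair_def encl_jet_def by (simp add: abs_le_iff)
  show "ju (snd (unst_jet l u)) < 0" if "l \<in> Ls" "u \<in> Us" for l u
    using box_enclosures(1)[OF that] unfolding unstable_ball_box encl_pair_def encl_jet_def by (simp add: abs_le_iff)
  show "snd (stab l (s\<^sub>0 - 860000 / 2 ^ 32)) < snd (unst l u) \<and> snd (unst l u) < snd (stab l (s\<^sub>0 + 860000 / 2 ^ 32))"
    if "l \<in> Ls" "u \<in> Us" for l u
    using boxes_bracket[OF that] by blast
  show "- (34 / 10) \<le> gap_l (fst (unst_jet l u)) (snd (unst_jet l u)) (fst (stab_jet l s)) (snd (stab_jet l s)) \<and>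
      gap_l (fst (unst_jet l u)) (snd (unst_jet l u)) (fst (stab_jet l s)) (snd (stab_jet l s)) \<le> - (32 / 10)"
    if "l \<in> Ls" "u \<in> Us" "s \<in> Ss" for l u s
  proof -
    have "encl (Ball (- 14204263070) 132231929) (gap_l (fst (unst_jet l u)) (snd (unst_jet l u)) (fst (stab_jet l s)) (snd (stab_jet l s)))"
      unfolding gap_l_box[symmetric]
      using box_enclosures(1)[OF that(1,2)] box_enclosures(2)[OF that(1,3)] unfolding encl_pair_def by (intro encl_gaps) auto
    then show ?thesis unfolding encl.simps abs_le_iff by simp
  qed
  show "8700 \<le> gap_uu (fst (unst_jet l u)) (snd (unst_jet l u)) (fst (stab_jet l s)) (snd (stab_jet l s))"
    if "l \<in> Ls" "u \<in> Us" "s \<in> Ss" for l u s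
  proof -
    have "encl (Ball 37875170103042 189624033821) (gap_uu (fst (unst_jet l u)) (snd (unst_jet l u)) (fst (stab_jet l s)) (snd (stab_jet l s)))"
      unfolding gap_uu_box[symmetric]
      using box_enclosures(1)[OF that(1,2)] box_enclosures(2)[OF that(1,3)] unfolding encl_pair_def by (intro encl_gaps) auto
    then show ?thesis unfolding encl.simps abs_le_iff by simp
  qed
  show "\<bar>fst (unst l\<^sub>0 u\<^sub>0) - fst (stab l\<^sub>0 s)\<bar> \<le> 5 / 10 ^ 6 \<and>
    \<bar>gap_u (fst (unst_jet l\<^sub>0 u\<^sub>0)) (snd (unst_jet l\<^sub>0 u\<^sub>0)) (fst (stab_jet l\<^sub>0 s)) (snd (stab_jet l\<^sub>0 s))\<bar> \<le> 2 / 10 ^ 3"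
    if "s \<in> Ss" "snd (stab l\<^sub>0 s) = snd (unst l\<^sub>0 u\<^sub>0)" for s
    by (rule centre_bounds[OF that])
next
  fix l u \<epsilon> gs gu gs' gu' gs'' gu'' D
  assume l: "l \<in> {l\<^sub>0 - 11000 / 2 ^ 32<..<l\<^sub>0 + 11000 / 2 ^ 32}" and u: "u \<in> Us" and \<epsilon>: "(0 :: real) < \<epsilon>"
    and near: "\<And>l'. \<bar>l' - l\<bar> < \<epsilon> \<Longrightarrow> l' \<in> Ls"
    and gs: "\<And>l' t. \<bar>l' - l\<bar> < \<epsilon> \<Longrightarrow> \<bar>t\<bar> < \<epsilon> \<Longrightarrow> \<exists>s\<in>Ss. gs l' t = fst (stab l' s) \<and> snd (unst l u) + t = snd (stab l' s)"
    and gu: "\<And>l' t. \<bar>l' - l\<bar> < \<epsilon> \<Longrightarrow> \<bar>t\<bar> < \<epsilon> \<Longrightarrow> \<exists>u'\<in>Us. gu l' t = fst (unst l' u') \<and> snd (unst l u) + t = snd (unst l' u')"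
    and gs_cont: "\<And>l' t. \<bar>l' - l\<bar> < \<epsilon> \<Longrightarrow> \<bar>t\<bar> < \<epsilon> \<Longrightarrow> isCont (\<lambda>(l, t). gs l t) (l', t)"
    and gu_cont: "\<And>l' t. \<bar>l' - l\<bar> < \<epsilon> \<Longrightarrow> \<bar>t\<bar> < \<epsilon> \<Longrightarrow> isCont (\<lambda>(l, t). gu l t) (l', t)"
    and g0: "gs l 0 = fst (unst l u)" "gu l 0 = fst (unst l u)"
    and gs': "\<And>t. \<bar>t\<bar> < \<epsilon> \<Longrightarrow> (gs l has_real_derivative gs' t) (at t)"
    and gu': "\<And>t. \<bar>t\<bar> < \<epsilon> \<Longrightarrow> (gu l has_real_derivative gu' t) (at t)"
    and tangent: "gs' 0 = gu' 0"
    and gs'': "(gs' has_real_derivative gs'') (at 0)" and gu'': "(gu' has_real_derivative gu'') (at 0)" and ne: "gs'' \<noteq> gu''"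
    and D: "((\<lambda>l. gs l 0 - gu l 0) has_real_derivative D) (at l)" "D \<noteq> 0"
  define a where "a = par_at l"
  have lL: "l \<in> Ls" using near[of l] \<epsilon> by simp
  note la = par_at_box[OF lL]
  have a1: "a > 1" using la unfolding a_def abs_le_iff by simp
  have ev: "eigenvalue_of a = l" unfolding a_def by (rule eigenvalue_of_par_at[OF in_boxes(4)[OF lL]])
  obtain d where d: "(eigenvalue_of has_real_derivative d) (at a)" by (rule eigenvalue_of_deriv[OF a1])
  \<comment> \<open>\<open>par_at\<close> undoes \<open>eigenvalue_of\<close>, so the product of
    their derivatives is 1.\<close>
  have d0: "d \<noteq> 0"
  proof
    assume "d = 0"
    obtain p where p: "(par_at has_real_derivative p) (at l)" by (rule par_at_deriv[of l]) (use lL in auto)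
    have "((\<lambda>a. par_at (eigenvalue_of a)) has_real_derivative p * d) (at a)"
      by (rule DERIV_chain2[OF _ d]) (simp add: ev p)
    then have "((\<lambda>a. a) has_real_derivative p * d) (at a)"
      by (rule has_field_derivative_transform_within_open[where S = "{1<..}"]) (use a1 fixpoint_eigenvalue(2) in auto)
    then have "p * d = 1" by (rule DERIV_unique) (rule DERIV_ident)
    with \<open>d = 0\<close> show False by simp
  qed
  \<comment> \<open>Continuity of \<open>eigenvalue_of\<close> pulls the admissible range of l back
    to an interval of parameters a'.\<close>
  have "\<forall>\<^sub>F a' in nhds a. dist (eigenvalue_of a') l < \<epsilon> \<and> a' > 1"
  proof (intro eventually_conj)
    have "(eigenvalue_of \<longlongrightarrow> l) (nhds a)"
      using DERIV_isCont[OF d] ev by (simp add: isCont_def tendsto_nhds_iff)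
    then show "\<forall>\<^sub>F a' in nhds a. dist (eigenvalue_of a') l < \<epsilon>" using \<epsilon> by (rule tendstoD)
    show "\<forall>\<^sub>F a' in nhds a. a' > 1" using eventually_nhds_in_open[of "{1<..}" a] a1 by simp
  qed
  then obtain e where e: "e > 0" "\<And>a'. dist a' a < e \<Longrightarrow> dist (eigenvalue_of a') l < \<epsilon> \<and> a' > 1"
    unfolding eventually_nhds_metric by blast
  have e': "\<bar>eigenvalue_of a' - l\<bar> < \<epsilon>" "a' > 1" if "a' \<in> {a - e<..<a + e}" for a'
    using e(2)[of a'] that by (auto simp: dist_real_def abs_less_iff)
  define X where "X = fst (unst l u)"
  define Y where "Y = snd (unst l u)"
  \<comment> \<open>The tangent direction is (v, 1) and the transversal (1, 0); subtracting the
    common tangent X + t * v makes both graphs and their slopes vanish at t = 0 without changing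
    their difference.\<close>
  define v where "v = gs' 0"
  define fs where "fs a' t = gs (eigenvalue_of a') t - X - t * v" for a' t
  define fu where "fu a' t = gu (eigenvalue_of a') t - X - t * v" for a' t
  have fp: "henon_fp a' b = (fixpoint (eigenvalue_of a'), fixpoint (eigenvalue_of a'))" "par_at (eigenvalue_of a') = a'"
    if "a' > 1" for a' using fixpoint_eigenvalue[OF that] by auto
  have pts: "(X, Y) + t *\<^sub>R (v, 1) + f *\<^sub>R (1, 0) = (f + X + t * v, Y + t)" for t f
    by simp
  have in_stable: "(X, Y) + t *\<^sub>R (v, 1) + fs a' t *\<^sub>R (1, 0) \<in> stable_set a' b (henon_fp a' b)"
    and in_unstable: "(X, Y) + t *\<^sub>R (v, 1) + fu a' t *\<^sub>R (1, 0) \<in> unstable_set a' b (henon_fp a' b)"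
    if a': "a' \<in> {a - e<..<a + e}" and t: "t \<in> {- \<epsilon><..<\<epsilon>}" for a' t
  proof -
    note ea = e'[OF a']
    have t': "\<bar>t\<bar> < \<epsilon>" using t by auto
    have L: "eigenvalue_of a' \<in> {3.857<..<3.859}" by (rule in_boxes(4)[OF near[OF ea(1)]])
    obtain s where s: "s \<in> Ss" "gs (eigenvalue_of a') t = fst (stab (eigenvalue_of a') s)" "Y + t = snd (stab (eigenvalue_of a') s)"
      using gs[OF ea(1) t'] unfolding Y_def by blast
    have "(X, Y) + t *\<^sub>R (v, 1) + fs a' t *\<^sub>R (1, 0) = stab (eigenvalue_of a') s"
      unfolding pts fs_def by (simp add: s prod_eq_iff)
    then show "(X, Y) + t *\<^sub>R (v, 1) + fs a' t *\<^sub>R (1, 0) \<in> stable_set a' b (henon_fp a' b)"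
      using stab_in_stable_set[OF L in_boxes(6)[OF s(1)]] fp[OF ea(2)] by simp
    obtain u' where u': "u' \<in> Us" "gu (eigenvalue_of a') t = fst (unst (eigenvalue_of a') u')" "Y + t = snd (unst (eigenvalue_of a') u')"
      using gu[OF ea(1) t'] unfolding Y_def by blast
    have "(X, Y) + t *\<^sub>R (v, 1) + fu a' t *\<^sub>R (1, 0) = unst (eigenvalue_of a') u'"
      unfolding pts fu_def by (simp add: u' prod_eq_iff)
    then show "(X, Y) + t *\<^sub>R (v, 1) + fu a' t *\<^sub>R (1, 0) \<in> unstable_set a' b (henon_fp a' b)"
      using unst_in_unstable_set[OF L in_boxes(5)[OF u'(1)]] fp[OF ea(2)] by simp
  qed
  have cont: "continuous_on ({a - e<..<a + e} \<times> {- \<epsilon><..<\<epsilon>}) (\<lambda>(a', t). g (eigenvalue_of a') t - X - t * v)"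
    if g: "\<And>l' t. \<bar>l' - l\<bar> < \<epsilon> \<Longrightarrow> \<bar>t\<bar> < \<epsilon> \<Longrightarrow> isCont (\<lambda>(l, t). g l t) (l', t)" for g :: "real \<Rightarrow> real \<Rightarrow> real"
  proof (intro continuous_at_imp_continuous_on ballI)
    fix z assume "z \<in> {a - e<..<a + e} \<times> {- \<epsilon><..<\<epsilon>}"
    then obtain a' t where z: "z = (a', t)" "a' \<in> {a - e<..<a + e}" "\<bar>t\<bar> < \<epsilon>" by (auto simp: abs_less_iff)
    obtain d' where "(eigenvalue_of has_real_derivative d') (at a')" by (rule eigenvalue_of_deriv[OF e'(2)[OF z(2)]])
    from DERIV_isCont[OF this] have "isCont (\<lambda>z. eigenvalue_of (fst z)) z"
      using isCont_o2[of z fst eigenvalue_of] by (simp add: z(1))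
    then have "isCont (\<lambda>z. (eigenvalue_of (fst z), snd z)) z" by (intro continuous_intros)
    from isCont_o2[OF this, of "\<lambda>(l, t). g l t"] g[OF e'(1)[OF z(2)] z(3)]
    have "isCont (\<lambda>z. g (eigenvalue_of (fst z)) (snd z)) z" by (simp add: z(1) case_prod_unfold)
    then show "isCont (\<lambda>(a', t). g (eigenvalue_of a') t - X - t * v) z"
      unfolding case_prod_unfold by (intro continuous_intros)
  qed
  have der: "((\<lambda>t. g t - X - t * v) has_real_derivative g' - v) (at t)" if "(g has_real_derivative g') (at t)" for g g' t
    using DERIV_diff[OF DERIV_diff[OF that DERIV_const] DERIV_cmult_right[OF DERIV_ident]] by simp
  have der2: "((\<lambda>t. g t - v) has_real_derivative g') (at t)" if "(g has_real_derivative g') (at t)" for g g' t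
    using DERIV_diff[OF that DERIV_const] by simp
  have unfold: "((\<lambda>a'. fs a' 0 - fu a' 0) has_real_derivative D * d) (at a)"
    using DERIV_chain2[OF _ d, of "\<lambda>l. gs l 0 - gu l 0" D] D(1) by (simp add: ev fs_def fu_def)
  \<comment> \<open>The fixed point lies on the diagonal, while the enclosures put X near -1.66 and
    Y near 1.72.\<close>
  have q: "(X, Y) \<noteq> henon_fp a b"
  proof
    assume "(X, Y) = henon_fp a b"
    then have "X = Y" by (simp add: henon_fp_def Let_def)
    have "jv (fst (unst_jet l u)) = X" "jv (snd (unst_jet l u)) = Y"
      using jet_onD(1)[OF jet_on_boxes(1) lL u] jet_onD(1)[OF jet_on_boxes(2) lL u] by (simp_all add: X_def Y_def)
    with box_enclosures(1)[OF lL u] have "\<bar>X * 2 ^ 32 + 7110284392\<bar> \<le> 13745935" "\<bar>Y * 2 ^ 32 - 7407161141\<bar> \<le> 2456667"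
      unfolding unstable_ball_box encl_pair_def encl_jet_def by simp_all
    with \<open>X = Y\<close> show False unfolding abs_le_iff by simp
  qed
  have "quadratic_generic_homoclinic_tangency a b"
    unfolding quadratic_generic_homoclinic_tangency_def
  proof (intro exI conjI ballI)
    show "(X, Y) \<noteq> henon_fp a b" by (rule q)
    show "fst (v, 1 :: real) * snd (1 :: real, 0 :: real) - snd (v, 1 :: real) * fst (1 :: real, 0 :: real) \<noteq> 0" by simp
    show "0 < e" "0 < \<epsilon>" by fact+
    show "continuous_on ({a - e<..<a + e} \<times> {- \<epsilon><..<\<epsilon>}) (\<lambda>(a', t). fs a' t)"
      "continuous_on ({a - e<..<a + e} \<times> {- \<epsilon><..<\<epsilon>}) (\<lambda>(a', t). fu a' t)"
      unfolding fs_def fu_def by (rule cont[OF gs_cont] cont[OF gu_cont]; assumption)+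
    show "fs a 0 = 0" "fu a 0 = 0" by (simp_all add: fs_def fu_def ev g0 X_def)
    show "(fs a has_real_derivative gs' t - v) (at t)" "(fu a has_real_derivative gu' t - v) (at t)"
      if "t \<in> {- \<epsilon><..<\<epsilon>}" for t
      using der[OF gs'] der[OF gu'] that unfolding fs_def[abs_def] fu_def[abs_def] ev by (auto simp: abs_less_iff)
    show "gs' 0 - v = 0" "gu' 0 - v = 0" using tangent by (simp_all add: v_def)
    show "((\<lambda>t. gs' t - v) has_real_derivative gs'') (at 0)" "((\<lambda>t. gu' t - v) has_real_derivative gu'') (at 0)"
      by (rule der2[OF gs''] der2[OF gu''])+
    show "gs'' \<noteq> gu''" by (rule ne)
    show "((\<lambda>a'. fs a' 0 - fu a' 0) has_real_derivative D * d) (at a)" by (rule unfold)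
    show "D * d \<noteq> 0" using D(2) d0 by simp
  qed (use in_stable in_unstable in auto)
  then show ?thesis using la unfolding a_def by blast
qed

end

theorem mainTheorem1:
  fixes a0 :: real
  assumes "a0 = 1.3145271093265"
  shows "\<exists>B :: real set. open B \<and> (-0.3 :: real) \<in> B \<and>
           (\<forall>b \<in> B. \<exists>a \<in> {a0 - 10 powr -5 .. a0 + 10 powr -5}.
              quadratic_generic_homoclinic_tangency a b)"
proof (intro exI[of _ "{- 3 / 10 - 1 / 10 ^ 9<..<- 3 / 10 + 1 / 10 ^ 9}"] conjI ballI)
  fix b :: real assume "b \<in> {- 3 / 10 - 1 / 10 ^ 9<..<- 3 / 10 + 1 / 10 ^ 9}"
  then interpret near_parameter b
    by unfold_locales (simp only: abs_less_iff greaterThanLessThan_iff, linarith)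
  obtain a where a: "\<bar>a * 2 ^ 32 - 5645850945\<bar> \<le> 32109" "quadratic_generic_homoclinic_tangency a b"
    using exists_tangency by blast
  have "10 powr - 5 = (1 / 10 ^ 5 :: real)"
    by (simp add: powr_minus_divide)
  then have "a \<in> {a0 - 10 powr -5 .. a0 + 10 powr -5}"
    using a(1) assms unfolding abs_le_iff by simp
  with a(2) show "\<exists>a \<in> {a0 - 10 powr -5 .. a0 + 10 powr -5}. quadratic_generic_homoclinic_tangency a b" by blast
qed auto


end
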